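(* Let $K$ be a closed curve in $\mathbb{R}^3$ that admits a knotted inscribed polygon. Then its second hull $h_2(K)$ is nonempty; that is, there is a point $p\in\mathbb{R}^3$ such that $K$ cuts every plane through $p$ at least four times.
   Context: A closed curve $K$ in $\mathbb{R}^d$ is a continuous map from the circle to $\mathbb{R}^d$, modulo reparametrization. An inscribed polygon of $K$ is a closed polygon whose vertices lie on $K$ in cyclic order along $K$; it is knotted if it is an embedded closed polygon that is a nontrivial knot. The $n$th hull $h_n(K)$ of a closed curve $K$ in $\mathbb{R}^d$ is the set of points $p\in\mathbb{R}^d$ such that $K$ cuts every hyperplane through $p$ at least $2n$ times, with the following counting conventions. Orient $K$ and, given a hyperplane $P$, call its two sides "above" and "below". Consider the connected components of the pullback of $K\cap P$ to the domain circle. If $K\subset P$, then $K$ cuts $P$ twice (once in either direction). If there are infinitely many components, $K$ cuts $P$ infinitely often. Otherwise each component is preceded and followed by open arcs of $K$, each lying to one side of $P$; a component is an upward intersection if it is preceded by an arc below $P$ or followed by an arc above $P$, and a downward intersection if it is preceded by an arc above $P$ or followed by an arc below $P$. The number of times $K$ cuts $P$ is the number of upward intersections plus the number of downward intersections; thus a component preceded and followed by arcs on the same side of $P$ counts twice, and one preceded and followed by arcs on opposite sides counts once. *)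

theory Defs
  imports "HOL-Analysis.Analysis" "HOL-Library.Extended_Nat"
begin

text \<open>A closed curve is represented by a map on the unit circle of the complex plane,
  oriented counterclockwise, i.e. by increasing \<open>t\<close> in \<open>cis t\<close>. Values off the circle are
  irrelevant.\<close>

definition closed_curve :: "(complex \<Rightarrow> 'a::euclidean_space) \<Rightarrow> bool" where
  "closed_curve K \<longleftrightarrow> continuous_on (sphere 0 1) K"

text \<open>The hyperplane given by \<open>u \<noteq> 0\<close> and \<open>c\<close> is \<open>{x. u \<bullet> x = c}\<close>; its side above is
  \<open>{x. u \<bullet> x > c}\<close>.\<close>

definition intersection_components ::
    "(complex \<Rightarrow> 'a::euclidean_space) \<Rightarrow> 'a \<Rightarrow> real \<Rightarrow> complex set set" where
  "intersection_components K u c = components {z \<in> sphere 0 1. u \<bullet> K z = c}"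

text \<open>In the next two definitions, \<open>C = cis ` {a..b}\<close> determines \<open>a\<close> and \<open>b\<close> modulo \<open>2 * pi\<close>
  unless \<open>C\<close> is the whole circle; no component is the whole circle when they are used in
  \<open>cuts\<close>.\<close>

definition preceded_by :: "(complex \<Rightarrow> 'a) \<Rightarrow> complex set \<Rightarrow> 'a set \<Rightarrow> bool" where
  "preceded_by K C S \<longleftrightarrow>
     (\<exists>a b e. a \<le> b \<and> 0 < e \<and> C = cis ` {a..b} \<and> (\<forall>t\<in>{a - e<..<a}. K (cis t) \<in> S))"

definition followed_by :: "(complex \<Rightarrow> 'a) \<Rightarrow> complex set \<Rightarrow> 'a set \<Rightarrow> bool" where
  "followed_by K C S \<longleftrightarrow>
     (\<exists>a b e. a \<le> b \<and> 0 < e \<and> C = cis ` {a..b} \<and> (\<forall>t\<in>{b<..<b + e}. K (cis t) \<in> S))"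

definition upward_intersections ::
    "(complex \<Rightarrow> 'a::euclidean_space) \<Rightarrow> 'a \<Rightarrow> real \<Rightarrow> complex set set" where
  "upward_intersections K u c =
     {C \<in> intersection_components K u c.
        preceded_by K C {x. u \<bullet> x < c} \<or> followed_by K C {x. u \<bullet> x > c}}"

definition downward_intersections ::
    "(complex \<Rightarrow> 'a::euclidean_space) \<Rightarrow> 'a \<Rightarrow> real \<Rightarrow> complex set set" where
  "downward_intersections K u c =
     {C \<in> intersection_components K u c.
        preceded_by K C {x. u \<bullet> x > c} \<or> followed_by K C {x. u \<bullet> x < c}}"

definition cuts :: "(complex \<Rightarrow> 'a::euclidean_space) \<Rightarrow> 'a \<Rightarrow> real \<Rightarrow> enat" where
  "cuts K u c =
     (if K ` sphere 0 1 \<subseteq> {x. u \<bullet> x = c} then 2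
      else if infinite (intersection_components K u c) then \<infinity>
      else enat (card (upward_intersections K u c) + card (downward_intersections K u c)))"

definition hull_n :: "nat \<Rightarrow> (complex \<Rightarrow> 'a::euclidean_space) \<Rightarrow> 'a set" where
  "hull_n n K = {p. \<forall>u. u \<noteq> 0 \<longrightarrow> enat (2 * n) \<le> cuts K u (u \<bullet> p)}"

fun polygonal_path :: "'a::real_normed_vector list \<Rightarrow> real \<Rightarrow> 'a" where
  "polygonal_path [] = linepath 0 0"
| "polygonal_path [a] = linepath a a"
| "polygonal_path [a, b] = linepath a b"
| "polygonal_path (a # b # c # vs) = linepath a b +++ polygonal_path (b # c # vs)"

definition closed_polygon :: "'a::real_normed_vector list \<Rightarrow> real \<Rightarrow> 'a" where
  "closed_polygon vs = polygonal_path (vs @ [hd vs])"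

definition inscribed_polygon :: "(complex \<Rightarrow> 'a) \<Rightarrow> 'a list \<Rightarrow> bool" where
  "inscribed_polygon K vs \<longleftrightarrow>
     vs \<noteq> [] \<and>
     (\<exists>a ts. sorted_wrt (<) ts \<and> set ts \<subseteq> {a..<a + 2 * pi} \<and> vs = map (\<lambda>t. K (cis t)) ts)"

text \<open>A homotopy from the identity through homeomorphisms of the whole space is an ambient
  isotopy.\<close>

definition ambient_isotopic :: "'a::euclidean_space set \<Rightarrow> 'a set \<Rightarrow> bool" where
  "ambient_isotopic A B \<longleftrightarrow>
     (\<exists>h. homotopic_with_canon (\<lambda>k. \<exists>k'. homeomorphism UNIV UNIV k k') UNIV UNIV id h \<and>
          h ` A = B)"

definition trivial_knot :: "(real ^ 3) set \<Rightarrow> bool" where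
  "trivial_knot A \<longleftrightarrow> ambient_isotopic A {x. norm x = 1 \<and> x $ 3 = 0}"

text \<open>On a loop, \<open>simple_path\<close> means injective up to the coincidence of the two endpoints; for
  \<open>closed_polygon vs\<close> this forces at least three vertices, all distinct.\<close>

definition knotted_polygon :: "(real ^ 3) list \<Rightarrow> bool" where
  "knotted_polygon vs \<longleftrightarrow>
     simple_path (closed_polygon vs) \<and> \<not> trivial_knot (path_image (closed_polygon vs))"

end

theory Submission imports Defs begin

text \<open>Suppose that every point \<open>p\<close> lies on a plane that an inscribed polygon crosses at most twice, in the sense
  that its vertices above the plane are consecutive, and so are those below. Such a plane splits the polygon
  into two arcs, each in an open half-space, and further such planes split these arcs again. Call an arc in an
  open convex cell trivial if moves across triangles inside the cell turn it into a path of two segments.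
  If both pieces of an arc are trivial in their half-cells, so is the arc. If some arc were not
  trivial, Zorn's lemma would give a minimal compact convex set \<open>C\<close> such that every neighbourhood of \<open>C\<close>
  contains a cell with a nontrivial arc. Take \<open>p\<close> in the relative interior of \<open>C\<close>, and its plane \<open>P\<close>. If
  \<open>C\<close> is not inside \<open>P\<close>, cutting along a parallel plane makes \<open>C\<close> smaller. If it is, nontrivial arcs exist
  arbitrarily close to \<open>P\<close>; but close to \<open>P\<close> all planes parallel to \<open>P\<close> meet the arc at most twice, so its height
  function has at most one maximum and one minimum, and it can be shortened vertex by vertex.\<close>

section \<open>Isotopies close to the identity\<close>

text \<open>The hypothesis gives one plane through each point, with no control of its direction and
  no continuity in the point, so no fixed subdivision into small cells is at hand; compactness, in
  the form of a minimal set, takes its place. Two features of the cutting step shape the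
  definitions. If a plane is crossed twice, the part on one side consists of two pieces and becomes
  an arc only after a new chord joins them. The arcs that arise are therefore not sub-arcs of the
  polygon; what they inherit is the relation \<open>dominates\<close>: each plane that meets the
  original polygon well still meets them well. And pieces are replaced one at a time while the rest
  stays fixed, so triviality is tested against every possible remainder outside the cell, by the
  relation \<open>eqv\<close>. Crossing at most twice is stated separately for the vertices strictly
  above and strictly below a plane; in this form it persists at nearby parallel levels, so a cutting
  level can be moved off all vertices. The curve enters only at the end: three sign changes along a
  closed inscribed polygon force four cuts of the curve.\<close>

lemma homeomorphism_id_plus_contraction:
  fixes g :: "'a::euclidean_space \<Rightarrow> 'a"
  assumes k: "k < 1" and lip: "\<And>x y. norm (g x - g y) \<le> k * norm (x - y)"
  shows "\<exists>f'. homeomorphism UNIV UNIV (\<lambda>x. x + g x) f'"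
proof (cases "0 \<le> k")
  case False
  have "x = y" for x y :: 'a
  proof (rule ccontr)
    assume "x \<noteq> y"
    then have "k * norm (x - y) < 0" using False by (simp add: mult_neg_pos)
    then show False using lip[of x y] norm_ge_zero[of "g x - g y"] by linarith
  qed
  then have "(\<lambda>x. x + g x) = id" by (intro ext)
  then show ?thesis
    by (intro exI[of _ id]) (auto simp: homeomorphism_def id_def)
next
  case True
  let ?f = "\<lambda>x. x + g x"
  have low: "(1 - k) * norm (x - y) \<le> norm (?f x - ?f y)" for x y
  proof -
    have "norm (x - y) \<le> norm (?f x - ?f y) + norm (g x - g y)"
      using norm_triangle_ineq4[of "?f x - ?f y" "g x - g y"] by (simp add: algebra_simps)
    then show ?thesis using lip[of x y] by (simp add: algebra_simps)
  qed
  have inj: "inj ?f"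
  proof (rule injI)
    fix x y assume "?f x = ?f y"
    then have "(1 - k) * norm (x - y) \<le> 0" using low[of x y] by simp
    then have "norm (x - y) \<le> 0" using k by (simp add: mult_le_0_iff)
    then show "x = y" by simp
  qed
  have surj: "\<exists>x. ?f x = y" for y
  proof -
    \<comment> \<open>A preimage of \<open>y\<close> is a fixed point of the contraction that sends
      \<open>x\<close> to \<open>y - g x\<close>.\<close>
    have "\<exists>!x. y - g x = x"
      by (rule banach_fix_type[OF True k])
         (auto simp: dist_norm norm_minus_commute intro: order_trans[OF _ lip])
    then obtain x where "y - g x = x" by blast
    then have "x + g x = y" by (metis diff_add_cancel)
    then show ?thesis ..
  qed
  have bij: "bij ?f" using inj surj unfolding bij_def surj_def by metis
  have fi: "inv ?f x + g (inv ?f x) = x" for x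
    using surj_f_inv_f[OF bij_is_surj[OF bij], of x] .
  have contg: "continuous_on UNIV g"
  proof (rule lipschitz_on_continuous_on)
    show "k-lipschitz_on UNIV g"
      using True lip by (auto simp: lipschitz_on_def dist_norm)
  qed
  have contf: "continuous_on UNIV ?f" by (intro continuous_intros contg)
  have contf': "continuous_on UNIV (inv ?f)"
  proof (rule lipschitz_on_continuous_on)
    show "(1/(1-k))-lipschitz_on UNIV (inv ?f)"
    proof (rule lipschitz_onI)
      fix x y
      have "(1 - k) * norm (inv ?f x - inv ?f y) \<le> norm (x - y)"
        using low[of "inv ?f x" "inv ?f y"] unfolding fi .
      then show "dist (inv ?f x) (inv ?f y) \<le> 1/(1-k) * dist x y"
        using k by (simp add: dist_norm field_simps)
    qed (use k in auto)
  qed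
  have "homeomorphism UNIV UNIV ?f (inv ?f)"
    using contf contf' inj
    by (intro homeomorphismI) (simp_all add: fi inv_f_f[OF inj])
  then show ?thesis by blast
qed

lemma ambient_isotopicI:
  fixes H :: "real \<Rightarrow> 'a::euclidean_space \<Rightarrow> 'a"
  assumes "continuous_on ({0..1} \<times> UNIV) (\<lambda>p. H (fst p) (snd p))"
    and "\<And>x. H 0 x = x"
    and "\<And>t. t \<in> {0..1} \<Longrightarrow> \<exists>k'. homeomorphism UNIV UNIV (H t) k'"
  shows "ambient_isotopic A (H 1 ` A)"
proof -
  have top: "prod_topology (top_of_set {0..1::real}) (top_of_set (UNIV :: 'a set)) =
      top_of_set ({0..1} \<times> UNIV)"
    by (simp only: prod_topology_subtopology_eu)
  have cm: "continuous_map (top_of_set ({0..1} \<times> UNIV)) (top_of_set UNIV) (\<lambda>p. H (fst p) (snd p))"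
    using assms(1) by (simp add: continuous_map_iff_continuous)
  have "homotopic_with_canon (\<lambda>k. \<exists>k'. homeomorphism UNIV UNIV k k') UNIV UNIV id (H 1)"
    unfolding homotopic_with_def top
    by (rule exI[of _ "\<lambda>p. H (fst p) (snd p)"])
       (use assms cm in auto)
  then show ?thesis
    unfolding ambient_isotopic_def by blast
qed

text \<open>Along the straight homotopy from the identity, each stage adds \<open>t\<close> times
  \<open>g\<close> with \<open>t\<close> in the unit interval, again a contraction, so each stage is
  a homeomorphism.\<close>

lemma ambient_isotopic_id_plus_contraction:
  fixes g :: "'a::euclidean_space \<Rightarrow> 'a"
  assumes k: "k < 1" and lip: "\<And>x y. norm (g x - g y) \<le> k * norm (x - y)"
  shows "ambient_isotopic A ((\<lambda>x. x + g x) ` A)"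
proof -
  have "norm (g x - g y) \<le> \<bar>k\<bar> * norm (x - y)" for x y
    using lip[of x y] mult_right_mono[of k "\<bar>k\<bar>" "norm (x - y)"] abs_ge_self[of k]
      norm_ge_zero[of "x - y"] by linarith
  then have contg: "continuous_on UNIV g"
    by (intro lipschitz_on_continuous_on[of "\<bar>k\<bar>"]) (auto simp: lipschitz_on_def dist_norm)
  have "ambient_isotopic A ((\<lambda>t x. x + t *\<^sub>R g x) 1 ` A)"
  proof (rule ambient_isotopicI)
    show "continuous_on ({0..1} \<times> UNIV) (\<lambda>p. snd p + fst p *\<^sub>R g (snd p))"
      by (intro continuous_intros continuous_on_compose2[OF contg]) auto
  next
    fix t :: real assume t: "t \<in> {0..1}"
    show "\<exists>k'. homeomorphism UNIV UNIV (\<lambda>x. x + t *\<^sub>R g x) k'"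
    proof (rule homeomorphism_id_plus_contraction)
      show "max 0 k < 1" using k by simp
      fix x y
      have "norm (t *\<^sub>R g x - t *\<^sub>R g y) = t * norm (g x - g y)"
        using t by (simp flip: scaleR_diff_right)
      also have "\<dots> \<le> 1 * norm (g x - g y)"
        using t by (intro mult_right_mono) auto
      also have "\<dots> \<le> max 0 k * norm (x - y)"
        using lip[of x y] mult_right_mono[of k "max 0 k" "norm (x - y)"]
          max.cobounded2[of k 0] norm_ge_zero[of "x - y"] by linarith
      finally show "norm (t *\<^sub>R g x - t *\<^sub>R g y) \<le> max 0 k * norm (x - y)" .
    qed
  qed simp
  then show ?thesis by simp
qed

lemma ambient_isotopic_refl: "ambient_isotopic A A"
  using ambient_isotopic_id_plus_contraction[of 0 "\<lambda>x. 0" A] by simp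

lemma ambient_isotopic_trans:
  assumes "ambient_isotopic A B" "ambient_isotopic B C"
  shows "ambient_isotopic A C"
proof -
  let ?P = "\<lambda>k. \<exists>k'. homeomorphism UNIV UNIV k k'"
  obtain h where h: "homotopic_with_canon ?P UNIV UNIV id h" "h ` A = B"
    using assms unfolding ambient_isotopic_def by blast
  obtain g where g: "homotopic_with_canon ?P UNIV UNIV id g" "g ` B = C"
    using assms unfolding ambient_isotopic_def by blast
  obtain h' where h': "homeomorphism UNIV UNIV h h'"
    using homotopic_with_imp_property[OF h(1)] by blast
  have "homotopic_with_canon ?P UNIV UNIV (id \<circ> h) (g \<circ> h)"
  proof (rule homotopic_with_compose_continuous_map_right[OF g(1)])
    show "continuous_map (top_of_set UNIV) (top_of_set UNIV) h"
      using h' by (simp add: homeomorphism_def)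
    show "\<exists>k'. homeomorphism UNIV UNIV (j \<circ> h) k'" if "?P j" for j
      using that homeomorphism_compose[OF h'] by blast
  qed
  then have "homotopic_with_canon ?P UNIV UNIV id (g \<circ> h)"
    using homotopic_with_trans[OF h(1)] by simp
  moreover have "(g \<circ> h) ` A = C"
    using h(2) g(2) by (metis image_comp)
  ultimately show ?thesis
    unfolding ambient_isotopic_def by blast
qed

text \<open>Triviality travels backwards along an isotopy, by transitivity alone; an equivalence
  takes isotopies in both directions.\<close>

lemma trivial_knot_ambient_isotopic:
  "ambient_isotopic A B \<Longrightarrow> trivial_knot B \<Longrightarrow> trivial_knot A"
  unfolding trivial_knot_def by (rule ambient_isotopic_trans)

section \<open>Moves across triangles\<close>

text \<open>The fixed rest of a knot is kept piecewise linear: a segment that touches a triangle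
  only at a vertex leaves it at a linear rate, which makes Lipschitz bump functions
  possible.\<close>

definition finseg :: "'a::real_vector set \<Rightarrow> bool" where
  "finseg Z \<longleftrightarrow> (\<exists>S. finite S \<and> Z = (\<Union>(x, y)\<in>S. closed_segment x y))"

lemma finseg_empty [simp]: "finseg {}"
  unfolding finseg_def by (rule exI[of _ "{}"]) auto

lemma finseg_segment [simp]: "finseg (closed_segment x y)"
  unfolding finseg_def by (rule exI[of _ "{(x, y)}"]) auto

lemma finseg_singleton [simp]: "finseg {x}"
  using finseg_segment[of x x] by simp

lemma finseg_Un [simp]: "finseg A \<Longrightarrow> finseg B \<Longrightarrow> finseg (A \<union> B)"
  unfolding finseg_def
proof (elim exE conjE)
  fix S T assume "finite S" "A = (\<Union>(x, y)\<in>S. closed_segment x y)"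
    "finite T" "B = (\<Union>(x, y)\<in>T. closed_segment x y)"
  then show "\<exists>S. finite S \<and> A \<union> B = (\<Union>(x, y)\<in>S. closed_segment x y)"
    by (intro exI[of _ "S \<union> T"]) auto
qed

lemma finseg_compact:
  fixes Z :: "'a::euclidean_space set"
  shows "finseg Z \<Longrightarrow> compact Z"
  unfolding finseg_def by (auto intro!: compact_UN)

text \<open>Affine independence of three points, in the form in which coefficients are
  compared.\<close>

definition nondeg :: "'a::real_vector \<Rightarrow> 'a \<Rightarrow> 'a \<Rightarrow> bool" where
  "nondeg a b c \<longleftrightarrow> (\<forall>r q. r *\<^sub>R (b - a) + q *\<^sub>R (c - a) = 0 \<longrightarrow> r = 0 \<and> q = 0)"

lemma nondegD: "nondeg a b c \<Longrightarrow> r *\<^sub>R (b - a) + q *\<^sub>R (c - a) = 0 \<Longrightarrow> r = 0 \<and> q = 0"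
  unfolding nondeg_def by blast

lemma nondeg_swap: "nondeg a b c \<Longrightarrow> nondeg a c b"
  unfolding nondeg_def by (metis add.commute)

lemma nondeg_rot:
  assumes "nondeg a b c" shows "nondeg c b a"
  unfolding nondeg_def
proof (intro allI impI)
  fix r q assume "r *\<^sub>R (b - c) + q *\<^sub>R (a - c) = 0"
  then have "r *\<^sub>R (b - a) + (- r - q) *\<^sub>R (c - a) = 0"
    by (simp add: algebra_simps)
  from nondegD[OF assms this] show "r = 0 \<and> q = 0" by auto
qed

lemma nondeg_distinct: "nondeg a b c \<Longrightarrow> a \<noteq> b \<and> b \<noteq> c \<and> a \<noteq> c"
proof -
  assume n: "nondeg a b c"
  have "a \<noteq> b" using nondegD[OF n, of 1 0] by auto
  moreover have "a \<noteq> c" using nondegD[OF n, of 0 1] by auto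
  moreover have "b \<noteq> c" using nondegD[OF n, of 1 "-1"] by auto
  ultimately show ?thesis by blast
qed

lemma nondeg_functional:
  fixes a b c :: "'a::real_inner"
  assumes "nondeg a b c"
  shows "\<exists>f. f \<bullet> (b - a) = 1 \<and> f \<bullet> (c - a) = 0"
proof -
  define p q where "p = b - a" and "q = c - a"
  \<comment> \<open>A Gram-Schmidt step, multiplied through by \<open>q \<bullet> q\<close>:
    \<open>e\<close> is orthogonal to \<open>q\<close> and only has to be normalised against
    \<open>p\<close>.\<close>
  define e where "e = (q \<bullet> q) *\<^sub>R p - (p \<bullet> q) *\<^sub>R q"
  have "q \<noteq> 0" using nondeg_distinct[OF assms] by (auto simp: q_def)
  then have qq: "q \<bullet> q > 0" by simp
  have e0: "e \<noteq> 0"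
  proof
    assume "e = 0"
    then have "(q \<bullet> q) *\<^sub>R (b - a) + (- (p \<bullet> q)) *\<^sub>R (c - a) = 0"
      by (simp add: e_def p_def q_def)
    from nondegD[OF assms this] qq show False by simp
  qed
  have eq: "e \<bullet> q = 0" by (simp add: e_def inner_diff_left)
  have "e \<bullet> e = (q \<bullet> q) * (e \<bullet> p)"
    using eq by (subst (2) e_def) (simp add: inner_diff_right)
  then have ep: "e \<bullet> p > 0" using e0 qq by (metis inner_gt_zero_iff zero_less_mult_pos)
  show ?thesis
    by (rule exI[of _ "e /\<^sub>R (e \<bullet> p)"]) (use eq ep in \<open>simp add: p_def q_def\<close>)
qed

section \<open>Linear lower bounds for the distance to a triangle\<close>

lemma triangle_coords:
  "x \<in> convex hull {a, b, c} \<longleftrightarrow>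
    (\<exists>r q. 0 \<le> r \<and> 0 \<le> q \<and> r + q \<le> 1 \<and> x = a + r *\<^sub>R (b - a) + q *\<^sub>R (c - a))"
  unfolding convex_hull_3_alt by auto

text \<open>Both sides are homogeneous of degree one in \<open>r\<close>, \<open>q\<close>,
  \<open>l\<close>, so a positive minimum on the compact simplex \<open>r + q + l = 1\<close> is
  enough. A zero there would give a common point other than \<open>a\<close>, or contradict
  nondegeneracy.\<close>

lemma cone_segment_bound:
  fixes a b c e :: "'a::euclidean_space"
  assumes nd: "nondeg a b c" and ea: "e \<noteq> a"
    and int: "closed_segment a e \<inter> convex hull {a, b, c} \<subseteq> {a}"
  shows "\<exists>\<kappa>>0. \<forall>r q l. 0 \<le> r \<longrightarrow> 0 \<le> q \<longrightarrow> 0 \<le> l \<longrightarrow>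
     \<kappa> * (r + q) \<le> norm (r *\<^sub>R (b - a) + q *\<^sub>R (c - a) - l *\<^sub>R (e - a))"
proof -
  let ?N = "\<lambda>p::real\<times>real\<times>real. norm (fst p *\<^sub>R (b - a) + fst (snd p) *\<^sub>R (c - a) - snd (snd p) *\<^sub>R (e - a))"
  let ?S = "{p::real\<times>real\<times>real. 0 \<le> fst p \<and> 0 \<le> fst (snd p) \<and> 0 \<le> snd (snd p)
      \<and> fst p + fst (snd p) + snd (snd p) = 1}"
  have cl: "closed ?S"
    by (intro closed_Collect_conj closed_Collect_le closed_Collect_eq continuous_intros)
  have "?S \<subseteq> cbox (0,0,0) (1,1,1)"
    by (auto simp: cbox_Pair_eq)
  then have "compact ?S" using cl by (meson bounded_cbox bounded_subset compact_eq_bounded_closed)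
  moreover have "(1,0,0) \<in> ?S" by simp
  moreover have "continuous_on ?S ?N" by (intro continuous_intros)
  ultimately obtain p0 where p0: "p0 \<in> ?S" "\<And>p. p \<in> ?S \<Longrightarrow> ?N p0 \<le> ?N p"
    using continuous_attains_inf[of ?S ?N] by blast
  have pos: "?N p0 > 0"
  proof (rule ccontr)
    obtain r q l where p: "p0 = (r, q, l)" by (cases p0) auto
    assume "\<not> ?N p0 > 0"
    then have z: "r *\<^sub>R (b - a) + q *\<^sub>R (c - a) = l *\<^sub>R (e - a)" by (simp add: p)
    have rql: "0 \<le> r" "0 \<le> q" "0 \<le> l" "r + q + l = 1" using p0(1) p by auto
    let ?w = "a + l *\<^sub>R (e - a)"
    have "?w \<in> closed_segment a e"
      unfolding closed_segment_def using rql
      by (auto simp: algebra_simps intro!: exI[of _ l])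
    moreover have "?w \<in> convex hull {a, b, c}"
      unfolding triangle_coords using rql z
      by (intro exI[of _ r] exI[of _ q]) (simp add: add.assoc)
    ultimately have "?w = a" using int by blast
    then have "l = 0" using ea by simp
    then have "r = 0 \<and> q = 0" using z by (intro nondegD[OF nd]) simp
    then show False using rql \<open>l = 0\<close> by simp
  qed
  show ?thesis
  proof (intro exI[of _ "?N p0"] conjI pos allI impI)
    fix r q l :: real assume rql: "0 \<le> r" "0 \<le> q" "0 \<le> l"
    define s where "s = r + q + l"
    show "?N p0 * (r + q) \<le> norm (r *\<^sub>R (b - a) + q *\<^sub>R (c - a) - l *\<^sub>R (e - a))"
    proof (cases "s = 0")
      case True
      then have "r = 0" "q = 0" "l = 0" using rql by (auto simp: s_def)
      then show ?thesis by simp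
    next
      case False
      then have s: "s > 0" using rql by (auto simp: s_def)
      have "(r/s, q/s, l/s) \<in> ?S" using rql s by (auto simp: s_def add_divide_distrib[symmetric])
      from p0(2)[OF this]
      have "?N p0 \<le> norm ((1/s) *\<^sub>R (r *\<^sub>R (b - a) + q *\<^sub>R (c - a) - l *\<^sub>R (e - a)))"
        by (simp add: scaleR_right_diff_distrib scaleR_right_distrib)
      also have "\<dots> = norm (r *\<^sub>R (b - a) + q *\<^sub>R (c - a) - l *\<^sub>R (e - a)) / s"
        using s by (simp only: norm_scaleR) simp
      finally have "?N p0 * s \<le> norm (r *\<^sub>R (b - a) + q *\<^sub>R (c - a) - l *\<^sub>R (e - a))"
        using s by (simp only: pos_le_divide_eq)
      moreover have "?N p0 * (r + q) \<le> ?N p0 * s"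
        using rql by (intro mult_left_mono) (auto simp: s_def)
      ultimately show ?thesis by linarith
    qed
  qed
qed

lemma vertex_segment_bound:
  fixes a b c e :: "'a::euclidean_space"
  assumes nd: "nondeg a b c"
    and int: "closed_segment a e \<inter> convex hull {a, b, c} \<subseteq> {a}"
  shows "\<exists>M\<ge>0. \<forall>r q. 0 \<le> r \<longrightarrow> 0 \<le> q \<longrightarrow>
     (\<forall>z\<in>closed_segment a e. r + q \<le> M * norm (a + r *\<^sub>R (b - a) + q *\<^sub>R (c - a) - z))"
proof -
  have *: "\<exists>M\<ge>0. \<forall>r q. 0 \<le> r \<longrightarrow> 0 \<le> q \<longrightarrow>
     (\<forall>z\<in>closed_segment a e. r + q \<le> M * norm (a + r *\<^sub>R (b - a) + q *\<^sub>R (c - a) - z))"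
    if ea: "e \<noteq> a" and int: "closed_segment a e \<inter> convex hull {a, b, c} \<subseteq> {a}" for e
  proof -
    obtain \<kappa> where k: "\<kappa> > 0" "\<And>r q l. 0 \<le> r \<Longrightarrow> 0 \<le> q \<Longrightarrow> 0 \<le> l \<Longrightarrow>
     \<kappa> * (r + q) \<le> norm (r *\<^sub>R (b - a) + q *\<^sub>R (c - a) - l *\<^sub>R (e - a))"
      using cone_segment_bound[OF nd ea int] by blast
    show ?thesis
    proof (intro exI[of _ "1/\<kappa>"] conjI allI impI ballI)
      fix r q :: real and z assume rq: "0 \<le> r" "0 \<le> q" and "z \<in> closed_segment a e"
      then obtain l where l: "0 \<le> l" "z = (1 - l) *\<^sub>R a + l *\<^sub>R e"
        by (auto simp: closed_segment_def)
      have "a + r *\<^sub>R (b - a) + q *\<^sub>R (c - a) - z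
          = r *\<^sub>R (b - a) + q *\<^sub>R (c - a) - l *\<^sub>R (e - a)"
        unfolding l(2) by (simp add: algebra_simps)
      then have "(r + q) * \<kappa> \<le> norm (a + r *\<^sub>R (b - a) + q *\<^sub>R (c - a) - z)"
        using k(2)[OF rq l(1)] by (simp only: mult.commute)
      then show "r + q \<le> 1/\<kappa> * norm (a + r *\<^sub>R (b - a) + q *\<^sub>R (c - a) - z)"
        using k(1) by (simp only: times_divide_eq_left mult_1 pos_le_divide_eq)
    qed (use k in auto)
  qed
  show ?thesis
  proof (cases "e = a")
    case False then show ?thesis using *[OF False int] by blast
  next
    case True
    \<comment> \<open>The degenerate segment has no direction; the segment pointing away from
      \<open>b\<close> also starts at \<open>a\<close> and meets the triangle only there.\<close>
    define e' where "e' = a - (b - a)"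
    have "e' \<noteq> a" using nondeg_distinct[OF nd] by (simp add: e'_def)
    moreover have "closed_segment a e' \<inter> convex hull {a, b, c} \<subseteq> {a}"
    proof
      fix x assume x: "x \<in> closed_segment a e' \<inter> convex hull {a, b, c}"
      then obtain l where l: "0 \<le> l" "x = (1 - l) *\<^sub>R a + l *\<^sub>R e'"
        by (auto simp: closed_segment_def)
      obtain r q where rq: "0 \<le> r" "0 \<le> q" "x = a + r *\<^sub>R (b - a) + q *\<^sub>R (c - a)"
        using x by (auto simp: triangle_coords)
      have "(r + l) *\<^sub>R (b - a) + q *\<^sub>R (c - a) = 0"
        using l(2) rq(3) by (simp add: e'_def algebra_simps)
      from nondegD[OF nd this] rq l show "x \<in> {a}" by auto
    qed
    ultimately obtain M where "M \<ge> 0" "\<And>r q z. 0 \<le> r \<Longrightarrow> 0 \<le> q \<Longrightarrow> z \<in> closed_segment a e' \<Longrightarrow>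
        r + q \<le> M * norm (a + r *\<^sub>R (b - a) + q *\<^sub>R (c - a) - z)"
      using *[of e'] by blast
    then show ?thesis using True by (intro exI[of _ M]) (metis closed_segment_idem ends_in_segment(1) singletonD)
  qed
qed

lemma triangle_swap: "convex hull {c, b, a} = convex hull {a, b, c}"
  by (metis insert_commute)

text \<open>The left side is the future bump function. It is at most \<open>2 * (r + q)\<close> and
  at most \<open>2 * (1 - q)\<close>, hence linearly small at \<open>a\<close> and at
  \<open>c\<close>. A segment through one of these points is split there; one that misses the
  triangle has positive distance from it.\<close>

lemma segment_triangle_bound:
  fixes a b c d e :: "'a::euclidean_space"
  assumes nd: "nondeg a b c"
    and int: "closed_segment d e \<inter> convex hull {a, b, c} \<subseteq> {a, c}"
  shows "\<exists>M\<ge>0. \<forall>r q. 0 \<le> r \<longrightarrow> 0 \<le> q \<longrightarrow> r + q \<le> 1 \<longrightarrow>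
     (\<forall>z\<in>closed_segment d e. r + 2 * min (1 - r - q) q \<le> M * norm (a + r *\<^sub>R (b - a) + q *\<^sub>R (c - a) - z))"
    (is "?G d e")
proof -
  have at_a: "?G a e" if H: "closed_segment a e \<inter> convex hull {a, b, c} \<subseteq> {a}" for e
  proof -
    obtain M where M: "M \<ge> 0" "\<And>r q z. 0 \<le> r \<Longrightarrow> 0 \<le> q \<Longrightarrow> z \<in> closed_segment a e \<Longrightarrow>
        r + q \<le> M * norm (a + r *\<^sub>R (b - a) + q *\<^sub>R (c - a) - z)"
      using vertex_segment_bound[OF nd H] by blast
    show ?thesis
    proof (intro exI[of _ "2*M"] conjI allI impI ballI)
      fix r q z assume rq: "0 \<le> r" "0 \<le> q" "r + q \<le> (1::real)" "z \<in> closed_segment a e"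
      have "r + 2 * min (1 - r - q) q \<le> 2 * (r + q)" using rq by (simp add: min_def)
      also have "\<dots> \<le> 2 * (M * norm (a + r *\<^sub>R (b - a) + q *\<^sub>R (c - a) - z))"
        using M(2)[OF rq(1,2,4)] by (rule mult_left_mono) simp
      finally show "r + 2 * min (1 - r - q) q \<le> 2 * M * norm (a + r *\<^sub>R (b - a) + q *\<^sub>R (c - a) - z)"
        by (simp only: mult.assoc)
    qed (use M in auto)
  qed
  have at_c: "?G c e" if H: "closed_segment c e \<inter> convex hull {a, b, c} \<subseteq> {c}" for e
  proof -
    have "closed_segment c e \<inter> convex hull {c, b, a} \<subseteq> {c}" using H triangle_swap by metis
    from vertex_segment_bound[OF nondeg_rot[OF nd] this]
    obtain M where M: "M \<ge> 0" "\<And>r q z. 0 \<le> r \<Longrightarrow> 0 \<le> q \<Longrightarrow> z \<in> closed_segment c e \<Longrightarrow>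
        r + q \<le> M * norm (c + r *\<^sub>R (b - c) + q *\<^sub>R (a - c) - z)"
      by blast
    show ?thesis
    proof (intro exI[of _ "2*M"] conjI allI impI ballI)
      fix r q z assume rq: "0 \<le> r" "0 \<le> q" "r + q \<le> (1::real)" "z \<in> closed_segment c e"
      have "c + r *\<^sub>R (b - c) + (1 - r - q) *\<^sub>R (a - c) = a + r *\<^sub>R (b - a) + q *\<^sub>R (c - a)"
        by (simp add: algebra_simps)
      then have "r + (1 - r - q) \<le> M * norm (a + r *\<^sub>R (b - a) + q *\<^sub>R (c - a) - z)"
        using M(2)[of r "1 - r - q" z] rq by simp
      moreover have "r + 2 * min (1 - r - q) q \<le> 2 * (r + (1 - r - q))"
        using rq by (simp add: min_def)
      ultimately show "r + 2 * min (1 - r - q) q \<le> 2 * M * norm (a + r *\<^sub>R (b - a) + q *\<^sub>R (c - a) - z)"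
        unfolding mult.assoc by (meson mult_left_mono order_trans zero_le_numeral)
    qed (use M in auto)
  qed
  have union: "?G d e" if x: "x \<in> closed_segment d e" and xd: "?G x d" and xe: "?G x e" for x
  proof -
    obtain M where M: "M \<ge> 0" "\<And>r q z. 0 \<le> r \<Longrightarrow> 0 \<le> q \<Longrightarrow> r + q \<le> 1 \<Longrightarrow> z \<in> closed_segment x d \<Longrightarrow>
        r + 2 * min (1 - r - q) q \<le> M * norm (a + r *\<^sub>R (b - a) + q *\<^sub>R (c - a) - z)"
      using xd by blast
    obtain M' where M': "M' \<ge> 0" "\<And>r q z. 0 \<le> r \<Longrightarrow> 0 \<le> q \<Longrightarrow> r + q \<le> 1 \<Longrightarrow> z \<in> closed_segment x e \<Longrightarrow>
        r + 2 * min (1 - r - q) q \<le> M' * norm (a + r *\<^sub>R (b - a) + q *\<^sub>R (c - a) - z)"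
      using xe by blast
    show ?thesis
    proof (intro exI[of _ "max M M'"] conjI allI impI ballI)
      fix r q z assume rq: "0 \<le> r" "0 \<le> q" "r + q \<le> (1::real)" "z \<in> closed_segment d e"
      let ?n = "norm (a + r *\<^sub>R (b - a) + q *\<^sub>R (c - a) - z)"
      have "z \<in> closed_segment x d \<or> z \<in> closed_segment x e"
        using rq(4) Un_closed_segment[OF x] by (auto simp: closed_segment_commute)
      moreover have "M * ?n \<le> max M M' * ?n" "M' * ?n \<le> max M M' * ?n"
        by (auto intro: mult_right_mono)
      ultimately show "r + 2 * min (1 - r - q) q \<le> max M M' * ?n"
        using M(2)[of r q z] M'(2)[of r q z] rq(1-3) by fastforce
    qed (use M in auto)
  qed
  have ac: "a \<noteq> c" using nondeg_distinct[OF nd] by simp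
  \<comment> \<open>A segment through both points would contain their midpoint, a third point of the
    triangle.\<close>
  have notboth: "\<not> (a \<in> closed_segment d e \<and> c \<in> closed_segment d e)"
  proof
    assume "a \<in> closed_segment d e \<and> c \<in> closed_segment d e"
    then have "midpoint a c \<in> closed_segment d e"
      by (meson closed_segment_subset convex_closed_segment midpoint_in_closed_segment subsetD)
    moreover have "midpoint a c \<in> convex hull {a, b, c}"
      by (metis (no_types, lifting) closed_segment_subset convex_convex_hull hull_inc insertCI midpoint_in_closed_segment subsetD)
    ultimately show False using int ac by auto
  qed
  consider "a \<in> closed_segment d e" | "c \<in> closed_segment d e"
    | "closed_segment d e \<inter> convex hull {a, b, c} = {}"
    using int by blast
  then show ?thesis
  proof cases
    case 1
    have "closed_segment a d \<subseteq> closed_segment d e" "closed_segment a e \<subseteq> closed_segment d e"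
      using 1 by (auto simp: subset_closed_segment)
    then show ?thesis using 1 notboth int by (intro union[OF 1] at_a) blast+
  next
    case 2
    have "closed_segment c d \<subseteq> closed_segment d e" "closed_segment c e \<subseteq> closed_segment d e"
      using 2 by (auto simp: subset_closed_segment)
    then show ?thesis using 2 notboth int by (intro union[OF 2] at_c) blast+
  next
    case 3
    have "compact (convex hull {a, b, c})" by (simp add: finite_imp_compact_convex_hull)
    then obtain \<delta> where d: "\<delta> > 0" "\<And>x y. x \<in> convex hull {a, b, c} \<Longrightarrow> y \<in> closed_segment d e \<Longrightarrow> \<delta> \<le> dist x y"
      using separate_compact_closed[of "convex hull {a,b,c}" "closed_segment d e"] 3
      by (auto simp: Int_commute)
    show ?thesis
    proof (intro exI[of _ "1/\<delta>"] conjI allI impI ballI)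
      fix r q z assume rq: "0 \<le> r" "0 \<le> q" "r + q \<le> (1::real)" "z \<in> closed_segment d e"
      have "a + r *\<^sub>R (b - a) + q *\<^sub>R (c - a) \<in> convex hull {a, b, c}"
        unfolding triangle_coords using rq by blast
      from d(2)[OF this rq(4)]
      have "1 \<le> 1/\<delta> * norm (a + r *\<^sub>R (b - a) + q *\<^sub>R (c - a) - z)"
        using d(1) by (simp add: dist_norm field_simps)
      moreover have "r + 2 * min (1 - r - q) q \<le> 1" using rq by (simp add: min_def)
      ultimately show "r + 2 * min (1 - r - q) q \<le> 1/\<delta> * norm (a + r *\<^sub>R (b - a) + q *\<^sub>R (c - a) - z)"
        by linarith
    qed (use d in auto)
  qed
qed

lemma finseg_triangle_bound:
  fixes a b c :: "'a::euclidean_space"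
  assumes nd: "nondeg a b c" and fin: "finseg Z"
    and int: "Z \<inter> convex hull {a, b, c} \<subseteq> {a, c}"
  shows "\<exists>M\<ge>0. \<forall>r q. 0 \<le> r \<longrightarrow> 0 \<le> q \<longrightarrow> r + q \<le> 1 \<longrightarrow>
     (\<forall>z\<in>Z. r + 2 * min (1 - r - q) q \<le> M * norm (a + r *\<^sub>R (b - a) + q *\<^sub>R (c - a) - z))"
proof -
  obtain S where S: "finite S" "Z = (\<Union>(x, y)\<in>S. closed_segment x y)"
    using fin unfolding finseg_def by blast
  have "\<exists>M\<ge>0. \<forall>r q. 0 \<le> r \<longrightarrow> 0 \<le> q \<longrightarrow> r + q \<le> 1 \<longrightarrow>
     (\<forall>z\<in>closed_segment (fst s) (snd s).
        r + 2 * min (1 - r - q) q \<le> M * norm (a + r *\<^sub>R (b - a) + q *\<^sub>R (c - a) - z))" if "s \<in> S" for s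
    by (rule segment_triangle_bound[OF nd]) (use int S that in force)
  then obtain M where M: "\<And>s. s \<in> S \<Longrightarrow> 0 \<le> M s"
    "\<And>s r q z. s \<in> S \<Longrightarrow> 0 \<le> r \<Longrightarrow> 0 \<le> q \<Longrightarrow> r + q \<le> 1 \<Longrightarrow> z \<in> closed_segment (fst s) (snd s) \<Longrightarrow>
       r + 2 * min (1 - r - q) q \<le> M s * norm (a + r *\<^sub>R (b - a) + q *\<^sub>R (c - a) - z)"
    by metis
  show ?thesis
  proof (intro exI[of _ "sum M S"] conjI allI impI ballI)
    show "0 \<le> sum M S" using M(1) by (rule sum_nonneg)
    fix r q z assume rq: "0 \<le> r" "0 \<le> q" "r + q \<le> (1::real)" "z \<in> Z"
    then obtain s where s: "s \<in> S" "z \<in> closed_segment (fst s) (snd s)" using S(2) by force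
    have "M s \<le> sum M S" using M(1) S(1) s(1) by (intro member_le_sum) auto
    then have "M s * norm (a + r *\<^sub>R (b - a) + q *\<^sub>R (c - a) - z)
       \<le> sum M S * norm (a + r *\<^sub>R (b - a) + q *\<^sub>R (c - a) - z)" by (rule mult_right_mono) simp
    with M(2)[OF s(1) rq(1-3) s(2)]
    show "r + 2 * min (1 - r - q) q \<le> sum M S * norm (a + r *\<^sub>R (b - a) + q *\<^sub>R (c - a) - z)"
      by linarith
  qed
qed

lemma bump_lipschitz:
  fixes r q r' q' :: real
  shows "\<bar>r + 2 * min (1 - r - q) q - (r' + 2 * min (1 - r' - q') q')\<bar> \<le> 3 * \<bar>r - r'\<bar> + 4 * \<bar>q - q'\<bar>"
proof -
  have m: "\<bar>min a b - min c d\<bar> \<le> \<bar>a - c\<bar> + \<bar>b - d\<bar>" for a b c d :: real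
    by (auto simp: min_def)
  define k k' where "k = min (1 - r - q) q" and "k' = min (1 - r' - q') q'"
  have "\<bar>k - k'\<bar> \<le> \<bar>(1 - r - q) - (1 - r' - q')\<bar> + \<bar>q - q'\<bar>"
    unfolding k_def k'_def by (rule m)
  moreover have "\<bar>(1 - r - q) - (1 - r' - q')\<bar> \<le> \<bar>r - r'\<bar> + \<bar>q - q'\<bar>"
    by (auto simp: abs_if)
  ultimately have "\<bar>k - k'\<bar> \<le> \<bar>r - r'\<bar> + 2 * \<bar>q - q'\<bar>" by simp
  moreover have "\<bar>r + 2 * k - (r' + 2 * k')\<bar> \<le> \<bar>r - r'\<bar> + 2 * \<bar>k - k'\<bar>"
    by (auto simp: abs_if)
  ultimately show ?thesis unfolding k_def[symmetric] k'_def[symmetric] by simp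
qed

text \<open>The bump function equals 1 at each intermediate position of \<open>b\<close> on its way to the midpoint
  of \<open>a\<close> and \<open>c\<close>, and is affine along the two moving edges.\<close>

lemma triangle_bump:
  fixes a b c :: "'a::euclidean_space"
  assumes nd: "nondeg a b c" and fin: "finseg Z"
    and int: "Z \<inter> convex hull {a, b, c} \<subseteq> {a, c}"
  shows "\<exists>\<psi> L. (\<forall>x y. \<bar>\<psi> x - \<psi> y\<bar> \<le> L * norm (x - y)) \<and> (\<forall>z\<in>Z. \<psi> z = 0) \<and>
    (\<forall>r q. 0 \<le> r \<longrightarrow> 0 \<le> q \<longrightarrow> r + q \<le> 1 \<longrightarrow>
       \<psi> (a + r *\<^sub>R (b - a) + q *\<^sub>R (c - a)) = r + 2 * min (1 - r - q) q)"
proof -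
  let ?T = "convex hull {a, b, c}"
  obtain f1 where f1: "f1 \<bullet> (b - a) = 1" "f1 \<bullet> (c - a) = 0" using nondeg_functional[OF nd] by blast
  obtain f2 where f2: "f2 \<bullet> (c - a) = 1" "f2 \<bullet> (b - a) = 0"
    using nondeg_functional[OF nondeg_swap[OF nd]] by blast
  define r where "r x = f1 \<bullet> (x - a)" for x
  define q where "q x = f2 \<bullet> (x - a)" for x
  define \<phi> where "\<phi> x = r x + 2 * min (1 - r x - q x) (q x)" for x
  obtain M where M: "M \<ge> 0" "\<And>r q z. 0 \<le> r \<Longrightarrow> 0 \<le> q \<Longrightarrow> r + q \<le> 1 \<Longrightarrow> z \<in> Z \<Longrightarrow>
      r + 2 * min (1 - r - q) q \<le> M * norm (a + r *\<^sub>R (b - a) + q *\<^sub>R (c - a) - z)"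
    using finseg_triangle_bound[OF nd fin int] by blast
  have rT: "r (a + s *\<^sub>R (b - a) + t *\<^sub>R (c - a)) = s"
    and qT: "q (a + s *\<^sub>R (b - a) + t *\<^sub>R (c - a)) = t" for s t
    by (simp_all only: r_def q_def add_diff_cancel_left' add.assoc inner_add_right inner_scaleR_right f1 f2
        mult_1_right mult_zero_right add_0_left add_0_right)
  define L1 where "L1 = 3 * norm f1 + 4 * norm f2"
  have rL: "\<bar>r x - r y\<bar> \<le> norm f1 * norm (x - y)" and qL: "\<bar>q x - q y\<bar> \<le> norm f2 * norm (x - y)" for x y
    using Cauchy_Schwarz_ineq2[of f1 "x - y"] Cauchy_Schwarz_ineq2[of f2 "x - y"]
    by (simp_all add: r_def q_def inner_diff_right)
  have phiL: "\<bar>\<phi> x - \<phi> y\<bar> \<le> L1 * norm (x - y)" for x y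
  proof -
    have "\<bar>\<phi> x - \<phi> y\<bar> \<le> 3 * \<bar>r x - r y\<bar> + 4 * \<bar>q x - q y\<bar>"
      unfolding \<phi>_def by (rule bump_lipschitz)
    also have "\<dots> \<le> L1 * norm (x - y)"
      using rL[of x y] qL[of x y] by (simp add: L1_def algebra_simps)
    finally show ?thesis .
  qed
  have L10: "L1 \<ge> 0" by (simp add: L1_def)
  have cT: "compact ?T" by (simp add: finite_imp_compact_convex_hull)
  have neT: "?T \<noteq> {}" by simp
  \<comment> \<open>The penalty vanishes on the triangle. For \<open>z\<close> in \<open>Z\<close>
    with nearest triangle point \<open>y\<close>, \<open>\<phi>\<close> is at most \<open>M\<close>
    times the distance at \<open>y\<close> and grows by at most \<open>L1\<close> times the distance
    on the way to \<open>z\<close>, so the slope \<open>M + L1\<close> pushes the value at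
    \<open>z\<close> to zero.\<close>
  define \<psi> where "\<psi> x = max 0 (\<phi> x - (M + L1) * infdist x ?T)" for x
  have inf1: "\<bar>infdist x ?T - infdist y ?T\<bar> \<le> norm (x - y)" for x y
    using infdist_triangle_abs[of x ?T y] by (simp add: dist_norm)
  have "\<bar>\<psi> x - \<psi> y\<bar> \<le> (L1 + (M + L1)) * norm (x - y)" for x y
  proof -
    have "\<bar>\<psi> x - \<psi> y\<bar> \<le> \<bar>(\<phi> x - (M + L1) * infdist x ?T) - (\<phi> y - (M + L1) * infdist y ?T)\<bar>"
      unfolding \<psi>_def by (auto simp: max_def)
    also have "\<dots> \<le> \<bar>\<phi> x - \<phi> y\<bar> + \<bar>(M + L1) * (infdist x ?T - infdist y ?T)\<bar>"
      unfolding right_diff_distrib by linarith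
    also have "\<dots> \<le> L1 * norm (x - y) + (M + L1) * norm (x - y)"
      using phiL[of x y] inf1[of x y] M(1) L10
      by (intro add_mono) (auto simp: abs_mult intro!: mult_left_mono)
    finally show ?thesis by (simp add: algebra_simps)
  qed
  moreover have "\<psi> z = 0" if z: "z \<in> Z" for z
  proof -
    obtain y where y: "y \<in> ?T" "infdist z ?T = dist z y"
      using infdist_attains_inf[of ?T z] cT neT by (auto simp: compact_imp_closed)
    obtain s t where st: "0 \<le> s" "0 \<le> t" "s + t \<le> 1" "y = a + s *\<^sub>R (b - a) + t *\<^sub>R (c - a)"
      using y(1) unfolding triangle_coords by blast
    have "\<phi> y = s + 2 * min (1 - s - t) t" unfolding \<phi>_def st(4) rT qT ..
    then have "\<phi> y \<le> M * norm (y - z)" using M(2)[OF st(1-3) z] st(4) by simp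
    moreover have "\<phi> z \<le> \<phi> y + L1 * norm (y - z)"
      using phiL[of z y] by (simp add: norm_minus_commute abs_le_iff)
    ultimately have "\<phi> z \<le> (M + L1) * infdist z ?T"
      unfolding y(2) by (simp add: dist_norm norm_minus_commute distrib_right)
    then show ?thesis by (simp add: \<psi>_def)
  qed
  moreover have "\<psi> (a + s *\<^sub>R (b - a) + t *\<^sub>R (c - a)) = s + 2 * min (1 - s - t) t"
    if st: "0 \<le> s" "0 \<le> t" "s + t \<le> 1" for s t
  proof -
    have "a + s *\<^sub>R (b - a) + t *\<^sub>R (c - a) \<in> ?T" unfolding triangle_coords using st by blast
    then have "infdist (a + s *\<^sub>R (b - a) + t *\<^sub>R (c - a)) ?T = 0" by simp
    then show ?thesis unfolding \<psi>_def \<phi>_def rT qT using st by (simp add: min_def)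
  qed
  ultimately show ?thesis by blast
qed

section \<open>Realising a move across a triangle by an ambient isotopy\<close>

lemma segment_image:
  assumes "\<And>s. 0 \<le> s \<Longrightarrow> s \<le> 1 \<Longrightarrow> f ((1 - s) *\<^sub>R a + s *\<^sub>R b) = (1 - s) *\<^sub>R a' + s *\<^sub>R b'"
  shows "f ` closed_segment a b = closed_segment a' b'"
proof -
  have "closed_segment a b = (\<lambda>s. (1 - s) *\<^sub>R a + s *\<^sub>R b) ` {0..1}"
    and "closed_segment a' b' = (\<lambda>s. (1 - s) *\<^sub>R a' + s *\<^sub>R b') ` {0..1}"
    by (auto simp: closed_segment_def)
  then show ?thesis using assms by (auto simp: image_image intro!: image_cong)
qed

text \<open>The vertex \<open>b\<close> travels in short steps to the midpoint of \<open>a\<close>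
  and \<open>c\<close>. A step may go forwards or backwards, so both directions come from one
  argument and no symmetry of the relation is invoked.\<close>

lemma ambient_isotopic_triangle:
  fixes a b c :: "'a::euclidean_space"
  assumes nd: "nondeg a b c" and fin: "finseg Z"
    and int: "Z \<inter> convex hull {a, b, c} \<subseteq> {a, c}"
  shows "ambient_isotopic (closed_segment a b \<union> closed_segment b c \<union> Z) (closed_segment a c \<union> Z)"
    and "ambient_isotopic (closed_segment a c \<union> Z) (closed_segment a b \<union> closed_segment b c \<union> Z)"
proof -
  obtain \<psi> L where lip: "\<And>x y. \<bar>\<psi> x - \<psi> y\<bar> \<le> L * norm (x - y)" and psiZ: "\<And>z. z \<in> Z \<Longrightarrow> \<psi> z = 0"
    and psiT: "\<And>r q. 0 \<le> r \<Longrightarrow> 0 \<le> q \<Longrightarrow> r + q \<le> 1 \<Longrightarrow>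
       \<psi> (a + r *\<^sub>R (b - a) + q *\<^sub>R (c - a)) = r + 2 * min (1 - r - q) q"
    using triangle_bump[OF nd fin int] by blast
  define m where "m = midpoint a c"
  define w where "w = b - m"
  \<comment> \<open>A step of length \<open>1 / N\<close> displaces by a map with Lipschitz constant
    \<open>L * norm w / N\<close>, which must be below 1.\<close>
  obtain N :: nat where N: "L * norm w < real N" "N > 0"
  proof -
    obtain n :: nat where "L * norm w < real n" using reals_Archimedean2 by blast
    then show thesis by (intro that[of "Suc n"]) auto
  qed
  \<comment> \<open>\<open>P 1\<close> is \<open>b\<close>, and at \<open>P 0\<close> the two moving
    edges together form the segment from \<open>a\<close> to \<open>c\<close>.\<close>
  define P where "P t = m + t *\<^sub>R w" for t
  define Q where "Q t = closed_segment a (P t) \<union> closed_segment (P t) c \<union> Z" for t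
  have Pcoord: "(1 - s) *\<^sub>R a + s *\<^sub>R P t = a + (s * t) *\<^sub>R (b - a) + (s * (1 - t) / 2) *\<^sub>R (c - a)"
    and Pcoord': "(1 - s) *\<^sub>R P t + s *\<^sub>R c = a + ((1 - s) * t) *\<^sub>R (b - a) + (1 - (1 - s) * (1 + t) / 2) *\<^sub>R (c - a)"
    for s t
    by (rule euclidean_eqI;
        simp add: P_def w_def m_def midpoint_def inner_add_left inner_diff_left field_simps)+
  have psi1: "\<psi> ((1 - s) *\<^sub>R a + s *\<^sub>R P t) = s"
    and psi2: "\<psi> ((1 - s) *\<^sub>R P t + s *\<^sub>R c) = 1 - s"
    if st: "0 \<le> s" "s \<le> 1" "0 \<le> t" "t \<le> 1" for s t
  proof -
    have p: "0 \<le> s * t" "0 \<le> (1 - s) * t" "s * t \<le> s" "(1 - s) * t \<le> 1 - s"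
      using st by (auto simp: mult_left_le)
    have v1: "x + 2 * min (1 - x - (y - x) / 2) ((y - x) / 2) = y"
      and v2: "x + 2 * min (1 - x - (1 - (y + x) / 2)) (1 - (y + x) / 2) = y"
      if "0 \<le> x" "x \<le> y" "y \<le> 1" for x y :: real
      using that by (auto simp: min_def field_simps)
    have e: "s * (1 - t) / 2 = (s - s * t) / 2" "(1 - s) * (1 + t) / 2 = ((1 - s) + (1 - s) * t) / 2"
      by (simp_all add: algebra_simps)
    have b: "s * t + (s - s * t) / 2 \<le> 1" "0 \<le> (s - s * t) / 2"
      "0 \<le> 1 - ((1 - s) + (1 - s) * t) / 2" "(1 - s) * t + (1 - ((1 - s) + (1 - s) * t) / 2) \<le> 1"
      using p st by (auto simp: field_simps)
    show "\<psi> ((1 - s) *\<^sub>R a + s *\<^sub>R P t) = s"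
      unfolding Pcoord e psiT[OF p(1) b(2) b(1)] by (rule v1) (use p st in auto)
    show "\<psi> ((1 - s) *\<^sub>R P t + s *\<^sub>R c) = 1 - s"
      unfolding Pcoord' e psiT[OF p(2) b(3) b(4)] by (rule v2) (use p st in auto)
  qed
  have step: "ambient_isotopic (Q t) (Q t')" if t: "0 \<le> t" "t \<le> 1" and tt: "\<bar>t' - t\<bar> \<le> 1 / N" for t t'
  proof -
    let ?g = "\<lambda>x. ((t' - t) * \<psi> x) *\<^sub>R w"
    have "ambient_isotopic (Q t) ((\<lambda>x. x + ?g x) ` Q t)"
    proof (rule ambient_isotopic_id_plus_contraction)
      show "L * norm w / N < 1" using N by (simp add: field_simps)
      fix x y
      have "norm (?g x - ?g y) = \<bar>t' - t\<bar> * (\<bar>\<psi> x - \<psi> y\<bar> * norm w)"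
        by (simp add: abs_mult flip: scaleR_diff_left right_diff_distrib)
      also have "\<dots> \<le> (1 / N) * ((L * norm (x - y)) * norm w)"
        using tt lip[of x y] by (intro mult_mono) auto
      finally show "norm (?g x - ?g y) \<le> L * norm w / N * norm (x - y)"
        by (simp add: mult_ac)
    qed
    also have "(\<lambda>x. x + ?g x) ` Q t = Q t'"
    proof -
      have "(\<lambda>x. x + ?g x) ` closed_segment a (P t) = closed_segment a (P t')"
        by (rule segment_image) (simp add: psi1 t, simp add: P_def algebra_simps)
      moreover have "(\<lambda>x. x + ?g x) ` closed_segment (P t) c = closed_segment (P t') c"
        by (rule segment_image) (simp add: psi2 t, simp add: P_def algebra_simps)
      moreover have "(\<lambda>x. x + ?g x) ` Z = Z" using psiZ by auto
      ultimately show ?thesis unfolding Q_def by (simp only: image_Un)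
    qed
    finally show ?thesis .
  qed
  have up: "ambient_isotopic (Q 0) (Q (real k / N)) \<and> ambient_isotopic (Q (real k / N)) (Q 0)" if "k \<le> N" for k
    using that
  proof (induction k)
    case 0
    then show ?case by (simp add: ambient_isotopic_refl)
  next
    case (Suc k)
    have "ambient_isotopic (Q (real k / N)) (Q (real (Suc k) / N))"
      "ambient_isotopic (Q (real (Suc k) / N)) (Q (real k / N))"
      using Suc(2) N(2) by (auto intro!: step simp: divide_simps)
    with Suc show ?case by (meson Suc_leD ambient_isotopic_trans)
  qed
  have P0: "P 0 = midpoint a c" and P1: "P 1 = b" by (simp_all add: P_def m_def w_def)
  have Q0: "Q 0 = closed_segment a c \<union> Z"
    unfolding Q_def P0 using Un_closed_segment[of "midpoint a c" a c] by simp
  have Q1: "Q 1 = closed_segment a b \<union> closed_segment b c \<union> Z"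
    unfolding Q_def P1 ..
  have "real N / real N = 1" using N(2) by simp
  then show "ambient_isotopic (closed_segment a b \<union> closed_segment b c \<union> Z) (closed_segment a c \<union> Z)"
    and "ambient_isotopic (closed_segment a c \<union> Z) (closed_segment a b \<union> closed_segment b c \<union> Z)"
    using up[of N] Q0 Q1 by auto
qed

lemma trivial_knot_triangle:
  assumes "nondeg a b c" "finseg Z" "Z \<inter> convex hull {a, b, c} \<subseteq> {a, c}"
  shows "trivial_knot (closed_segment a b \<union> closed_segment b c \<union> Z) \<longleftrightarrow> trivial_knot (closed_segment a c \<union> Z)"
  using ambient_isotopic_triangle[OF assms] trivial_knot_ambient_isotopic by blast

section \<open>General position\<close>

lemma nondeg_perms:
  assumes "nondeg a b c"
  shows "nondeg a c b" "nondeg b a c" "nondeg b c a" "nondeg c a b" "nondeg c b a"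
proof -
  show 1: "nondeg a c b" using assms by (rule nondeg_swap)
  show 2: "nondeg c b a" using assms by (rule nondeg_rot)
  show 3: "nondeg b c a" using 1 by (rule nondeg_rot)
  show 4: "nondeg c a b" using 2 by (rule nondeg_swap)
  show "nondeg b a c" using 4 by (rule nondeg_rot)
qed

lemma nondegI:
  assumes "a \<noteq> b" "c \<notin> affine hull {a, b}"
  shows "nondeg a b c"
  unfolding nondeg_def
proof (intro allI impI)
  fix r q assume e: "r *\<^sub>R (b - a) + q *\<^sub>R (c - a) = 0"
  have "q = 0"
  proof (rule ccontr)
    assume q: "q \<noteq> 0"
    have "q *\<^sub>R c = q *\<^sub>R a - r *\<^sub>R (b - a)" using e by (simp add: algebra_simps)
    then have "(1/q) *\<^sub>R (q *\<^sub>R c) = (1/q) *\<^sub>R (q *\<^sub>R a - r *\<^sub>R (b - a))" by simp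
    then have "c = (1 + r/q) *\<^sub>R a + (- (r/q)) *\<^sub>R b" using q by (simp add: algebra_simps)
    then have "c \<in> affine hull {a, b}" unfolding affine_hull_2
      by (intro CollectI exI[of _ "1 + r/q"] exI[of _ "-(r/q)"]) simp
    then show False using assms by simp
  qed
  with e assms show "r = 0 \<and> q = 0" by simp
qed

lemma nondeg_not_in_line: "nondeg a b c \<Longrightarrow> c \<notin> affine hull {a, b}"
proof
  assume n: "nondeg a b c" and "c \<in> affine hull {a, b}"
  then obtain u v where uv: "c = u *\<^sub>R a + v *\<^sub>R b" "u + v = 1" by (auto simp: affine_hull_2)
  then have "u = 1 - v" by simp
  then have "c = (1 - v) *\<^sub>R a + v *\<^sub>R b" using uv by simp
  then have "v *\<^sub>R (b - a) + (-1) *\<^sub>R (c - a) = 0" by (simp add: algebra_simps)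
  from nondegD[OF n this] show False by simp
qed

text \<open>Steinitz exchange. In an affine relation expressing \<open>c\<close>, the coefficient of
  \<open>x\<close> cannot vanish because \<open>c\<close> is off the line through \<open>a\<close>
  and \<open>b\<close>; solving for \<open>x\<close> puts it into the excluded plane.\<close>

lemma affine_exchange:
  assumes n: "nondeg a b c" and x: "x \<notin> affine hull {a, b, c}"
  shows "c \<notin> affine hull {x, a, b}"
proof
  assume "c \<in> affine hull {x, a, b}"
  then obtain u v w where e: "c = u *\<^sub>R x + v *\<^sub>R a + w *\<^sub>R b" "u + v + w = 1"
    by (auto simp: affine_hull_3)
  show False
  proof (cases "u = 0")
    case True
    then have "c = v *\<^sub>R a + w *\<^sub>R b \<and> v + w = 1" using e by simp
    then have "c \<in> affine hull {a, b}" unfolding affine_hull_2 by blast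
    then show False using nondeg_not_in_line[OF n] by simp
  next
    case False
    have "u *\<^sub>R x = c - v *\<^sub>R a - w *\<^sub>R b" unfolding e(1) by simp
    then have "(1/u) *\<^sub>R (u *\<^sub>R x) = (1/u) *\<^sub>R (c - v *\<^sub>R a - w *\<^sub>R b)" by simp
    then have "x = (1/u) *\<^sub>R (c - v *\<^sub>R a - w *\<^sub>R b)" using False by simp
    then have "x = (- v/u) *\<^sub>R a + (- w/u) *\<^sub>R b + (1/u) *\<^sub>R c"
      by (simp only: scaleR_diff_right scaleR_scaleR) simp
    moreover have "- v/u + - w/u + 1/u = 1" using False e(2) by (simp add: field_simps)
    ultimately have "x \<in> affine hull {a, b, c}" unfolding affine_hull_3 by blast
    then show False using x by simp
  qed
qed

text \<open>A point of the triangle with positive weight at the apex \<open>d\<close>, if it lay in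
  \<open>S\<close>, would let \<open>d\<close> be recovered as an affine combination of points of
  \<open>S\<close>.\<close>

lemma triangle_Int_affine:
  assumes S: "affine S" and ab: "a \<in> S" "b \<in> S" and d: "d \<notin> S"
  shows "convex hull {a, d, b} \<inter> S \<subseteq> closed_segment a b"
proof
  fix x assume "x \<in> convex hull {a, d, b} \<inter> S"
  then have xT: "x \<in> convex hull {a, d, b}" and x: "x \<in> S" by simp_all
  obtain r q where rq: "0 \<le> r" "0 \<le> q" "r + q \<le> 1" "x = a + r *\<^sub>R (d - a) + q *\<^sub>R (b - a)"
    using xT unfolding triangle_coords by blast
  have "r = 0"
  proof (rule ccontr)
    assume r: "r \<noteq> 0"
    have "r *\<^sub>R d = x - (1 - r - q) *\<^sub>R a - q *\<^sub>R b" unfolding rq(4) by (simp add: algebra_simps)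
    then have "(1/r) *\<^sub>R (r *\<^sub>R d) = (1/r) *\<^sub>R (x - (1 - r - q) *\<^sub>R a - q *\<^sub>R b)" by simp
    then have "d = (1/r) *\<^sub>R (x - (1 - r - q) *\<^sub>R a - q *\<^sub>R b)" using r by simp
    moreover have "(1/r) *\<^sub>R (x - (1 - r - q) *\<^sub>R a - q *\<^sub>R b)
        = (1/r) *\<^sub>R x + ((1/r) * - (1 - r - q)) *\<^sub>R a + ((1/r) * - q) *\<^sub>R b"
      by (simp only: scaleR_diff_right scaleR_scaleR mult_minus_right scaleR_minus_left) simp
    moreover have "1/r + (1/r) * - (1 - r - q) + (1/r) * - q = 1" using r by (simp add: field_simps)
    ultimately have "d \<in> affine hull {x, a, b}" unfolding affine_hull_3 by blast
    moreover have "affine hull {x, a, b} \<subseteq> S" using S x ab by (intro hull_minimal) auto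
    ultimately show False using d by blast
  qed
  then have "x = (1 - q) *\<^sub>R a + q *\<^sub>R b" unfolding rq(4) by (simp add: algebra_simps)
  moreover have "q \<le> 1" using rq(3) \<open>r = 0\<close> by simp
  ultimately show "x \<in> closed_segment a b" unfolding closed_segment_def using rq(2) by blast
qed

lemma segment_Int_affine:
  assumes "affine S" "a \<in> S" "d \<notin> S"
  shows "closed_segment a d \<inter> S \<subseteq> {a}"
proof -
  have "{a, d, a} = {a, d}" by auto
  then show ?thesis using triangle_Int_affine[OF assms(1,2,2,3)] by (simp add: segment_convex_hull)
qed

text \<open>The hull of at most three points is closed with empty interior in three-space, so
  removing it leaves an open nonempty set. A triple with a repeated point serves to avoid a
  line.\<close>

lemma ex_generic_point:
  fixes U :: "(real^3) set"
  assumes "open U" "U \<noteq> {}"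
  shows "\<exists>x\<in>U. \<forall>(a, b, c)\<in>set ts. x \<notin> affine hull {a, b, c}"
  using assms
proof (induction ts arbitrary: U)
  case Nil then show ?case by auto
next
  case (Cons t ts)
  obtain a b c where t: "t = (a, b, c)" by (cases t)
  let ?A = "affine hull {a, b, c}"
  have "card {a, b, c} \<le> 3" by (simp add: card_insert_if)
  then have "interior ?A = {}"
    by (intro empty_interior_affine_hull) auto
  then have "\<not> U \<subseteq> ?A" using Cons.prems by (metis interior_maximal subset_empty)
  moreover have "open (U - ?A)" using Cons.prems(1) by (intro open_Diff) (auto simp: closed_affine_hull)
  ultimately obtain x where "x \<in> U - ?A" "\<forall>(a, b, c)\<in>set ts. x \<notin> affine hull {a, b, c}"
    using Cons.IH[of "U - ?A"] by blast
  then show ?case using t by (intro bexI[of _ x]) auto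
qed

lemma nondeg_segments_Int:
  assumes "nondeg a b c"
  shows "closed_segment a b \<inter> closed_segment b c \<subseteq> {b}"
proof
  fix x assume x: "x \<in> closed_segment a b \<inter> closed_segment b c"
  then have "x \<in> closed_segment b a" "x \<in> closed_segment b c" by (auto simp: closed_segment_commute)
  then obtain s t where s: "x = (1 - s) *\<^sub>R b + s *\<^sub>R a" and t: "x = (1 - t) *\<^sub>R b + t *\<^sub>R c"
    unfolding closed_segment_def by blast
  have "(1 - s) *\<^sub>R b + s *\<^sub>R a - ((1 - t) *\<^sub>R b + t *\<^sub>R c) = 0" using s t by simp
  then have "(t - s) *\<^sub>R (b - a) + (- t) *\<^sub>R (c - a) = 0" by (simp add: algebra_simps)
  from nondegD[OF assms this] have "t = 0" by simp
  then show "x \<in> {b}" using t by simp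
qed

section \<open>Triangles\<close>

definition triangle_boundary :: "'a::real_vector \<Rightarrow> 'a \<Rightarrow> 'a \<Rightarrow> 'a set" where
  "triangle_boundary a b c = closed_segment a b \<union> closed_segment b c \<union> closed_segment c a"

lemma triangle_boundary_rot: "triangle_boundary a b c = triangle_boundary b c a"
  unfolding triangle_boundary_def by blast

text \<open>The quadrilateral \<open>x a b c\<close> lies between the two triangles: insert
  \<open>x\<close> into the side \<open>c a\<close>, then delete \<open>a\<close>. With
  \<open>x\<close> off the plane, neither triangle swept out meets the other edges.\<close>

lemma trivial_knot_move_vertex:
  assumes n: "nondeg a b c" and x: "x \<notin> affine hull {a, b, c}"
  shows "trivial_knot (triangle_boundary a b c) \<longleftrightarrow> trivial_knot (triangle_boundary x b c)"
    and "nondeg x b c"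
proof -
  let ?S = "affine hull {a, b, c}"
  have nc: "nondeg c a x"
  proof (rule nondegI)
    show "c \<noteq> a" using nondeg_distinct[OF n] by auto
    show "x \<notin> affine hull {c, a}" using x hull_mono[of "{c, a}" "{a, b, c}"] by auto
  qed
  have na: "nondeg a b x"
  proof (rule nondegI)
    show "a \<noteq> b" using nondeg_distinct[OF n] by auto
    show "x \<notin> affine hull {a, b}" using x hull_mono[of "{a, b}" "{a, b, c}"] by auto
  qed
  have "nondeg b c x"
  proof (rule nondegI)
    show "b \<noteq> c" using nondeg_distinct[OF n] by auto
    show "x \<notin> affine hull {b, c}" using x hull_mono[of "{b, c}" "{a, b, c}"] by auto
  qed
  then show "nondeg x b c" by (rule nondeg_perms)
  have segS: "closed_segment a b \<subseteq> ?S" "closed_segment b c \<subseteq> ?S"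
    by (simp_all add: closed_segment_subset hull_inc affine_imp_convex affine_affine_hull)
  have "trivial_knot (closed_segment c x \<union> closed_segment x a \<union> (closed_segment a b \<union> closed_segment b c))
     \<longleftrightarrow> trivial_knot (closed_segment c a \<union> (closed_segment a b \<union> closed_segment b c))"
  proof (rule trivial_knot_triangle)
    show "nondeg c x a" using nc by (rule nondeg_swap)
    have "(closed_segment a b \<union> closed_segment b c) \<inter> convex hull {c, x, a} \<subseteq> closed_segment c a"
      using triangle_Int_affine[of ?S c a x] x segS by (auto simp: hull_inc)
    moreover have "closed_segment c a \<inter> closed_segment a b \<subseteq> {a}"
      "closed_segment b c \<inter> closed_segment c a \<subseteq> {c}"
      using nondeg_segments_Int[OF nondeg_perms(4)[OF n]] nondeg_segments_Int[OF nondeg_perms(3)[OF n]] by auto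
    ultimately show "(closed_segment a b \<union> closed_segment b c) \<inter> convex hull {c, x, a} \<subseteq> {c, a}" by blast
  qed simp
  moreover have "trivial_knot (closed_segment x a \<union> closed_segment a b \<union> (closed_segment b c \<union> closed_segment c x))
     \<longleftrightarrow> trivial_knot (closed_segment x b \<union> (closed_segment b c \<union> closed_segment c x))"
  proof (rule trivial_knot_triangle)
    show "nondeg x a b" using na by (rule nondeg_perms)
    have "convex hull {a, x, b} \<inter> ?S \<subseteq> closed_segment a b"
      using x by (intro triangle_Int_affine) (auto simp: hull_inc)
    then have "closed_segment b c \<inter> convex hull {a, x, b} \<subseteq> {b}"
      using segS nondeg_segments_Int[OF n] by blast
    moreover have "closed_segment x c \<inter> affine hull {x, a, b} \<subseteq> {x}"
      using affine_exchange[OF n x] by (intro segment_Int_affine) (auto simp: hull_inc)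
    moreover have "convex hull {a, x, b} \<subseteq> affine hull {x, a, b}"
      using convex_hull_subset_affine_hull[of "{x, a, b}"] by (simp add: insert_commute)
    ultimately show "(closed_segment b c \<union> closed_segment c x) \<inter> convex hull {x, a, b} \<subseteq> {x, b}"
      by (auto simp: closed_segment_commute insert_commute)
  qed simp
  ultimately show "trivial_knot (triangle_boundary a b c) \<longleftrightarrow> trivial_knot (triangle_boundary x b c)"
    unfolding triangle_boundary_def by (simp add: Un_ac)
qed

text \<open>Both triangles are moved, one vertex at a time, to the same triangle
  \<open>z x y\<close>, whose vertices are generic with respect to both.\<close>

lemma trivial_knot_triangles_iff:
  fixes a b c a' b' c' :: "real^3"
  assumes n: "nondeg a b c" and n': "nondeg a' b' c'"
  shows "trivial_knot (triangle_boundary a b c) \<longleftrightarrow> trivial_knot (triangle_boundary a' b' c')"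
proof -
  have gen: "\<exists>x. \<forall>(a, b, c)\<in>set ts. x \<notin> affine hull {a, b, c}" for ts :: "((real^3) \<times> (real^3) \<times> (real^3)) list"
    using ex_generic_point[of UNIV ts] by auto
  obtain x where x: "x \<notin> affine hull {a, b, c}" "x \<notin> affine hull {a', b', c'}"
    using gen[of "[(a, b, c), (a', b', c')]"] by auto
  obtain y where y: "y \<notin> affine hull {b, c, x}" "y \<notin> affine hull {b', c', x}"
    using gen[of "[(b, c, x), (b', c', x)]"] by auto
  obtain z where z: "z \<notin> affine hull {c, x, y}" "z \<notin> affine hull {c', x, y}"
    using gen[of "[(c, x, y), (c', x, y)]"] by auto
  have rot: "nondeg u v w \<Longrightarrow> nondeg v w u" for u v w :: "real^3" by (rule nondeg_perms)
  have "trivial_knot (triangle_boundary a b c) \<longleftrightarrow> trivial_knot (triangle_boundary z x y)"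
    if n: "nondeg a b c" and x: "x \<notin> affine hull {a, b, c}" and y: "y \<notin> affine hull {b, c, x}"
      and z: "z \<notin> affine hull {c, x, y}" for a b c
  proof -
    note 1 = trivial_knot_move_vertex[OF n x]
    note 2 = trivial_knot_move_vertex[OF rot[OF 1(2)] y]
    note 3 = trivial_knot_move_vertex[OF rot[OF 2(2)] z]
    show ?thesis
      using 1(1) 2(1) 3(1) triangle_boundary_rot[of x b c] triangle_boundary_rot[of y c x] by simp
  qed
  from this[OF n x(1) y(1) z(1)] this[OF n' x(2) y(2) z(2)] show ?thesis by simp
qed

section \<open>From a standard triangle to the round circle\<close>

text \<open>On the plane \<open>x$3 = 0\<close> this is the Minkowski gauge of a triangle around the origin.\<close>

definition gauge3 :: "real^3 \<Rightarrow> real" where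
  "gauge3 x = max (max (- x$1) (- x$2)) (x$1 + x$2) + \<bar>x$3\<bar>"

lemma gauge3_scale: "0 \<le> k \<Longrightarrow> gauge3 (k *\<^sub>R x) = k * gauge3 x"
  by (simp add: gauge3_def max_mult_distrib_left abs_mult flip: distrib_left)
     (simp add: max_mult_distrib_left distrib_left)

lemma gauge3_pos: "x \<noteq> 0 \<Longrightarrow> 0 < gauge3 x"
proof -
  assume "x \<noteq> 0"
  then have "x$1 \<noteq> 0 \<or> x$2 \<noteq> 0 \<or> x$3 \<noteq> 0" by (simp add: vec_eq_iff forall_3)
  then show ?thesis by (auto simp: gauge3_def max_def)
qed

lemma gauge3_zero [simp]: "gauge3 0 = 0"
  by (simp add: gauge3_def)

lemma continuous_gauge3: "continuous_on S gauge3"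
  unfolding gauge3_def by (intro continuous_intros)

text \<open>Rescales every ray so that \<open>norm (radial x) = gauge3 x\<close>; level sets of the
  gauge go to spheres.\<close>

definition radial :: "real^3 \<Rightarrow> real^3" where
  "radial x = (gauge3 x / norm x) *\<^sub>R x"

lemma continuous_radial: "continuous_on UNIV radial"
proof -
  have "isCont radial x" for x
  proof (cases "x = 0")
    case False
    have "isCont gauge3 x" using continuous_gauge3[of UNIV] by (simp add: continuous_on_eq_continuous_at)
    then show ?thesis unfolding radial_def using False by (intro continuous_intros) auto
  next
    case True
    have "isCont gauge3 0" using continuous_gauge3[of UNIV] by (simp add: continuous_on_eq_continuous_at)
    then have "(gauge3 \<longlongrightarrow> 0) (at 0)" by (simp add: isCont_def)
    moreover have "norm (radial x) \<le> gauge3 x" for x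
      using gauge3_pos[of x] by (cases "x = 0") (auto simp: radial_def)
    ultimately have "(radial \<longlongrightarrow> 0) (at 0)"
      by (intro Lim_null_comparison[of radial gauge3]) (auto intro: always_eventually)
    then show ?thesis using True by (simp add: isCont_def radial_def)
  qed
  then show ?thesis by (simp add: continuous_at_imp_continuous_on)
qed

text \<open>Every stage multiplies each ray by a positive factor that is constant along the ray,
  hence is bijective; invariance of domain supplies continuity of the inverse.\<close>

lemma ambient_isotopic_radial: "ambient_isotopic A (radial ` A)"
proof -
  let ?H = "\<lambda>t x. (1 - t) *\<^sub>R x + t *\<^sub>R radial x"
  define k where "k t x = (1 - t) + t * (gauge3 x / norm x)" for t and x :: "real^3"
  have Hk: "?H t x = k t x *\<^sub>R x" for t x by (simp add: k_def radial_def scaleR_add_left)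
  have kpos: "k t x > 0" if "x \<noteq> 0" "t \<in> {0..1}" for t x
  proof (cases "t = 0")
    case False
    then have "t * (gauge3 x / norm x) > 0" using that gauge3_pos[of x] by simp
    then show ?thesis using that by (simp add: k_def add_nonneg_pos)
  qed (simp add: k_def)
  have kscale: "k t (l *\<^sub>R x) = k t x" if "l > 0" for t l x
    using that by (simp add: k_def gauge3_scale)
  have "ambient_isotopic A (?H 1 ` A)"
  proof (rule ambient_isotopicI[where H = "?H"])
    show "continuous_on ({0..1} \<times> UNIV) (\<lambda>p. (1 - fst p) *\<^sub>R snd p + fst p *\<^sub>R radial (snd p))"
      by (intro continuous_intros continuous_on_compose2[OF continuous_radial]) auto
    fix t :: real assume t: "t \<in> {0..1}"
    have inj: "inj (?H t)"
    proof (rule injI)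
      fix x y assume "?H t x = ?H t y"
      then have e: "k t x *\<^sub>R x = k t y *\<^sub>R y" by (simp only: Hk)
      show "x = y"
      proof (cases "x = 0 \<or> y = 0")
        case True
        then show ?thesis using e kpos[of x t] kpos[of y t] t by (cases "x = 0"; cases "y = 0") auto
      next
        case False
        then have p: "k t x > 0" "k t y > 0" using kpos t by auto
        have "y = (1 / k t y) *\<^sub>R (k t y *\<^sub>R y)" using p by simp
        then have y: "y = (k t x / k t y) *\<^sub>R x" unfolding e[symmetric] by simp
        have "k t ((k t x / k t y) *\<^sub>R x) = k t x" by (rule kscale) (use p in simp)
        then have "k t y = k t x" by (simp only: y[symmetric])
        then show ?thesis using y p by simp
      qed
    qed
    have surj: "surj (?H t)"
      unfolding surj_def
    proof
      fix y
      show "\<exists>x. y = ?H t x"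
      proof (cases "y = 0")
        case True
        then show ?thesis by (intro exI[of _ 0]) (simp add: radial_def)
      next
        case False
        then have p: "k t y > 0" using kpos t by auto
        show ?thesis unfolding Hk
          by (rule exI[of _ "(1 / k t y) *\<^sub>R y"], subst kscale) (use p in auto)
      qed
    qed
    have "continuous_on UNIV (?H t)" by (intro continuous_intros continuous_radial)
    then obtain g where "homeomorphism UNIV (?H t ` UNIV) (?H t) g"
      using invariance_of_domain_homeomorphism[of UNIV "?H t"] inj by auto
    then show "\<exists>k'. homeomorphism UNIV UNIV (?H t) k'" using surj by auto
  qed simp
  then show ?thesis by simp
qed

lemma vector3_nth [simp]:
  "(vector [x, y, z] :: 'a::zero^3) $ 1 = x" "(vector [x, y, z] :: 'a^3) $ 2 = y" "(vector [x, y, z] :: 'a^3) $ 3 = z"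
  by (simp_all add: vector_def)

lemma gauge3_triangle:
  "triangle_boundary (vector [-1, -1, 0]) (vector [2, -1, 0]) (vector [-1, 2, 0]) =
   {x :: real^3. gauge3 x = 1 \<and> x$3 = 0}" (is "triangle_boundary ?a ?b ?c = ?S")
proof
  have seg: "x \<in> closed_segment p q \<longleftrightarrow>
     (\<exists>u\<ge>0. u \<le> 1 \<and> x$1 = (1 - u) * p$1 + u * q$1 \<and> x$2 = (1 - u) * p$2 + u * q$2 \<and> x$3 = (1 - u) * p$3 + u * q$3)"
    for x p q :: "real^3"
    by (auto simp: closed_segment_def vec_eq_iff forall_3)
  show "triangle_boundary ?a ?b ?c \<subseteq> ?S"
    unfolding triangle_boundary_def by (auto simp: seg gauge3_def max_def)
  show "?S \<subseteq> triangle_boundary ?a ?b ?c"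
  proof
    fix x :: "real^3" assume "x \<in> ?S"
    then have x: "max (max (- x$1) (- x$2)) (x$1 + x$2) = 1" "x$3 = 0" by (auto simp: gauge3_def)
    then have b: "x$1 \<ge> -1" "x$2 \<ge> -1" "x$1 + x$2 \<le> 1" by (auto simp: max_def split: if_splits)
    consider "x$1 = -1" | "x$2 = -1" | "x$1 + x$2 = 1" using x by (auto simp: max_def split: if_splits)
    then show "x \<in> triangle_boundary ?a ?b ?c"
    proof cases
      case 1
      have "x \<in> closed_segment ?c ?a"
        unfolding seg by (rule exI[of _ "(2 - x$2) / 3"]) (use 1 x b in \<open>auto simp: field_simps\<close>)
      then show ?thesis by (simp add: triangle_boundary_def)
    next
      case 2
      have "x \<in> closed_segment ?a ?b"
        unfolding seg by (rule exI[of _ "(x$1 + 1) / 3"]) (use 2 x b in \<open>auto simp: field_simps\<close>)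
      then show ?thesis by (simp add: triangle_boundary_def)
    next
      case 3
      then have e: "x$2 = 1 - x$1" by simp
      have "x \<in> closed_segment ?b ?c"
        unfolding seg by (rule exI[of _ "(2 - x$1) / 3"]) (use e x b in \<open>auto simp: field_simps\<close>)
      then show ?thesis by (simp add: triangle_boundary_def)
    qed
  qed
qed

text \<open>One explicit triangle suffices: it is the unit level of \<open>gauge3\<close> in the
  horizontal plane, so \<open>radial\<close> carries it to the circle.\<close>

lemma trivial_knot_triangle_boundary:
  assumes "nondeg a b (c :: real^3)"
  shows "trivial_knot (triangle_boundary a b c)"
proof -
  let ?a = "vector [-1, -1, 0] :: real^3" and ?b = "vector [2, -1, 0] :: real^3"
    and ?c = "vector [-1, 2, 0] :: real^3"
  have nd: "nondeg ?a ?b ?c"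
    unfolding nondeg_def by (auto simp: vec_eq_iff forall_3)
  have "radial ` {x. gauge3 x = 1 \<and> x$3 = 0} = {x. norm x = 1 \<and> x $ 3 = 0}"
  proof (intro equalityI subsetI)
    fix y assume "y \<in> radial ` {x. gauge3 x = 1 \<and> x$3 = 0}"
    then obtain x where x: "y = radial x" "gauge3 x = 1" "x$3 = 0" by blast
    have "x \<noteq> 0" using x(2) by auto
    then show "y \<in> {x. norm x = 1 \<and> x $ 3 = 0}" unfolding x(1) using x(2,3) by (simp add: radial_def)
  next
    fix y :: "real^3" assume "y \<in> {x. norm x = 1 \<and> x $ 3 = 0}"
    then have y: "norm y = 1" "y$3 = 0" by simp_all
    then have "y \<noteq> 0" by auto
    then have g: "gauge3 y > 0" by (rule gauge3_pos)
    have "radial ((1 / gauge3 y) *\<^sub>R y) = y"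
      using g y by (simp add: radial_def gauge3_scale)
    moreover have "gauge3 ((1 / gauge3 y) *\<^sub>R y) = 1" using g by (simp add: gauge3_scale)
    ultimately show "y \<in> radial ` {x. gauge3 x = 1 \<and> x$3 = 0}"
      using y(2) by (intro image_eqI[of _ _ "(1 / gauge3 y) *\<^sub>R y"]) auto
  qed
  then have "trivial_knot (triangle_boundary ?a ?b ?c)"
    unfolding gauge3_triangle trivial_knot_def
    using ambient_isotopic_radial[of "{x. gauge3 x = 1 \<and> x$3 = 0}"] by simp
  then show ?thesis using trivial_knot_triangles_iff[OF nd assms] by simp
qed

section \<open>Polygonal lines\<close>

fun pline :: "'a::real_vector list \<Rightarrow> 'a set" where
  "pline [] = {}"
| "pline [a] = {a}"
| "pline (a # b # xs) = closed_segment a b \<union> pline (b # xs)"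

text \<open>Each edge meets everything after it only in its own second end; this one-sided recursion
  splits cleanly at a vertex, see \<open>emb_append\<close>.\<close>

fun emb :: "'a::real_vector list \<Rightarrow> bool" where
  "emb [] \<longleftrightarrow> True"
| "emb [a] \<longleftrightarrow> True"
| "emb (a # b # xs) \<longleftrightarrow> a \<noteq> b \<and> closed_segment a b \<inter> pline (b # xs) \<subseteq> {b} \<and> emb (b # xs)"

lemma set_subset_pline: "set xs \<subseteq> pline xs"
  by (induction xs rule: pline.induct) auto

lemma pline_append: "pline (xs @ m # ys) = pline (xs @ [m]) \<union> pline (m # ys)"
proof (induction xs rule: pline.induct)
  case 1
  then show ?case using set_subset_pline[of "m # ys"] by auto
next
  case (2 a)
  then show ?case using set_subset_pline[of "m # ys"] by auto
next
  case (3 a b xs)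
  then show ?case by auto
qed

lemma emb_append:
  "emb (xs @ m # ys) \<longleftrightarrow> emb (xs @ [m]) \<and> emb (m # ys) \<and> pline (xs @ [m]) \<inter> pline (m # ys) \<subseteq> {m}"
proof (induction xs rule: pline.induct)
  case 1
  then show ?case by auto
next
  case (2 a)
  have "m \<in> pline (m # ys)" using set_subset_pline[of "m # ys"] by auto
  then show ?case by auto
next
  case (3 a b xs)
  have b: "b \<in> pline (b # xs @ [m])" using set_subset_pline[of "b # xs @ [m]"] by auto
  have m: "m \<in> pline (b # xs @ [m])" "m \<in> pline (m # ys)"
    using set_subset_pline[of "b # xs @ [m]"] set_subset_pline[of "m # ys"] by auto
  have e: "pline (b # xs @ m # ys) = pline (b # xs @ [m]) \<union> pline (m # ys)"
    using pline_append[of "b # xs" m ys] by simp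
  show ?case
  proof
    assume L: "emb ((a # b # xs) @ m # ys)"
    then have L': "a \<noteq> b" "closed_segment a b \<inter> (pline (b # xs @ [m]) \<union> pline (m # ys)) \<subseteq> {b}"
      "emb (b # xs @ [m])" "emb (m # ys)" "pline (b # xs @ [m]) \<inter> pline (m # ys) \<subseteq> {m}"
      using 3 e by auto
    have "closed_segment a b \<inter> pline (m # ys) \<subseteq> {m}"
      using L'(2,5) b by blast
    then show "emb ((a # b # xs) @ [m]) \<and> emb (m # ys) \<and> pline ((a # b # xs) @ [m]) \<inter> pline (m # ys) \<subseteq> {m}"
      using L' by auto
  next
    assume R: "emb ((a # b # xs) @ [m]) \<and> emb (m # ys) \<and> pline ((a # b # xs) @ [m]) \<inter> pline (m # ys) \<subseteq> {m}"
    then have R': "a \<noteq> b" "closed_segment a b \<inter> pline (b # xs @ [m]) \<subseteq> {b}" "emb (b # xs @ [m])" "emb (m # ys)"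
      "(closed_segment a b \<union> pline (b # xs @ [m])) \<inter> pline (m # ys) \<subseteq> {m}" by auto
    have "emb (b # xs @ m # ys)" using 3 R' by auto
    moreover have "closed_segment a b \<inter> pline (b # xs @ m # ys) \<subseteq> {b}"
      unfolding e using R'(2,5) m by blast
    ultimately show "emb ((a # b # xs) @ m # ys)" using R'(1) by auto
  qed
qed

lemma pline_rev [simp]: "pline (rev xs) = pline xs"
proof (induction xs rule: pline.induct)
  case (3 a b xs)
  have "pline (rev (a # b # xs)) = pline (rev xs @ [b]) \<union> pline [b, a]"
    using pline_append[of "rev xs" b "[a]"] by simp
  then show ?case using 3 set_subset_pline[of "b # xs"] by (auto simp: closed_segment_commute)
qed auto

lemma emb_rev [simp]: "emb (rev xs) \<longleftrightarrow> emb xs"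
proof (induction xs rule: pline.induct)
  case (3 a b xs)
  have "emb (rev (a # b # xs)) \<longleftrightarrow> emb (rev (b # xs)) \<and> emb [b, a] \<and> pline (rev (b # xs)) \<inter> pline [b, a] \<subseteq> {b}"
    using emb_append[of "rev xs" b "[a]"] by simp
  also have "\<dots> \<longleftrightarrow> emb (a # b # xs)"
    unfolding pline_rev using 3 set_subset_pline[of "b # xs"] by (auto simp: closed_segment_commute)
  finally show ?case .
qed auto

lemma emb_distinct: "emb xs \<Longrightarrow> distinct xs"
proof (induction xs rule: pline.induct)
  case (3 a b xs)
  have "a \<notin> set (b # xs)"
  proof
    assume "a \<in> set (b # xs)"
    then have "a \<in> pline (b # xs)" using set_subset_pline[of "b # xs"] by blast
    then show False using 3 by auto
  qed
  then show ?case using 3 by simp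
qed auto

lemma finseg_pline [simp]: "finseg (pline xs)"
  by (induction xs rule: pline.induct) auto

lemma compact_pline [simp]: "compact (pline (xs :: 'a::euclidean_space list))"
  by (simp add: finseg_compact)

lemma pline_subset_convex: "convex S \<Longrightarrow> set xs \<subseteq> S \<Longrightarrow> pline xs \<subseteq> S"
proof (induction xs rule: pline.induct)
  case (3 a b xs)
  then show ?case using closed_segment_subset[of a S b] by simp
qed auto

text \<open>The end \<open>b\<close> may lie on the level itself, as crossing points do.\<close>

lemma segment_below:
  assumes "h \<bullet> a < c" "h \<bullet> b \<le> c" "y \<in> closed_segment a b"
  shows "h \<bullet> y < c \<or> y = b"
proof -
  obtain t where t: "0 \<le> t" "t \<le> 1" and y: "y = (1 - t) *\<^sub>R a + t *\<^sub>R b"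
    using assms(3) unfolding closed_segment_def by blast
  show ?thesis
  proof (cases "t = 1")
    case False
    then have "(1 - t) * (h \<bullet> a) < (1 - t) * c" using t assms(1) by simp
    moreover have "t * (h \<bullet> b) \<le> t * c" using t assms(2) by (simp add: mult_left_mono)
    ultimately have "(1 - t) * (h \<bullet> a) + t * (h \<bullet> b) < (1 - t) * c + t * c" by linarith
    then show ?thesis unfolding y by (simp add: inner_add_right algebra_simps)
  qed (simp add: y)
qed

lemma pline_below:
  assumes "\<forall>x\<in>set xs. h \<bullet> x < c" "h \<bullet> m \<le> c" "y \<in> pline (xs @ [m])"
  shows "h \<bullet> y < c \<or> y = m"
  using assms
proof (induction xs rule: pline.induct)
  case (2 a)
  then show ?case using segment_below[of h a c m y] by auto
next
  case (3 a b xs)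
  then show ?case using segment_below[of h a c b y] by auto
qed auto

lemma pline_above:
  assumes "\<forall>x\<in>set xs. h \<bullet> x > c" "h \<bullet> m \<ge> c" "y \<in> pline (xs @ [m])"
  shows "h \<bullet> y > c \<or> y = m"
  using pline_below[of xs "- h" "- c" m y] assms by auto

text \<open>If the segment entered the triangle beyond \<open>x\<close>, the ray would leave it
  through the opposite side. Then either \<open>p\<close> comes later and the segment crosses that
  side, or \<open>p\<close> comes earlier and lies in the triangle.\<close>

lemma ray_lemma:
  assumes p: "p \<notin> convex hull {x, y, z}" and int: "closed_segment x p \<inter> closed_segment y z = {}"
  shows "closed_segment x p \<inter> convex hull {x, y, z} \<subseteq> {x}"
proof (rule ccontr)
  assume "\<not> ?thesis"
  then obtain w where w: "w \<in> closed_segment x p" "w \<in> convex hull {x, y, z}" "w \<noteq> x" by blast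
  obtain r q where rq: "0 \<le> r" "0 \<le> q" "r + q \<le> 1" and wrq: "w = x + r *\<^sub>R (y - x) + q *\<^sub>R (z - x)"
    using w(2) unfolding triangle_coords by blast
  obtain t where t: "0 \<le> t" "t \<le> 1" and wt: "w = (1 - t) *\<^sub>R x + t *\<^sub>R p"
    using w(1) unfolding closed_segment_def by blast
  define s where "s = r + q"
  have "s \<noteq> 0"
  proof
    assume "s = 0"
    then have "r = 0" "q = 0" using rq by (auto simp: s_def)
    then have "w = x" unfolding wrq by simp
    then show False using w(3) by blast
  qed
  then have s: "0 < s" "s \<le> 1" using rq by (auto simp: s_def)
  have "t \<noteq> 0"
  proof
    assume "t = 0"
    then have "w = x" unfolding wt by simp
    then show False using w(3) by blast
  qed
  then have t0: "0 < t" using t by simp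
  \<comment> \<open>The exit point of the ray from \<open>x\<close> through \<open>w\<close>, on the
    side \<open>y z\<close>; whether \<open>t \<le> s\<close> decides which of \<open>w'\<close> and
    \<open>p\<close> comes first.\<close>
  define w' where "w' = x + (r/s) *\<^sub>R (y - x) + (q/s) *\<^sub>R (z - x)"
  have sum1: "r/s + q/s = 1" using s by (simp add: s_def flip: add_divide_distrib)
  have w'T: "w' \<in> convex hull {x, y, z}"
    unfolding triangle_coords using rq s sum1 by (intro exI[of _ "r/s"] exI[of _ "q/s"]) (simp add: w'_def)
  have e1: "1 - q/s = r/s" using sum1 by simp
  have "w' = (1 - q/s) *\<^sub>R y + (q/s) *\<^sub>R z"
  proof -
    have "w' = (1 - (r/s + q/s)) *\<^sub>R x + (r/s) *\<^sub>R y + (q/s) *\<^sub>R z"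
      unfolding w'_def by (simp add: algebra_simps)
    then show ?thesis unfolding sum1 e1 by simp
  qed
  moreover have "0 \<le> q/s" "q/s \<le> 1" using rq s by (simp_all add: s_def)
  ultimately have w'yz: "w' \<in> closed_segment y z" unfolding closed_segment_def by blast
  have ww': "s *\<^sub>R (w' - x) = t *\<^sub>R (p - x)"
  proof -
    have "s *\<^sub>R (w' - x) = r *\<^sub>R (y - x) + q *\<^sub>R (z - x)"
      unfolding w'_def using s by (simp add: scaleR_add_right)
    also have "\<dots> = w - x" unfolding wrq by simp
    also have "\<dots> = t *\<^sub>R (p - x)" unfolding wt by (simp add: algebra_simps)
    finally show ?thesis .
  qed
  show False
  proof (cases "t \<le> s")
    case True
    have "(1/s) *\<^sub>R (s *\<^sub>R (w' - x)) = (1/s) *\<^sub>R (t *\<^sub>R (p - x))" unfolding ww' ..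
    then have "w' - x = (t/s) *\<^sub>R (p - x)" using s by simp
    then have "w' = x + (t/s) *\<^sub>R (p - x)" by (simp only: diff_eq_eq add.commute)
    then have "w' = (1 - t/s) *\<^sub>R x + (t/s) *\<^sub>R p" by (simp add: scaleR_diff_left scaleR_diff_right)
    moreover have "0 \<le> t/s" "t/s \<le> 1" using t s True by simp_all
    ultimately have "w' \<in> closed_segment x p" unfolding closed_segment_def by blast
    then show False using w'yz int by blast
  next
    case False
    have "(1/t) *\<^sub>R (s *\<^sub>R (w' - x)) = (1/t) *\<^sub>R (t *\<^sub>R (p - x))" unfolding ww' ..
    then have "p - x = (s/t) *\<^sub>R (w' - x)" using t0 by simp
    then have "p = x + (s/t) *\<^sub>R (w' - x)" by (simp only: diff_eq_eq add.commute)
    then have "p = (1 - s/t) *\<^sub>R x + (s/t) *\<^sub>R w'" by (simp add: scaleR_diff_left scaleR_diff_right)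
    moreover have "0 \<le> s/t" "s/t \<le> 1" using t0 s False by simp_all
    ultimately have "p \<in> closed_segment x w'" unfolding closed_segment_def by blast
    moreover have "closed_segment x w' \<subseteq> convex hull {x, y, z}"
      using w'T by (intro closed_segment_subset) (auto simp: hull_inc)
    ultimately show False using p by blast
  qed
qed

text \<open>\<open>A\<close> and \<open>B\<close> are interchangeable parts of a knot whose remaining part \<open>Z\<close> avoids the cell \<open>W\<close>.\<close>

definition eqv :: "(real^3) set \<Rightarrow> (real^3) set \<Rightarrow> (real^3) set \<Rightarrow> bool" where
  "eqv W A B \<longleftrightarrow> (\<forall>Z. finseg Z \<longrightarrow> Z \<inter> W = {} \<longrightarrow> (trivial_knot (A \<union> Z) \<longleftrightarrow> trivial_knot (B \<union> Z)))"

lemma eqv_refl [simp]: "eqv W A A"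
  by (simp add: eqv_def)

lemma eqv_sym: "eqv W A B \<Longrightarrow> eqv W B A"
  by (simp add: eqv_def)

lemma eqv_trans [trans]: "eqv W A B \<Longrightarrow> eqv W B C \<Longrightarrow> eqv W A C"
  by (simp add: eqv_def)

lemma eqv_context:
  assumes "eqv V A B" "finseg X" "X \<inter> V = {}" "V \<subseteq> W"
  shows "eqv W (A \<union> X) (B \<union> X)"
  unfolding eqv_def
proof (intro allI impI)
  fix Z assume "finseg Z" "Z \<inter> W = {}"
  then have "finseg (X \<union> Z)" "(X \<union> Z) \<inter> V = {}" using assms by auto
  then have "trivial_knot (A \<union> (X \<union> Z)) = trivial_knot (B \<union> (X \<union> Z))"
    using assms(1) unfolding eqv_def by blast
  then show "trivial_knot (A \<union> X \<union> Z) = trivial_knot (B \<union> X \<union> Z)" by (simp only: Un_assoc)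
qed

lemma eqv_mono: "eqv V A B \<Longrightarrow> V \<subseteq> W \<Longrightarrow> eqv W A B"
  using eqv_context[of V A B "{}" W] by simp

text \<open>The unknown remainder avoids \<open>W\<close>, so it meets the triangle at most in
  \<open>a\<close> and \<open>c\<close>; only the known part \<open>X\<close> has to be
  checked.\<close>

lemma eqv_triangle:
  assumes nd: "nondeg a b c" and X: "finseg X" "X \<inter> convex hull {a, b, c} \<subseteq> {a, c}"
    and W: "convex hull {a, b, c} \<subseteq> W \<union> {a, c}"
  shows "eqv W (closed_segment a b \<union> closed_segment b c \<union> X) (closed_segment a c \<union> X)"
  unfolding eqv_def
proof (intro allI impI)
  fix Z assume Z: "finseg Z" "Z \<inter> W = {}"
  have "(X \<union> Z) \<inter> convex hull {a, b, c} \<subseteq> {a, c}" using X Z W by blast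
  from trivial_knot_triangle[OF nd _ this] X(1) Z(1)
  show "trivial_knot (closed_segment a b \<union> closed_segment b c \<union> X \<union> Z) = trivial_knot (closed_segment a c \<union> X \<union> Z)"
    by (simp add: Un_assoc)
qed

section \<open>Trivial arcs in convex cells\<close>

text \<open>A half-open segment from a point of an open convex set to a point of its closure stays
  inside; so only points of the side opposite to \<open>b\<close> can escape.\<close>

lemma triangle_subset_cell:
  fixes W :: "'a::euclidean_space set"
  assumes W: "open W" "convex W" and b: "b \<in> W" and ac: "a \<in> closure W" "c \<in> closure W"
  shows "convex hull {a, b, c} \<subseteq> W \<union> closed_segment a c"
proof
  fix x assume "x \<in> convex hull {a, b, c}"
  then have "x \<in> convex hull (insert b {a, c})" by (simp add: insert_commute)
  then obtain y where y: "y \<in> closed_segment a c" "x \<in> closed_segment b y"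
    unfolding convex_hull_insert_segments by (auto simp: segment_convex_hull)
  have "y \<in> closure W" using y(1) ac W(2) by (meson closed_segment_subset convex_closure subsetD)
  then have "open_segment b y \<subseteq> W"
    using in_interior_closure_convex_segment[of W b y] W b by (simp add: interior_open)
  then show "x \<in> W \<union> closed_segment a c" using y b by (auto simp: open_segment_def)
qed

lemma open_segment_subset_cell:
  fixes W :: "'a::euclidean_space set"
  assumes W: "open W" "convex W" and a: "a \<in> W" and c: "c \<in> closure W"
  shows "open_segment a c \<subseteq> W" "open_segment c a \<subseteq> W"
  using in_interior_closure_convex_segment[of W a c] W a c
  by (simp_all add: interior_open open_segment_commute)

lemma triangle_subset_cell':
  fixes W :: "'a::euclidean_space set"
  assumes W: "open W" "convex W" and b: "b \<in> W" and ac: "a \<in> closure W" "c \<in> closure W"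
    and "a \<in> W \<or> c \<in> W \<or> open_segment a c \<subseteq> W"
  shows "convex hull {a, b, c} \<subseteq> W \<union> {a, c}"
proof -
  have "open_segment a c \<subseteq> W"
    using assms(6) open_segment_subset_cell[OF W] ac by blast
  then show ?thesis
    using triangle_subset_cell[OF W b ac] by (auto simp: open_segment_def)
qed

lemma not_nondeg_collinear:
  assumes "a \<noteq> b" "\<not> nondeg a b c"
  shows "collinear {a, b, c :: 'a::euclidean_space}"
proof -
  have "c \<in> affine hull {a, b}" using assms nondegI by blast
  then have "{a, b, c} \<subseteq> affine hull {a, b}" by (auto simp: hull_inc)
  then show ?thesis unfolding collinear_affine_hull by blast
qed

lemma not_nondeg_cases:
  assumes "a \<noteq> b" "\<not> nondeg a b (c :: 'a::euclidean_space)"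
  shows "a \<in> closed_segment b c \<or> b \<in> closed_segment a c \<or> c \<in> closed_segment a b"
  using not_nondeg_collinear[OF assms]
  unfolding collinear_between_cases between_mem_segment by (auto simp: closed_segment_commute)

text \<open>Of three collinear points with one of the ends in the middle, the two edges would
  overlap in more than \<open>b\<close>.\<close>

lemma collinear_middle:
  assumes ab: "a \<noteq> b" "b \<noteq> c" and n: "\<not> nondeg a b (c :: 'a::euclidean_space)"
    and int: "closed_segment a b \<inter> closed_segment b c \<subseteq> {b}"
  shows "b \<in> closed_segment a c"
proof -
  have "a \<in> closed_segment a b" "c \<in> closed_segment b c" by simp_all
  then show ?thesis using not_nondeg_cases[OF ab(1) n] int ab by blast
qed

lemma nondeg_off_plane:
  assumes "p \<noteq> q" "y \<notin> S" "affine S" "p \<in> S" "q \<in> S"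
  shows "nondeg p q y"
proof (rule nondegI[OF assms(1)])
  have "affine hull {p, q} \<subseteq> S" using assms by (intro hull_minimal) auto
  then show "y \<notin> affine hull {p, q}" using assms by blast
qed

text \<open>Insert \<open>y\<close> into the edge \<open>z v\<close>, then delete \<open>z\<close>;
  each swept triangle has the remaining edge sticking out of its plane.\<close>

lemma eqv_apex_step:
  assumes W: "open W" "convex W" and uv: "u \<in> closure W" "v \<in> closure W"
    and zy: "z \<in> W" "y \<in> W" and n: "nondeg u z v" and y: "y \<notin> affine hull {u, z, v}"
  shows "eqv W (closed_segment u z \<union> closed_segment z v) (closed_segment u y \<union> closed_segment y v)"
proof -
  let ?S = "affine hull {u, z, v}"
  have inS: "u \<in> ?S" "z \<in> ?S" "v \<in> ?S" by (auto simp: hull_inc)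
  have d: "u \<noteq> z" "z \<noteq> v" using nondeg_distinct[OF n] by auto
  have zcl: "z \<in> closure W" "y \<in> closure W" using zy closure_subset by auto
  have y1: "y \<notin> affine hull {z, v, u}" using y by (simp add: insert_commute)
  have "eqv W (closed_segment z y \<union> closed_segment y v \<union> closed_segment u z) (closed_segment z v \<union> closed_segment u z)"
  proof (rule eqv_triangle)
    show "nondeg z y v"
      by (rule nondeg_perms(1)[OF nondeg_off_plane[OF d(2) y affine_affine_hull inS(2,3)]])
    have "u \<notin> affine hull {y, z, v}" by (rule affine_exchange[OF nondeg_perms(3)[OF n] y1])
    then have "closed_segment z u \<inter> affine hull {z, y, v} \<subseteq> {z}"
      by (intro segment_Int_affine) (auto simp: hull_inc insert_commute affine_affine_hull)
    then show "closed_segment u z \<inter> convex hull {z, y, v} \<subseteq> {z, v}"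
      using convex_hull_subset_affine_hull[of "{z, y, v}"] by (auto simp: closed_segment_commute)
    show "convex hull {z, y, v} \<subseteq> W \<union> {z, v}"
      by (rule triangle_subset_cell'[OF W]) (use zy uv zcl in auto)
  qed simp
  moreover have "eqv W (closed_segment u z \<union> closed_segment z y \<union> closed_segment y v) (closed_segment u y \<union> closed_segment y v)"
  proof (rule eqv_triangle)
    show "nondeg u z y" by (rule nondeg_off_plane[OF d(1) y affine_affine_hull inS(1,2)])
    have "v \<notin> affine hull {y, u, z}" by (rule affine_exchange[OF n y])
    then have "closed_segment y v \<inter> affine hull {u, z, y} \<subseteq> {y}"
      by (intro segment_Int_affine) (auto simp: hull_inc insert_commute affine_affine_hull)
    then show "closed_segment y v \<inter> convex hull {u, z, y} \<subseteq> {u, y}"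
      using convex_hull_subset_affine_hull[of "{u, z, y}"] by auto
    show "convex hull {u, z, y} \<subseteq> W \<union> {u, y}"
      by (rule triangle_subset_cell'[OF W]) (use zy uv zcl in auto)
  qed simp
  ultimately show ?thesis
    using eqv_trans[OF eqv_sym, of W "closed_segment z y \<union> closed_segment y v \<union> closed_segment u z"
       "closed_segment u z \<union> closed_segment z v"] by (simp add: Un_ac)
qed

lemma eqv_segment_apex:
  assumes W: "open W" "convex W" and uv: "u \<in> closure W" "v \<in> closure W" "u \<noteq> v"
    and o: "open_segment u v \<subseteq> W" and y: "y \<in> W" "y \<notin> affine hull {u, v}"
  shows "eqv W (closed_segment u v) (closed_segment u y \<union> closed_segment y v)"
proof -
  have "eqv W (closed_segment u y \<union> closed_segment y v \<union> {}) (closed_segment u v \<union> {})"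
  proof (rule eqv_triangle)
    show "nondeg u y v" using nondegI[OF uv(3) y(2)] by (rule nondeg_perms)
    show "convex hull {u, y, v} \<subseteq> W \<union> {u, v}"
      by (rule triangle_subset_cell'[OF W]) (use y uv o in auto)
  qed simp_all
  then show ?thesis by (simp add: eqv_sym)
qed

text \<open>Two apexes are compared through a third one, generic for both. Since the ends are
  outside \<open>W\<close>, a collinear apex lies between them, and the path is then the straight
  segment.\<close>

lemma eqv_apex:
  assumes W: "open W" "convex W" and u: "u \<in> closure W" "u \<notin> W" and v: "v \<in> closure W" "v \<notin> W"
    and uv: "u \<noteq> v" and z: "z \<in> W" "z' \<in> W"
  shows "eqv W (closed_segment u z \<union> closed_segment z v) (closed_segment u z' \<union> closed_segment z' v)"
proof -
  obtain y where y: "y \<in> W" "y \<notin> affine hull {u, z, v}" "y \<notin> affine hull {u, z', v}"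
    using ex_generic_point[OF W(1), of "[(u, z, v), (u, z', v)]"] z by auto
  have "eqv W (closed_segment u z \<union> closed_segment z v) (closed_segment u y \<union> closed_segment y v)"
    if z: "z \<in> W" and y': "y \<notin> affine hull {u, z, v}" for z
  proof (cases "nondeg u z v")
    case True
    show ?thesis by (rule eqv_apex_step[OF W u(1) v(1) z y(1) True y'])
  next
    case False
    have zuv: "z \<noteq> u" "z \<noteq> v" using z u v by auto
    have "u \<notin> closed_segment z v"
      using open_segment_subset_cell(1)[OF W z v(1)] u uv zuv by (auto simp: open_segment_def)
    moreover have "v \<notin> closed_segment u z"
      using open_segment_subset_cell(2)[OF W z u(1)] v uv zuv by (auto simp: open_segment_def)
    ultimately have mid: "z \<in> closed_segment u v"
      using not_nondeg_cases[OF zuv(1)[symmetric] False] by blast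
    have "open_segment u v \<subseteq> W"
    proof -
      have "closed_segment u v = closed_segment u z \<union> closed_segment z v"
        using Un_closed_segment[OF mid] by simp
      then show ?thesis
        using open_segment_subset_cell[OF W z] u(1) v(1) z unfolding open_segment_def by blast
    qed
    moreover have "y \<notin> affine hull {u, v}" using y' hull_mono[of "{u, v}" "{u, z, v}"] by auto
    ultimately have "eqv W (closed_segment u v) (closed_segment u y \<union> closed_segment y v)"
      using y(1) u(1) v(1) uv by (intro eqv_segment_apex[OF W]) auto
    then show ?thesis using Un_closed_segment[OF mid] by simp
  qed
  from this[OF z(1) y(2)] this[OF z(2) y(3)] show ?thesis by (blast intro: eqv_trans eqv_sym)
qed

text \<open>One apex suffices: between distinct frontier points every apex is equivalent, by
  \<open>triv_all\<close>.\<close>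

definition triv :: "(real^3) set \<Rightarrow> real^3 \<Rightarrow> real^3 \<Rightarrow> (real^3) set \<Rightarrow> bool" where
  "triv W u v A \<longleftrightarrow> (\<exists>z\<in>W. eqv W A (closed_segment u z \<union> closed_segment z v))"

lemma triv_eqv:
  "eqv W A B \<Longrightarrow> triv W u v B \<Longrightarrow> triv W u v A"
  unfolding triv_def by (meson eqv_trans)

lemma triv_mono:
  "triv V u v A \<Longrightarrow> V \<subseteq> W \<Longrightarrow> triv W u v A"
  unfolding triv_def by (meson eqv_mono subsetD)

lemma triv_commute: "triv W u v A \<longleftrightarrow> triv W v u A"
  unfolding triv_def by (simp add: closed_segment_commute Un_commute)

lemma triv_all:
  assumes "open W" "convex W" "u \<in> closure W" "u \<notin> W" "v \<in> closure W" "v \<notin> W" "u \<noteq> v"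
    and "triv W u v A" "z \<in> W"
  shows "eqv W A (closed_segment u z \<union> closed_segment z v)"
  using assms(8) eqv_apex[OF assms(1-7) _ assms(9)] unfolding triv_def by (blast intro: eqv_trans)

text \<open>If \<open>v\<close> is off the plane of \<open>u x y\<close>, deleting \<open>x\<close>
  is a triangle move at once, and a straight corner at \<open>x\<close> disappears by itself. The
  planar case takes a detour through space.\<close>

lemma triv_three_segments:
  assumes W: "open W" "convex W" and uv: "u \<in> closure W" "v \<in> closure W"
    and xy: "x \<in> W" "y \<in> W" and ne: "u \<noteq> x" "x \<noteq> y" "y \<noteq> v"
    and i1: "closed_segment u x \<inter> closed_segment x y \<subseteq> {x}"
    and i2: "closed_segment x y \<inter> closed_segment y v \<subseteq> {y}"
    and i3: "closed_segment u x \<inter> closed_segment y v = {}"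
  shows "triv W u v (closed_segment u x \<union> closed_segment x y \<union> closed_segment y v)"
proof -
  have cl: "x \<in> closure W" "y \<in> closure W" using xy closure_subset by auto
  consider "\<not> nondeg u x y" | "nondeg u x y" "v \<notin> affine hull {u, x, y}"
    | "nondeg u x y" "v \<in> affine hull {u, x, y}" by blast
  then show ?thesis
  proof cases
    case 1
    have "x \<in> closed_segment u y" by (rule collinear_middle[OF ne(1,2) 1 i1])
    then have "closed_segment u x \<union> closed_segment x y = closed_segment u y"
      using Un_closed_segment by blast
    then show ?thesis unfolding triv_def using xy by (intro bexI[of _ y]) auto
  next
    case 2
    have "eqv W (closed_segment u x \<union> closed_segment x y \<union> closed_segment y v) (closed_segment u y \<union> closed_segment y v)"
    proof (rule eqv_triangle[OF 2(1)])
      have "closed_segment y v \<inter> affine hull {u, x, y} \<subseteq> {y}"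
        using 2(2) by (intro segment_Int_affine) (auto simp: hull_inc affine_affine_hull)
      then show "closed_segment y v \<inter> convex hull {u, x, y} \<subseteq> {u, y}"
        using convex_hull_subset_affine_hull[of "{u, x, y}"] by auto
      show "convex hull {u, x, y} \<subseteq> W \<union> {u, y}"
        by (rule triangle_subset_cell'[OF W]) (use xy uv cl in auto)
    qed simp
    then show ?thesis unfolding triv_def using xy by blast
  next
    \<comment> \<open>The edge \<open>y v\<close> may run through the triangle \<open>u x y\<close>
      here. With \<open>z\<close> off the plane, the path goes from \<open>u x y v\<close> to
      \<open>u z x y v\<close>, \<open>u z y v\<close> and \<open>u z v\<close>.\<close>
    case 3
    define S where "S = affine hull {u, x, y}"
    have S: "affine S" "u \<in> S" "x \<in> S" "y \<in> S" "v \<in> S"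
      using 3(2) by (auto simp: S_def affine_affine_hull hull_inc)
    have segS: "closed_segment p q \<subseteq> S" if "p \<in> S" "q \<in> S" for p q
      using that S(1) by (simp add: closed_segment_subset affine_imp_convex)
    obtain z where z: "z \<in> W" "z \<notin> affine hull {u, x, y}"
      using ex_generic_point[OF W(1), of "[(u, x, y)]"] xy by auto
    have zS: "z \<notin> S" using z(2) by (simp add: S_def)
    have zcl: "z \<in> closure W" using z(1) closure_subset by auto
    have "eqv W (closed_segment u z \<union> closed_segment z x \<union> (closed_segment x y \<union> closed_segment y v))
       (closed_segment u x \<union> (closed_segment x y \<union> closed_segment y v))"
    proof (rule eqv_triangle)
      show "nondeg u z x" using nondeg_off_plane[OF ne(1) zS S(1-3)] by (rule nondeg_perms)
      have "convex hull {u, z, x} \<inter> S \<subseteq> closed_segment u x"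
        by (rule triangle_Int_affine[OF S(1-3) zS])
      then show "(closed_segment x y \<union> closed_segment y v) \<inter> convex hull {u, z, x} \<subseteq> {u, x}"
        using segS[OF S(3,4)] segS[OF S(4,5)] i1 i3 by blast
      show "convex hull {u, z, x} \<subseteq> W \<union> {u, x}"
        by (rule triangle_subset_cell'[OF W]) (use xy z uv cl in auto)
    qed simp
    moreover have "eqv W (closed_segment z x \<union> closed_segment x y \<union> (closed_segment u z \<union> closed_segment y v))
       (closed_segment z y \<union> (closed_segment u z \<union> closed_segment y v))"
    proof (rule eqv_triangle)
      show "nondeg z x y" using nondeg_off_plane[OF ne(2) zS S(1,3,4)] by (rule nondeg_perms)
      have "convex hull {x, z, y} \<inter> S \<subseteq> closed_segment x y"
        by (rule triangle_Int_affine[OF S(1,3,4) zS])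
      then have "closed_segment y v \<inter> convex hull {x, z, y} \<subseteq> {y}"
        using segS[OF S(4,5)] i2 by blast
      moreover have "u \<notin> affine hull {z, x, y}"
        by (rule affine_exchange[OF nondeg_perms(3)[OF 3(1)]]) (use z(2) in \<open>simp add: insert_commute\<close>)
      then have "closed_segment z u \<inter> affine hull {z, x, y} \<subseteq> {z}"
        by (intro segment_Int_affine) (auto simp: hull_inc affine_affine_hull)
      ultimately show "(closed_segment u z \<union> closed_segment y v) \<inter> convex hull {z, x, y} \<subseteq> {z, y}"
        using convex_hull_subset_affine_hull[of "{z, x, y}"]
        by (simp add: insert_commute closed_segment_commute) blast
      show "convex hull {z, x, y} \<subseteq> W \<union> {z, y}"
        by (rule triangle_subset_cell'[OF W]) (use xy z zcl cl in auto)
    qed simp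
    moreover have "eqv W (closed_segment z y \<union> closed_segment y v \<union> closed_segment u z)
       (closed_segment z v \<union> closed_segment u z)"
    proof (rule eqv_triangle)
      show "nondeg z y v" using nondeg_off_plane[OF ne(3) zS S(1,4,5)] by (rule nondeg_perms)
      have T: "convex hull {y, z, v} \<inter> S \<subseteq> closed_segment y v"
        by (rule triangle_Int_affine[OF S(1,4,5) zS])
      have "u \<in> closed_segment u x" by simp
      then have u: "u \<notin> closed_segment y v" using i3 by blast
      have "closed_segment z u \<inter> convex hull {z, y, v} \<subseteq> {z}"
      proof (rule ray_lemma)
        show "u \<notin> convex hull {z, y, v}" using T u S(2) by (auto simp: insert_commute)
        have "closed_segment u z \<inter> S \<subseteq> {u}" by (rule segment_Int_affine[OF S(1,2) zS])
        then show "closed_segment z u \<inter> closed_segment y v = {}"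
          using segS[OF S(4,5)] u by (auto simp: closed_segment_commute)
      qed
      then show "closed_segment u z \<inter> convex hull {z, y, v} \<subseteq> {z, v}"
        by (auto simp: closed_segment_commute)
      show "convex hull {z, y, v} \<subseteq> W \<union> {z, v}"
        by (rule triangle_subset_cell'[OF W]) (use xy z uv zcl in auto)
    qed simp
    ultimately have "eqv W (closed_segment u x \<union> closed_segment x y \<union> closed_segment y v)
        (closed_segment u z \<union> closed_segment z v)"
      unfolding eqv_def by (simp add: Un_ac)
    then show ?thesis unfolding triv_def using z by blast
  qed
qed

section \<open>Gluing trivial arcs along a plane\<close>

lemma closure_Int_halfspace:
  assumes "x \<in> closure W" "s < h \<bullet> x"
  shows "x \<in> closure (W \<inter> {y. s < h \<bullet> y})"
proof -
  have "open {y. s < h \<bullet> y}" by (rule open_halfspace_gt)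
  from open_Int_closure_subset[OF this, of W] assms show ?thesis by (auto simp: Int_commute)
qed

lemma segment_above:
  assumes "h \<bullet> a \<ge> c" "h \<bullet> b > c" "y \<in> closed_segment a b"
  shows "h \<bullet> y > c \<or> y = a"
  using segment_below[of "- h" b "- c" a y] assms by (simp add: closed_segment_commute)

text \<open>The point \<open>p\<close> on the cutting plane is a limit along the segment towards
  \<open>u\<close>, which runs inside the cell and strictly above the plane.\<close>

lemma closure_Int_halfspace':
  fixes W :: "'a::euclidean_space set"
  assumes W: "open W" "convex W" and p: "p \<in> W" "h \<bullet> p = s" and u: "u \<in> closure W" "s < h \<bullet> u"
  shows "p \<in> closure (W \<inter> {y. s < h \<bullet> y})"
proof -
  have "open_segment p u \<subseteq> W \<inter> {y. s < h \<bullet> y}"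
    using open_segment_subset_cell(1)[OF W p(1) u(1)] segment_above[of s h p u] p u
    by (auto simp: open_segment_def)
  then have "closure (open_segment p u) \<subseteq> closure (W \<inter> {y. s < h \<bullet> y})" by (rule closure_mono)
  moreover have "p \<in> closure (open_segment p u)" using p u by auto
  ultimately show ?thesis by blast
qed

lemma segment_ge: "h \<bullet> a \<ge> c \<Longrightarrow> h \<bullet> b \<ge> c \<Longrightarrow> y \<in> closed_segment a b \<Longrightarrow> h \<bullet> y \<ge> c"
  using closed_segment_subset[of a "{y. h \<bullet> y \<ge> c}" b] by (auto simp: convex_halfspace_ge)

lemma segment_le: "h \<bullet> a \<le> c \<Longrightarrow> h \<bullet> b \<le> c \<Longrightarrow> y \<in> closed_segment a b \<Longrightarrow> h \<bullet> y \<le> c"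
  using segment_ge[of "- c" "- h" a b y] by simp

lemma segment_gt: "h \<bullet> a > c \<Longrightarrow> h \<bullet> b > c \<Longrightarrow> y \<in> closed_segment a b \<Longrightarrow> h \<bullet> y > c"
  using closed_segment_subset[of a "{y. h \<bullet> y > c}" b] by (auto simp: convex_halfspace_gt)

lemma segment_lt: "h \<bullet> a < c \<Longrightarrow> h \<bullet> b < c \<Longrightarrow> y \<in> closed_segment a b \<Longrightarrow> h \<bullet> y < c"
  using segment_gt[of "- c" "- h" a b y] by simp

text \<open>The upper piece becomes \<open>u z1 p\<close> while the lower one is fixed, then the
  lower piece becomes \<open>p z2 v\<close>. Deleting \<open>p\<close> leaves the three segments
  \<open>u z1 z2 v\<close>.\<close>

lemma triv_glue_once:
  assumes W: "open W" "convex W" and u: "u \<in> closure W" "u \<notin> W" and v: "v \<in> closure W" "v \<notin> W"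
    and p: "p \<in> W" "h \<bullet> p = s" and hu: "s < h \<bullet> u" and hv: "h \<bullet> v < s"
    and A: "finseg A1" "finseg A2" "\<And>x. x \<in> A1 \<Longrightarrow> s \<le> h \<bullet> x" "\<And>x. x \<in> A2 \<Longrightarrow> h \<bullet> x \<le> s"
    and t1: "triv (W \<inter> {y. s < h \<bullet> y}) u p A1" and t2: "triv (W \<inter> {y. h \<bullet> y < s}) p v A2"
  shows "triv W u v (A1 \<union> A2)"
proof -
  let ?P = "W \<inter> {y. s < h \<bullet> y}" and ?M = "W \<inter> {y. h \<bullet> y < s}"
  have M: "?M = W \<inter> {y. - s < (- h) \<bullet> y}" by auto
  have oc: "open ?P" "convex ?P" "open ?M" "convex ?M"
    using W by (auto intro: open_halfspace_gt open_halfspace_lt convex_halfspace_gt convex_halfspace_lt convex_Int)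
  have ne: "u \<noteq> p" "p \<noteq> v" "u \<noteq> v" using p hu hv by auto
  have ne': "?P \<noteq> {}" "?M \<noteq> {}" using t1 t2 unfolding triv_def by blast+
  have clP: "u \<in> closure ?P" "p \<in> closure ?P"
    using closure_Int_halfspace[OF u(1) hu] closure_Int_halfspace'[OF W p u(1) hu] by auto
  have clM: "v \<in> closure ?M" "p \<in> closure ?M"
    using closure_Int_halfspace[OF v(1), of "- s" "- h"] closure_Int_halfspace'[OF W p(1) _ v(1), of "- h" "- s"] hv p(2)
    unfolding M by auto
  \<comment> \<open>Generic apexes make the triangle \<open>z1 p z2\<close> meet the edges to
    \<open>u\<close> and \<open>v\<close> only in its corners.\<close>
  obtain z1 where z1: "z1 \<in> ?P" "z1 \<notin> affine hull {u, p}" "z1 \<notin> affine hull {p, v}"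
    using ex_generic_point[OF oc(1) ne'(1), of "[(u, p, p), (p, v, v)]"] by auto
  obtain z2 where z2: "z2 \<in> ?M" "z2 \<notin> affine hull {u, z1, p}" "z2 \<notin> affine hull {z1, p, v}"
    using ex_generic_point[OF oc(3) ne'(2), of "[(u, z1, p), (z1, p, v)]"] by auto
  have zW: "z1 \<in> W" "z2 \<in> W" "s < h \<bullet> z1" "h \<bullet> z2 < s" using z1 z2 by auto
  have zne: "z1 \<noteq> p" "z2 \<noteq> p" "z1 \<noteq> z2" "u \<noteq> z1" "z2 \<noteq> v" using zW p u v by auto
  have e1: "eqv ?P A1 (closed_segment u z1 \<union> closed_segment z1 p)"
    by (rule triv_all[OF oc(1,2) clP(1) _ clP(2) _ ne(1) t1 z1(1)]) (use u p in auto)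
  have e2: "eqv ?M A2 (closed_segment p z2 \<union> closed_segment z2 v)"
    by (rule triv_all[OF oc(3,4) clM(2) _ clM(1) _ ne(2) t2 z2(1)]) (use v p in auto)
  have "eqv W (A1 \<union> A2) (closed_segment u z1 \<union> closed_segment z1 p \<union> A2)"
    by (rule eqv_context[OF e1 A(2)]) (use A(4) in force)+
  also have "eqv W (closed_segment u z1 \<union> closed_segment z1 p \<union> A2)
     (closed_segment u z1 \<union> closed_segment z1 p \<union> (closed_segment p z2 \<union> closed_segment z2 v))"
  proof -
    have "(closed_segment u z1 \<union> closed_segment z1 p) \<inter> ?M = {}"
      using segment_ge[of s h u z1] segment_ge[of s h z1 p] zW hu p by force
    then have "eqv W (A2 \<union> (closed_segment u z1 \<union> closed_segment z1 p))
       ((closed_segment p z2 \<union> closed_segment z2 v) \<union> (closed_segment u z1 \<union> closed_segment z1 p))"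
      by (intro eqv_context[OF e2]) auto
    then show ?thesis by (simp only: Un_commute)
  qed
  also have "eqv W (closed_segment u z1 \<union> closed_segment z1 p \<union> (closed_segment p z2 \<union> closed_segment z2 v))
      (closed_segment u z1 \<union> closed_segment z1 z2 \<union> closed_segment z2 v)"
  proof -
    have sub: "z2 \<notin> affine hull {z1, p}" using z2(2) hull_mono[of "{z1, p}" "{u, z1, p}"] by auto
    have "eqv W (closed_segment z1 p \<union> closed_segment p z2 \<union> (closed_segment u z1 \<union> closed_segment z2 v))
      (closed_segment z1 z2 \<union> (closed_segment u z1 \<union> closed_segment z2 v))"
    proof (rule eqv_triangle)
      show "nondeg z1 p z2" using zne(1) sub by (rule nondegI)
      have "u \<notin> affine hull {z2, z1, p}"
      proof (rule affine_exchange)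
        show "nondeg z1 p u" using nondegI[OF ne(1) z1(2)] by (rule nondeg_perms(5))
        show "z2 \<notin> affine hull {z1, p, u}" using z2(2) by (simp add: insert_commute)
      qed
      then have "closed_segment z1 u \<inter> affine hull {z1, p, z2} \<subseteq> {z1}"
        by (intro segment_Int_affine) (simp_all add: hull_inc affine_affine_hull insert_commute)
      moreover have "v \<notin> affine hull {z2, z1, p}"
      proof (rule affine_exchange)
        show "nondeg z1 p v" using nondegI[OF ne(2) z1(3)] by (rule nondeg_perms(4))
        show "z2 \<notin> affine hull {z1, p, v}" by (rule z2(3))
      qed
      then have "closed_segment z2 v \<inter> affine hull {z1, p, z2} \<subseteq> {z2}"
        by (intro segment_Int_affine) (simp_all add: hull_inc affine_affine_hull insert_commute)
      ultimately show "(closed_segment u z1 \<union> closed_segment z2 v) \<inter> convex hull {z1, p, z2} \<subseteq> {z1, z2}"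
        using convex_hull_subset_affine_hull[of "{z1, p, z2}"] closed_segment_commute[of u z1] by blast
      have "convex hull {z1, p, z2} \<subseteq> W" using zW p W(2) by (intro hull_minimal) auto
      then show "convex hull {z1, p, z2} \<subseteq> W \<union> {z1, z2}" by blast
    qed simp
    then show ?thesis by (simp only: Un_ac)
  qed
  finally have "eqv W (A1 \<union> A2) (closed_segment u z1 \<union> closed_segment z1 z2 \<union> closed_segment z2 v)" .
  moreover have "triv W u v (closed_segment u z1 \<union> closed_segment z1 z2 \<union> closed_segment z2 v)"
  proof (rule triv_three_segments[OF W u(1) v(1) zW(1,2) zne(4,3,5)])
    have "nondeg u z1 z2"
      by (rule nondegI[OF zne(4)]) (use z2(2) hull_mono[of "{u, z1}" "{u, z1, p}"] in auto)
    then show "closed_segment u z1 \<inter> closed_segment z1 z2 \<subseteq> {z1}" by (rule nondeg_segments_Int)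
    have "v \<notin> affine hull {z2, z1, p}"
    proof (rule affine_exchange)
      show "nondeg z1 p v" using nondegI[OF ne(2) z1(3)] by (rule nondeg_perms(4))
      show "z2 \<notin> affine hull {z1, p, v}" by (rule z2(3))
    qed
    then have "nondeg z1 z2 v"
      by (intro nondegI[OF zne(3)]) (use hull_mono[of "{z1, z2}" "{z2, z1, p}"] in auto)
    then show "closed_segment z1 z2 \<inter> closed_segment z2 v \<subseteq> {z2}" by (rule nondeg_segments_Int)
    show "closed_segment u z1 \<inter> closed_segment z2 v = {}"
      using segment_gt[OF hu zW(3)] segment_lt[OF zW(4) hv] by force
  qed
  ultimately show ?thesis by (rule triv_eqv)
qed

text \<open>The arc dips below the level \<open>s\<close> once, between \<open>p\<close> and \<open>q\<close>; the dip is replaced by a chord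
  at the slightly higher level \<open>s'\<close>, so that the ends of the chord are inside the open upper part.\<close>

lemma eqv_glue_twice:
  assumes W: "open W" "convex W" and pq: "p \<in> W" "q \<in> W" "p \<noteq> q" "h \<bullet> p = s" "h \<bullet> q = s"
    and pq': "p' \<in> W" "q' \<in> W" "p' \<noteq> q'" "h \<bullet> p' = s'" "h \<bullet> q' = s'" and ss: "s < s'"
    and fin: "finseg B1" "finseg B2" "finseg A"
    and B1: "\<And>x. x \<in> B1 \<Longrightarrow> s' < h \<bullet> x \<or> x = p'" and B2: "\<And>x. x \<in> B2 \<Longrightarrow> s' < h \<bullet> x \<or> x = q'"
    and int: "closed_segment p' p \<inter> closed_segment q q' = {}"
    and t: "triv (W \<inter> {y. h \<bullet> y < s}) p q A"
  shows "eqv W (B1 \<union> closed_segment p' p \<union> A \<union> closed_segment q q' \<union> B2) (B1 \<union> closed_segment p' q' \<union> B2)"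
proof -
  let ?M = "W \<inter> {y. h \<bullet> y < s}"
  obtain z where z: "z \<in> ?M" and e: "eqv ?M A (closed_segment p z \<union> closed_segment z q)"
    using t unfolding triv_def by blast
  have nd: "nondeg p q z" if "h \<bullet> z \<noteq> c" "h \<bullet> p = c" "h \<bullet> q = c" "p \<noteq> q" for p q z :: "real^3" and c
    by (rule nondeg_off_plane[of p q z "{x. h \<bullet> x = c}"]) (use that in \<open>auto simp: affine_hyperplane\<close>)
  define X where "X = B1 \<union> closed_segment p' p \<union> closed_segment q q' \<union> B2"
  have sX: "s < h \<bullet> x \<or> x = p \<or> x = q" if "x \<in> X" for x
    using that B1[of x] B2[of x] ss pq pq' segment_above[of s h p p' x] segment_above[of s h q q' x]
    unfolding X_def closed_segment_commute[of p' p] by auto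
  have finX: "finseg X" using fin by (simp add: X_def)
  have "eqv W (A \<union> X) (closed_segment p z \<union> closed_segment z q \<union> X)"
    by (rule eqv_context[OF e finX]) (use sX pq in force)+
  also have "eqv W (closed_segment p z \<union> closed_segment z q \<union> X) (closed_segment p q \<union> X)"
  proof (rule eqv_triangle[OF _ finX])
    show "nondeg p z q" by (rule nondeg_perms(1)[OF nd[of z s p q]]) (use z pq in auto)
    have "convex hull {p, z, q} \<subseteq> {x. h \<bullet> x \<le> s}"
      using z pq by (intro hull_minimal) (auto simp: convex_halfspace_le)
    then show "X \<inter> convex hull {p, z, q} \<subseteq> {p, q}" using sX by force
    have "convex hull {p, z, q} \<subseteq> W" using z pq W(2) by (intro hull_minimal) auto
    then show "convex hull {p, z, q} \<subseteq> W \<union> {p, q}" by blast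
  qed
  also have "eqv W (closed_segment p q \<union> X) (closed_segment p' q \<union> (B1 \<union> closed_segment q q' \<union> B2))"
  proof -
    have "eqv W (closed_segment p' p \<union> closed_segment p q \<union> (B1 \<union> closed_segment q q' \<union> B2))
        (closed_segment p' q \<union> (B1 \<union> closed_segment q q' \<union> B2))"
    proof (rule eqv_triangle)
      show "nondeg p' p q" by (rule nondeg_perms(4)[OF nd[of p' s p q]]) (use pq pq' ss in auto)
      \<comment> \<open>The triangle stays below the level \<open>s'\<close> except at
        \<open>p'\<close>, while \<open>B1\<close> and \<open>B2\<close> stay at or above it. The
        edge \<open>q q'\<close> ends outside the triangle and could enter it only by meeting the
        side \<open>p' p\<close>, which \<open>int\<close> forbids.\<close>
      have lev: "s' > h \<bullet> x \<or> x = p'" if "x \<in> convex hull {p', p, q}" for x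
      proof -
        have "x \<in> convex hull (insert p' {p, q})" using that .
        then obtain y where y: "y \<in> closed_segment p q" "x \<in> closed_segment p' y"
          unfolding convex_hull_insert_segments by (auto simp: segment_convex_hull)
        have "h \<bullet> y \<le> s" using segment_le[of h p s q y] y(1) pq by simp
        then show ?thesis using segment_below[of h y s' p' x] y(2) pq' ss
          by (auto simp: closed_segment_commute)
      qed
      have q'T: "q' \<notin> convex hull {p', p, q}" using lev pq' by force
      have "closed_segment q q' \<inter> convex hull {q, p', p} \<subseteq> {q}"
        by (rule ray_lemma) (use q'T int in \<open>auto simp: insert_commute\<close>)
      moreover have "{q, p', p} = {p', p, q}" by auto
      ultimately show "(B1 \<union> closed_segment q q' \<union> B2) \<inter> convex hull {p', p, q} \<subseteq> {p', q}"
        using lev B1 B2 pq'(3) q'T by force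
      have "convex hull {p', p, q} \<subseteq> W" using pq' pq W(2) by (intro hull_minimal) auto
      then show "convex hull {p', p, q} \<subseteq> W \<union> {p', q}" by blast
    qed (use fin in simp)
    then show ?thesis by (simp only: X_def Un_ac)
  qed
  also have "eqv W (closed_segment p' q \<union> (B1 \<union> closed_segment q q' \<union> B2)) (closed_segment p' q' \<union> (B1 \<union> B2))"
  proof -
    have "eqv W (closed_segment p' q \<union> closed_segment q q' \<union> (B1 \<union> B2)) (closed_segment p' q' \<union> (B1 \<union> B2))"
    proof (rule eqv_triangle)
      show "nondeg p' q q'" by (rule nondeg_perms(1)[OF nd[of q s' p' q']]) (use pq pq' ss in auto)
      have "convex hull {p', q, q'} \<subseteq> {x. h \<bullet> x \<le> s'}"
        using pq pq' ss by (intro hull_minimal) (auto simp: convex_halfspace_le)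
      then show "(B1 \<union> B2) \<inter> convex hull {p', q, q'} \<subseteq> {p', q'}" using B1 B2 by force
      have "convex hull {p', q, q'} \<subseteq> W" using pq' pq W(2) by (intro hull_minimal) auto
      then show "convex hull {p', q, q'} \<subseteq> W \<union> {p', q'}" by blast
    qed (use fin in simp)
    then show ?thesis by (simp only: Un_ac)
  qed
  finally have "eqv W (A \<union> X) (closed_segment p' q' \<union> (B1 \<union> B2))" .
  then show ?thesis by (simp only: X_def Un_ac)
qed

section \<open>Planes that cut a polygonal line at most twice\<close>

fun changes :: "bool list \<Rightarrow> nat" where
  "changes (a # b # xs) = (if a = b then 0 else 1) + changes (b # xs)"
| "changes _ = 0"

lemma changes_append: "changes (xs @ m # ys) = changes (xs @ [m]) + changes (m # ys)"
proof (induction xs)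
  case (Cons a xs)
  then show ?case by (cases xs) auto
qed simp

lemma changes_insert: "y = a \<or> y = b \<Longrightarrow> changes (xs @ a # y # b # ys) = changes (xs @ a # b # ys)"
  using changes_append[of xs a "y # b # ys"] changes_append[of xs a "b # ys"] by auto

lemma changes_delete1: "changes (l @ r) \<le> changes (l @ y # r)"
proof (cases l rule: rev_cases)
  case Nil
  then show ?thesis by (cases r) auto
next
  case (snoc l' a)
  show ?thesis
  proof (cases r)
    case Nil
    then show ?thesis using snoc changes_append[of l' a "[y]"] by simp
  next
    case (Cons b r')
    then show ?thesis
      using snoc changes_append[of l' a "y # b # r'"] changes_append[of l' a "b # r'"] by auto
  qed
qed

lemma changes_delete: "changes (l @ r) \<le> changes (l @ m @ r)"
proof (induction m)
  case (Cons y m)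
  then show ?case using changes_delete1[of l "m @ r" y] by simp
qed simp

lemma changes_Not [simp]: "changes (map Not xs) = changes xs"
  by (induction xs rule: changes.induct) auto

lemma changes_rev: "changes (rev xs) = changes xs"
proof (induction xs rule: changes.induct)
  case (1 a b xs)
  then show ?case using changes_append[of "rev xs" b "[a]"] by auto
qed auto

lemma changes_hd_last: "xs \<noteq> [] \<Longrightarrow> hd xs \<noteq> last xs \<Longrightarrow> 1 \<le> changes xs"
proof (induction xs rule: changes.induct)
  case (1 a b xs)
  then show ?case by (cases "a = b") auto
qed auto

lemma changes_split:
  assumes "xs \<noteq> []"
  obtains A D where "xs = A @ D" "A \<noteq> []" "\<forall>y\<in>set A. P y = P (hd xs)"
    "D = [] \<or> P (hd D) \<noteq> P (hd xs) \<and> Suc (changes (map P D)) \<le> changes (map P xs)"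
proof -
  let ?Q = "\<lambda>y. P y = P (hd xs)"
  let ?A = "takeWhile ?Q xs" and ?D = "dropWhile ?Q xs"
  have ne: "?A \<noteq> []" using assms by (cases xs) auto
  have all: "\<forall>y\<in>set ?A. ?Q y" by (auto dest: set_takeWhileD)
  have D: "?D = [] \<or> P (hd ?D) \<noteq> P (hd xs) \<and> Suc (changes (map P ?D)) \<le> changes (map P xs)"
  proof (cases "?D")
    case (Cons d ds)
    have d: "P d \<noteq> P (hd xs)" using hd_dropWhile[of ?Q xs] Cons by auto
    have "hd ?A \<in> set ?A" using ne by simp
    then have "P (hd ?A) = P (hd xs)" using all by blast
    moreover have "hd (map P ?A @ [P d]) = P (hd ?A)" using ne by (simp add: hd_map)
    ultimately have "hd (map P ?A @ [P d]) \<noteq> last (map P ?A @ [P d])" using d by (metis last_snoc)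
    then have "1 \<le> changes (map P ?A @ [P d])" by (intro changes_hd_last) simp_all
    moreover have "map P xs = map P ?A @ P d # map P ds"
      using arg_cong[OF takeWhile_dropWhile_id[of ?Q xs], of "map P"] Cons by simp
    then have "changes (map P xs) = changes (map P ?A @ [P d]) + changes (map P ?D)"
      using changes_append[of "map P ?A" "P d" "map P ds"] Cons by simp
    ultimately show ?thesis using d Cons by simp
  qed simp
  show thesis by (rule that[OF _ ne all D]) simp
qed

text \<open>Each maximal constant block after the first uses up one change, so there are at most
  three blocks.\<close>

lemma changes_le_2_split:
  assumes "changes (map P xs) \<le> 2" "xs \<noteq> []"
  obtains A B C where "xs = A @ B @ C" "A \<noteq> []" "\<forall>y\<in>set A. P y = P (hd xs)"
    "\<forall>y\<in>set B. P y \<noteq> P (hd xs)" "\<forall>y\<in>set C. P y = P (hd xs)" "B = [] \<longrightarrow> C = []"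
proof -
  obtain A D where A: "xs = A @ D" "A \<noteq> []" "\<forall>y\<in>set A. P y = P (hd xs)"
    "D = [] \<or> P (hd D) \<noteq> P (hd xs) \<and> Suc (changes (map P D)) \<le> changes (map P xs)"
    by (rule changes_split[OF assms(2), where P = P])
  define x where "x = P (hd xs)"
  note A = A[folded x_def]
  show thesis
  proof (cases "D = []")
    case True
    show thesis
      by (rule that[folded x_def, of A "[]" "[]"]) (use A(1) True in simp, rule A(2), rule A(3), simp_all)
  next
    case False
    then have D: "P (hd D) \<noteq> x" "changes (map P D) \<le> 1" using A(4) assms(1) by simp_all
    obtain B E where B: "D = B @ E" "B \<noteq> []" "\<forall>y\<in>set B. P y = P (hd D)"
      "E = [] \<or> P (hd E) \<noteq> P (hd D) \<and> Suc (changes (map P E)) \<le> changes (map P D)"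
      by (rule changes_split[OF False, where P = P])
    have PB: "\<forall>y\<in>set B. P y \<noteq> x" using B(3) D(1) by blast
    show thesis
    proof (cases "E = []")
      case True
      show thesis
        by (rule that[folded x_def, of A B "[]"])
           (use A(1) B(1) True in simp, rule A(2), rule A(3), rule PB, simp_all)
    next
      case False
      then have E: "P (hd E) \<noteq> P (hd D)" "changes (map P E) = 0" using B(4) D(2) by simp_all
      obtain C F where C: "E = C @ F" "C \<noteq> []" "\<forall>y\<in>set C. P y = P (hd E)"
        "F = [] \<or> P (hd F) \<noteq> P (hd E) \<and> Suc (changes (map P F)) \<le> changes (map P E)"
        by (rule changes_split[OF False, where P = P])
      have F: "F = []" using C(4) unfolding E(2) by simp
      have PC: "\<forall>y\<in>set C. P y = x" using C(3) D(1) E(1) by blast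
      show thesis
        by (rule that[folded x_def, of A B C])
           (use A(1) B(1) C(1) F in simp, rule A(2), rule A(3), rule PB, rule PC, use B(2) in simp)
    qed
  qed
qed

text \<open>For a closed polygon written as an open list, at most two sign changes along the list means at most two
  around the circle, since the number around the circle is even.\<close>

definition good :: "'a::real_inner list \<Rightarrow> 'a \<Rightarrow> real \<Rightarrow> bool" where
  "good xs h c \<longleftrightarrow> changes (map (\<lambda>x. c < h \<bullet> x) xs) \<le> 2 \<and> changes (map (\<lambda>x. h \<bullet> x < c) xs) \<le> 2"

lemma good_uminus [simp]: "good xs (- h) (- c) \<longleftrightarrow> good xs h c"
  by (auto simp: good_def)

lemma good_delete: "good (l @ m @ r) h c \<Longrightarrow> good (l @ r) h c"
  using changes_delete[of "map (\<lambda>x. c < h \<bullet> x) l" "map (\<lambda>x. c < h \<bullet> x) r" "map (\<lambda>x. c < h \<bullet> x) m"]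
    changes_delete[of "map (\<lambda>x. h \<bullet> x < c) l" "map (\<lambda>x. h \<bullet> x < c) r" "map (\<lambda>x. h \<bullet> x < c) m"]
  by (auto simp: good_def)

lemma good_rev [simp]: "good (rev xs) h c \<longleftrightarrow> good xs h c"
  by (simp add: good_def rev_map[symmetric] changes_rev)

lemma good_insert:
  assumes "good (l @ a # b # r) h c" "y \<in> closed_segment a b"
  shows "good (l @ a # y # b # r) h c"
proof -
  have "(c < h \<bullet> y) = (c < h \<bullet> a) \<or> (c < h \<bullet> y) = (c < h \<bullet> b)"
    using segment_gt[of c h a b y] segment_le[of h a c b y] assms(2) by force
  moreover have "(h \<bullet> y < c) = (h \<bullet> a < c) \<or> (h \<bullet> y < c) = (h \<bullet> b < c)"
    using segment_lt[of h a c b y] segment_ge[of c h a b y] assms(2) by force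
  ultimately show ?thesis using assms(1) by (simp add: good_def changes_insert)
qed

text \<open>Inserting points on edges and deleting vertices preserve good planes, so the original
  polygon can go on supplying cutting planes for all arcs derived from it.\<close>

definition dominates :: "'a::real_inner list \<Rightarrow> 'a list \<Rightarrow> bool" where
  "dominates xs ys \<longleftrightarrow> (\<forall>h c. good xs h c \<longrightarrow> good ys h c)"

text \<open>A proper arc: inside the cell except for its two ends on the frontier, where a remainder
  avoiding \<open>W\<close> can be attached.\<close>

definition cellarc :: "(real^3) set \<Rightarrow> (real^3) list \<Rightarrow> bool" where
  "cellarc W xs \<longleftrightarrow> open W \<and> convex W \<and> 2 \<le> length xs \<and> emb xs \<and>
     hd xs \<in> closure W - W \<and> last xs \<in> closure W - W \<and> pline xs \<subseteq> W \<union> {hd xs, last xs}"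

definition arctriv :: "(real^3) set \<Rightarrow> (real^3) list \<Rightarrow> bool" where
  "arctriv W xs \<longleftrightarrow> triv W (hd xs) (last xs) (pline xs)"

lemma pline_insert:
  fixes p :: "'a::euclidean_space"
  assumes "p \<in> closed_segment a b"
  shows "pline (l @ a # p # b # r) = pline (l @ a # b # r)"
  using pline_append[of l a "p # b # r"] pline_append[of l a "b # r"] Un_closed_segment[OF assms] by auto

lemma emb_insert:
  fixes p :: "'a::euclidean_space"
  assumes e: "emb (l @ a # b # r)" and p: "p \<in> open_segment a b"
  shows "emb (l @ a # p # b # r)"
proof -
  have pc: "p \<in> closed_segment a b" "p \<noteq> a" "p \<noteq> b" using p by (auto simp: open_segment_def)
  have e': "emb (l @ [a])" "emb (a # b # r)" "pline (l @ [a]) \<inter> pline (a # b # r) \<subseteq> {a}"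
    using e unfolding emb_append[of l a "b # r"] by auto
  have sub: "closed_segment a p \<subseteq> closed_segment a b" "closed_segment p b \<subseteq> closed_segment a b"
    using pc(1) by (simp_all add: subset_closed_segment)
  have ap: "closed_segment a p \<inter> closed_segment p b \<subseteq> {p}"
    using Int_closed_segment[of p a b] pc(1) by simp
  have "b \<notin> closed_segment a p"
  proof
    assume "b \<in> closed_segment a p"
    moreover have "b \<in> closed_segment p b" by simp
    ultimately show False using ap pc(3) by blast
  qed
  moreover have "a \<notin> closed_segment p b"
  proof
    assume "a \<in> closed_segment p b"
    moreover have "a \<in> closed_segment a p" by simp
    ultimately show False using ap pc(2) by blast
  qed
  ultimately have "emb (a # p # b # r)"
    using e'(2) pc sub ap by auto
  moreover have "pline (a # p # b # r) = pline (a # b # r)" using pline_insert[OF pc(1), of "[]"] by simp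
  ultimately show ?thesis unfolding emb_append[of l a "p # b # r"] using e' by simp
qed

lemma ex_level_point:
  fixes h :: "'a::real_inner"
  assumes "s < h \<bullet> a" "h \<bullet> b < s"
  shows "\<exists>p\<in>open_segment a b. h \<bullet> p = s"
proof -
  define t where "t = (h \<bullet> a - s) / (h \<bullet> a - h \<bullet> b)"
  have t: "0 < t" "t < 1" using assms by (simp_all add: t_def)
  have "t * (h \<bullet> a - h \<bullet> b) = h \<bullet> a - s" using assms by (simp add: t_def)
  then have "h \<bullet> ((1 - t) *\<^sub>R a + t *\<^sub>R b) = s" by (simp add: inner_add_right algebra_simps)
  moreover have "(1 - t) *\<^sub>R a + t *\<^sub>R b \<in> open_segment a b"
    using t assms by (auto simp: in_segment)
  ultimately show ?thesis by blast
qed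

lemma pline_suffix: "pline (m # ys) \<subseteq> pline (xs @ m # ys)"
  unfolding pline_append[of xs m ys] by auto

lemma cell_halfspace:
  assumes "open W" "convex W"
  shows "open (W \<inter> {y. s < h \<bullet> y})" "convex (W \<inter> {y. s < h \<bullet> y})"
  using assms by (auto intro: open_halfspace_gt convex_halfspace_gt convex_Int)

lemma cellarc_pline_cell:
  assumes "cellarc W xs" "x \<in> pline xs" "x \<noteq> hd xs" "x \<noteq> last xs"
  shows "x \<in> W"
  using assms unfolding cellarc_def by blast

text \<open>The vertices form blocks \<open>A\<close> above, \<open>B\<close> below and
  \<open>C\<close> above the plane. Without \<open>B\<close> the arc lies in one half-cell; without
  \<open>C\<close> it is glued at one crossing point. With all three, the dip \<open>B\<close> is
  trivial in the lower half-cell and gives way to a chord, after which the arc lies in the upper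
  one.\<close>

lemma arctriv_cut_pos:
  assumes W: "cellarc W xs" and nov: "\<And>x. x \<in> set xs \<Longrightarrow> h \<bullet> x \<noteq> s" and g: "good xs h s"
    and hd: "s < h \<bullet> hd xs"
    and IH: "\<And>V ys. V = W \<inter> {y. s < h \<bullet> y} \<or> V = W \<inter> {y. h \<bullet> y < s} \<Longrightarrow> cellarc V ys \<Longrightarrow>
       dominates xs ys \<Longrightarrow> arctriv V ys"
  shows "arctriv W xs"
proof -
  let ?P = "W \<inter> {y. s < h \<bullet> y}" and ?M = "W \<inter> {y. h \<bullet> y < s}"
  have M: "?M = W \<inter> {y. - s < (- h) \<bullet> y}" by auto
  have oc: "open W" "convex W" and len: "2 \<le> length xs" and emb: "emb xs"
    and ends: "hd xs \<in> closure W" "hd xs \<notin> W" "last xs \<in> closure W" "last xs \<notin> W"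
    and sub: "pline xs \<subseteq> W \<union> {hd xs, last xs}"
    using W unfolding cellarc_def by auto
  have ocP: "open ?P" "convex ?P" using cell_halfspace[OF oc] by auto
  have ocM: "open ?M" "convex ?M" unfolding M by (rule cell_halfspace[OF oc])+
  have ne: "xs \<noteq> []" using len by auto
  have ch: "changes (map (\<lambda>x. s < h \<bullet> x) xs) \<le> 2" using g by (simp add: good_def)
  obtain A B C where ABC: "xs = A @ B @ C" "A \<noteq> []" "\<forall>y\<in>set A. (s < h \<bullet> y) = (s < h \<bullet> hd xs)"
    "\<forall>y\<in>set B. (s < h \<bullet> y) \<noteq> (s < h \<bullet> hd xs)" "\<forall>y\<in>set C. (s < h \<bullet> y) = (s < h \<bullet> hd xs)" "B = [] \<longrightarrow> C = []"
    by (rule changes_le_2_split[OF ch ne])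
  have hA: "\<forall>y\<in>set A. s < h \<bullet> y" using ABC(3) hd by blast
  have hC: "\<forall>y\<in>set C. s < h \<bullet> y" using ABC(5) hd by blast
  have hB: "\<forall>y\<in>set B. h \<bullet> y < s"
  proof
    fix y assume y: "y \<in> set B"
    then have "y \<in> set xs" unfolding ABC(1) by simp
    moreover have "\<not> s < h \<bullet> y" using ABC(4) hd y by blast
    ultimately show "h \<bullet> y < s" using nov[of y] by simp
  qed
  obtain A' a where A: "A = A' @ [a]" using ABC(2) by (cases A rule: rev_cases) auto
  have hdA: "hd xs = hd A" using ABC(1,2) by simp
  show ?thesis
  proof (cases "B = []")
    case True
    then have xs: "xs = A" using ABC(1,6) by simp
    have hs: "\<forall>y\<in>set xs. s < h \<bullet> y" using xs hA by simp
    have "pline xs \<subseteq> {y. s < h \<bullet> y}"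
      using hs by (intro pline_subset_convex) (auto simp: convex_halfspace_gt)
    then have "cellarc ?P xs"
      using len emb ocP closure_Int_halfspace[of _ W s h] ends hs ne sub unfolding cellarc_def by auto
    then have "arctriv ?P xs" using IH[of ?P xs] by (simp add: dominates_def)
    then show ?thesis unfolding arctriv_def by (rule triv_mono) simp
  next
    case False
    then obtain b B' where B: "B = b # B'" by (cases B) auto
    have hab: "s < h \<bullet> a" "h \<bullet> b < s" using A B hA hB by auto
    show ?thesis
    proof (cases "C = []")
      case True
      have xs: "xs = A' @ a # b # B'" using ABC(1) A B True by simp
      obtain p where p: "p \<in> open_segment a b" "h \<bullet> p = s" using ex_level_point[OF hab] by blast
      have pc: "p \<in> closed_segment a b" using p(1) by (simp add: open_segment_def)
      define xs' where "xs' = (A' @ [a]) @ p # (b # B')"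
      have xs': "xs' = A' @ a # p # b # B'" by (simp add: xs'_def)
      have e': "emb xs'" using emb_insert[OF _ p(1)] emb unfolding xs xs' by blast
      have pl: "pline xs' = pline xs" unfolding xs xs' by (rule pline_insert[OF pc])
      have dom: "dominates xs xs'" unfolding dominates_def xs xs' using good_insert[OF _ pc] by blast
      let ?Y1 = "A @ [p]" and ?Y2 = "p # B"
      have Y: "?Y1 = (A' @ [a]) @ [p]" "?Y2 = p # b # B'" using A B by auto
      have emb12: "emb ?Y1" "emb ?Y2" using e' emb_append[of "A' @ [a]" p "b # B'"] unfolding xs'_def Y by auto
      have plU: "pline xs = pline ?Y1 \<union> pline ?Y2"
        unfolding pl[symmetric] xs'_def Y by (rule pline_append)
      have lastB: "last xs = last B" using ABC(1) True False by simp
      have hl: "h \<bullet> last xs < s" using hB False lastB by simp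
      have pW: "p \<in> W"
        by (rule cellarc_pline_cell[OF W]) (use plU set_subset_pline[of ?Y2] p hd hl in auto)
      have hY1: "s < h \<bullet> x \<or> x = p" if "x \<in> pline ?Y1" for x
        by (rule pline_above[of A]) (use hA p that in auto)
      have hY2: "h \<bullet> x < s \<or> x = p" if "x \<in> pline ?Y2" for x
        using pline_below[of "rev B" h s p x] hB p that pline_rev[of ?Y2] by auto
      have dom1: "dominates xs ?Y1" using dom good_delete[of "A @ [p]" B "[]"] A B unfolding dominates_def xs' by simp
      have dom2: "dominates xs ?Y2" using dom good_delete[of "[]" A "p # B"] A B unfolding dominates_def xs' by simp
      have clp: "p \<in> closure ?P" by (rule closure_Int_halfspace'[OF oc pW p(2) ends(1) hd])
      have clm: "p \<in> closure ?M" unfolding M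
        by (rule closure_Int_halfspace'[OF oc pW _ ends(3)]) (use p hl in auto)
      have "cellarc ?P ?Y1"
        unfolding cellarc_def
      proof (intro conjI)
        show "hd ?Y1 \<in> closure ?P - ?P"
          using closure_Int_halfspace[OF ends(1) hd] ends hdA ABC(2) by simp
        show "pline ?Y1 \<subseteq> ?P \<union> {hd ?Y1, last ?Y1}"
        proof
          fix x assume x: "x \<in> pline ?Y1"
          then have "x \<in> W \<union> {hd xs, last xs}" using sub plU by auto
          then show "x \<in> ?P \<union> {hd ?Y1, last ?Y1}" using hY1[OF x] hl hdA ABC(2) by auto
        qed
      qed (use ocP emb12 clp p ABC(2) in \<open>auto simp: Suc_le_eq\<close>)
      then have t1: "arctriv ?P ?Y1" using IH dom1 by blast
      have "cellarc ?M ?Y2"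
        unfolding cellarc_def
      proof (intro conjI)
        have "last xs \<in> closure ?M" unfolding M by (rule closure_Int_halfspace[OF ends(3)]) (use hl in simp)
        then show "last ?Y2 \<in> closure ?M - ?M"
          using ends lastB False by simp
        show "pline ?Y2 \<subseteq> ?M \<union> {hd ?Y2, last ?Y2}"
        proof
          fix x assume x: "x \<in> pline ?Y2"
          then have "x \<in> W \<union> {hd xs, last xs}" using sub plU by auto
          then show "x \<in> ?M \<union> {hd ?Y2, last ?Y2}" using hY2[OF x] hd lastB False by auto
        qed
      qed (use ocM emb12 clm p False in \<open>auto simp: Suc_le_eq\<close>)
      then have t2: "arctriv ?M ?Y2" using IH dom2 by blast
      have "triv W (hd xs) (last xs) (pline ?Y1 \<union> pline ?Y2)"
      proof (rule triv_glue_once[OF oc ends pW p(2) hd hl])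
        show "triv ?P (hd xs) p (pline ?Y1)" using t1 hdA ABC(2) by (simp add: arctriv_def)
        show "triv ?M p (last xs) (pline ?Y2)" using t2 lastB False by (simp add: arctriv_def)
      qed (use hY1 hY2 p in \<open>auto intro: less_imp_le\<close>)
      then show ?thesis unfolding arctriv_def plU .
    next
      case CF: False
      then obtain c C' where C: "C = c # C'" by (cases C) auto
      obtain B'' b' where B': "B = B'' @ [b']" using False by (cases B rule: rev_cases) auto
      have hcb: "s < h \<bullet> c" "h \<bullet> b' < s" using C B' hC hB by auto
      \<comment> \<open>The chord level \<open>s'\<close> is halfway between \<open>s\<close> and
        the lowest vertex of \<open>A\<close> and \<open>C\<close>, so the upper pieces stay above
        it except at their new ends.\<close>
      define m where "m = Min ((\<lambda>x. h \<bullet> x) ` set (A @ C))"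
      have mle: "m \<le> h \<bullet> x" if "x \<in> set (A @ C)" for x using that by (simp add: m_def)
      have sm: "s < m" unfolding m_def using hA hC ABC(2) by (subst Min_gr_iff) auto
      define s' where "s' = (s + m) / 2"
      have s': "s < s'" "\<And>x. x \<in> set (A @ C) \<Longrightarrow> s' < h \<bullet> x"
        using sm mle by (force simp: s'_def)+
      have "s' < h \<bullet> a" "s' < h \<bullet> c" using s'(2) A C by auto
      obtain p' where p': "p' \<in> open_segment a b" "h \<bullet> p' = s'"
        using ex_level_point[of s' h a b] \<open>s' < h \<bullet> a\<close> hab s' by auto
      obtain p where p: "p \<in> open_segment p' b" "h \<bullet> p = s"
        using ex_level_point[of s h p' b] p' hab s' by auto
      obtain q' where q': "q' \<in> open_segment b' c" "h \<bullet> q' = s'"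
        using ex_level_point[of s' h c b'] \<open>s' < h \<bullet> c\<close> hcb s' by (auto simp: open_segment_commute)
      obtain q where q: "q \<in> open_segment b' q'" "h \<bullet> q = s"
        using ex_level_point[of s h q' b'] q' hcb s' by (auto simp: open_segment_commute)
      have cs: "p' \<in> closed_segment a b" "p \<in> closed_segment p' b" "q' \<in> closed_segment b' c" "q \<in> closed_segment b' q'"
        using p p' q q' by (auto simp: open_segment_def)
      \<comment> \<open>The crossing points are inserted one by one; each insertion leaves the point
        set, embeddedness and good planes intact.\<close>
      define x1 where "x1 = (A @ [p']) @ B @ C"
      define x2 where "x2 = (A @ [p', p]) @ B @ C"
      define x3 where "x3 = (A @ [p', p] @ B) @ q' # C"
      define x4 where "x4 = (A @ [p', p] @ B) @ q # q' # C"
      have L: "xs = A' @ a # b # (B' @ C)" "x1 = A' @ a # p' # b # (B' @ C)" "x1 = (A' @ [a]) @ p' # b # (B' @ C)"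
        "x2 = (A' @ [a]) @ p' # p # b # (B' @ C)" "x2 = (A @ [p', p] @ B'') @ b' # c # C'"
        "x3 = (A @ [p', p] @ B'') @ b' # q' # c # C'" "x3 = (A @ [p', p] @ B'') @ b' # q' # C"
        "x4 = (A @ [p', p] @ B'') @ b' # q # q' # C"
        unfolding x1_def x2_def x3_def x4_def using ABC(1) A B C B' by simp_all
      have emb1: "emb x1" unfolding L(2) by (rule emb_insert[OF _ p'(1)]) (use emb L(1) in simp)
      have emb2: "emb x2" unfolding L(4) by (rule emb_insert[OF _ p(1)]) (use emb1 L(3) in simp)
      have emb3: "emb x3" unfolding L(6) by (rule emb_insert[OF _ q'(1)]) (use emb2 L(5) in simp)
      have emb4: "emb x4" unfolding L(8) by (rule emb_insert[OF _ q(1)]) (use emb3 L(7) in simp)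
      have pl1: "pline x1 = pline xs" unfolding L(2) L(1) by (rule pline_insert[OF cs(1)])
      have pl2: "pline x2 = pline x1" unfolding L(4) L(3) by (rule pline_insert[OF cs(2)])
      have pl3: "pline x3 = pline x2" unfolding L(6) L(5) by (rule pline_insert[OF cs(3)])
      have pl4: "pline x4 = pline x3" unfolding L(8) L(7) by (rule pline_insert[OF cs(4)])
      have pl: "pline x4 = pline xs" using pl1 pl2 pl3 pl4 by simp
      have d1: "good x1 h c" if "good xs h c" for h c
        unfolding L(2) by (rule good_insert[OF _ cs(1)]) (use that L(1) in simp)
      have d2: "good x2 h c" if "good x1 h c" for h c
        unfolding L(4) by (rule good_insert[OF _ cs(2)]) (use that L(3) in simp)
      have d3: "good x3 h c" if "good x2 h c" for h c
        unfolding L(6) by (rule good_insert[OF _ cs(3)]) (use that L(5) in simp)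
      have d4: "good x4 h c" if "good x3 h c" for h c
        unfolding L(8) by (rule good_insert[OF _ cs(4)]) (use that L(7) in simp)
      have dom: "good x4 h c" if "good xs h c" for h c using d1 d2 d3 d4 that by blast
      let ?YM = "p # B @ [q]" and ?YP = "(A @ [p']) @ q' # C"
      have X: "x4 = (A @ [p']) @ ?YM @ q' # C" by (simp add: x4_def)
      have lastC: "last xs = last C" using ABC(1) CF by simp
      have hl: "s < h \<bullet> last xs" using hC CF lastC by simp
      have hl': "s' < h \<bullet> last xs" "s' < h \<bullet> hd xs" using s'(2) lastC hdA CF ABC(2) by auto
      have inW: "x \<in> W" if "x \<in> pline xs" "h \<bullet> x \<le> s'" for x
        by (rule cellarc_pline_cell[OF W]) (use that hl' in auto)
      have set4: "set x4 \<subseteq> pline xs" using set_subset_pline[of x4] pl by simp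
      have pqW: "p \<in> W" "q \<in> W" "p' \<in> W" "q' \<in> W" "b \<in> W"
        using set4 p q p' q' s'(1) hab(2) by (auto intro!: inW simp: X B)
      have split1: "emb (A @ [p'])" "emb (p' # ?YM @ q' # C)" "pline (A @ [p']) \<inter> pline (p' # ?YM @ q' # C) \<subseteq> {p'}"
        using emb4 emb_append[of A p' "?YM @ q' # C"] unfolding X by auto
      have split2: "emb (p # B @ q # [q'] @ C)" "closed_segment p' p \<inter> pline (p # B @ q # [q'] @ C) \<subseteq> {p}"
        using split1(2) by auto
      have split3: "emb ?YM" "emb (q # q' # C)" "pline ?YM \<inter> pline (q # q' # C) \<subseteq> {q}"
        using split2(1) emb_append[of "p # B" q "q' # C"] by auto
      have split4: "emb (q' # C)" using split3(2) by auto
      have plX: "pline xs = pline (A @ [p']) \<union> closed_segment p' p \<union> pline ?YM \<union> closed_segment q q' \<union> pline (q' # C)"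
        unfolding pl[symmetric] X
        using pline_append[of A p' "?YM @ q' # C"] pline_append[of "p # B" q "q' # C"] by auto
      have hB1: "s' < h \<bullet> x \<or> x = p'" if "x \<in> pline (A @ [p'])" for x
        by (rule pline_above[of A]) (use s' p' that in auto)
      have hB2: "s' < h \<bullet> x \<or> x = q'" if "x \<in> pline (q' # C)" for x
        using pline_above[of "rev C" s' h q' x] s' q' that pline_rev[of "q' # C"] by auto
      have hYM: "h \<bullet> x < s \<or> x = p \<or> x = q" if x: "x \<in> pline ?YM" for x
      proof -
        have "x \<in> closed_segment p b \<or> x \<in> pline (B @ [q])" using x B by auto
        then show ?thesis
          using segment_below[of h b s p x] pline_below[of B h s q x] hB hab p q
          by (auto simp: closed_segment_commute)
      qed
      have pq: "p \<noteq> q"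
      proof
        assume "p = q"
        then show False using emb_distinct[OF split3(1)] by simp
      qed
      have intpq: "closed_segment p' p \<inter> closed_segment q q' = {}"
      proof -
        have "closed_segment q q' \<subseteq> pline (p # B @ q # [q'] @ C)"
          using pline_suffix[of q "q' # C" "p # B"] by auto
        then have "closed_segment p' p \<inter> closed_segment q q' \<subseteq> {p}" using split2(2) by blast
        moreover have "p \<notin> closed_segment q q'"
        proof
          assume "p \<in> closed_segment q q'"
          then have "p \<in> pline ?YM \<inter> pline (q # q' # C)" using set_subset_pline[of ?YM] by auto
          then show False using split3(3) pq by blast
        qed
        ultimately show ?thesis by blast
      qed
      have p'q': "p' \<noteq> q'" using emb_distinct[OF emb4] by (auto simp: X)
      have clp: "p \<in> closure ?M" "q \<in> closure ?M" unfolding M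
        using closure_Int_halfspace'[OF oc, of _ "- h" "- s" b] pqW p q hab closure_subset[of W] by auto
      have "cellarc ?M ?YM"
        unfolding cellarc_def
      proof (intro conjI)
        show "pline ?YM \<subseteq> ?M \<union> {hd ?YM, last ?YM}"
        proof
          fix x assume x: "x \<in> pline ?YM"
          then have "x \<in> pline xs" using plX by auto
          then show "x \<in> ?M \<union> {hd ?YM, last ?YM}" using hYM[OF x] inW[of x] s' by auto
        qed
      qed (use ocM split3 clp p q in auto)
      moreover have "dominates xs ?YM"
        unfolding dominates_def
      proof (intro allI impI)
        fix h c assume "good xs h c"
        then have "good ([] @ (A @ [p']) @ (?YM @ q' # C)) h c" using dom X by simp
        then have "good ([] @ (?YM @ q' # C)) h c" by (rule good_delete)
        then have "good (?YM @ (q' # C) @ []) h c" by simp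
        then have "good (?YM @ []) h c" by (rule good_delete)
        then show "good ?YM h c" by simp
      qed
      ultimately have tM: "arctriv ?M ?YM" using IH by blast
      have disj: "pline (A @ [p']) \<inter> pline (q' # C) = {}"
      proof -
        have "pline (q' # C) \<subseteq> pline (p' # ?YM @ q' # C)" using pline_suffix[of q' C "p' # ?YM"] by simp
        then have "pline (A @ [p']) \<inter> pline (q' # C) \<subseteq> {p'}" using split1(3) by blast
        moreover have "p' \<notin> pline (q' # C)" using hB2[of p'] p' p'q' by auto
        ultimately show ?thesis by blast
      qed
      have seg': "h \<bullet> x = s'" if "x \<in> closed_segment p' q'" for x
        using segment_le[of h p' s' q' x] segment_ge[of s' h p' q' x] that p' q' by simp
      \<comment> \<open>The chord runs at level \<open>s'\<close>, which the two upper pieces reach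
        only at \<open>p'\<close> and \<open>q'\<close>.\<close>
      have embP: "emb ?YP"
        unfolding append.assoc append_Cons append_Nil emb_append[of A p' "q' # C"]
      proof (intro conjI)
        show "emb (A @ [p'])" by (rule split1(1))
        have "closed_segment p' q' \<inter> pline (q' # C) \<subseteq> {q'}" using seg' hB2 by force
        then show "emb (p' # q' # C)" using split4 p'q' by simp
        have "pline (A @ [p']) \<inter> closed_segment p' q' \<subseteq> {p'}" using seg' hB1 by force
        then show "pline (A @ [p']) \<inter> pline (p' # q' # C) \<subseteq> {p'}" using disj by auto
      qed
      have plP: "pline ?YP = pline (A @ [p']) \<union> closed_segment p' q' \<union> pline (q' # C)"
        using pline_append[of A p' "q' # C"] by auto
      have hdP: "hd ?YP = hd xs" "last ?YP = last xs" using hdA lastC ABC(2) CF by auto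
      have "cellarc ?P ?YP"
        unfolding cellarc_def
      proof (intro conjI)
        show "hd ?YP \<in> closure ?P - ?P" "last ?YP \<in> closure ?P - ?P"
          unfolding hdP using closure_Int_halfspace ends hd hl by auto
        show "pline ?YP \<subseteq> ?P \<union> {hd ?YP, last ?YP}"
        proof
          fix x assume x: "x \<in> pline ?YP"
          show "x \<in> ?P \<union> {hd ?YP, last ?YP}"
          proof (cases "x \<in> closed_segment p' q'")
            case True
            then have "x \<in> W" using pqW(3,4) oc(2) by (meson closed_segment_subset subsetD)
            then show ?thesis using seg'[OF True] s'(1) by auto
          next
            case False
            then have "x \<in> pline (A @ [p']) \<or> x \<in> pline (q' # C)" using x plP by blast
            then have "s' \<le> h \<bullet> x" "x \<in> pline xs" using hB1 hB2 p' q' plX by force+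
            then show ?thesis unfolding hdP using sub s'(1) by auto
          qed
        qed
      qed (use ocP embP ABC(2) in \<open>auto simp: Suc_le_eq\<close>)
      moreover have "dominates xs ?YP"
        unfolding dominates_def
      proof (intro allI impI)
        fix h c assume "good xs h c"
        then have "good ((A @ [p']) @ ?YM @ (q' # C)) h c" using dom X by simp
        then show "good ?YP h c" by (rule good_delete)
      qed
      ultimately have tP: "arctriv ?P ?YP" using IH by blast
      have "eqv W (pline (A @ [p']) \<union> closed_segment p' p \<union> pline ?YM \<union> closed_segment q q' \<union> pline (q' # C))
          (pline (A @ [p']) \<union> closed_segment p' q' \<union> pline (q' # C))"
        by (rule eqv_glue_twice[OF oc pqW(1,2) pq p(2) q(2) pqW(3,4) p'q' p'(2) q'(2) s'(1) _ _ _ hB1 hB2 intpq])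
           (use tM in \<open>auto simp: arctriv_def\<close>)
      then have "eqv W (pline xs) (pline ?YP)" unfolding plX plP .
      moreover have "triv W (hd xs) (last xs) (pline ?YP)"
        using tP unfolding arctriv_def hdP by (rule triv_mono) simp
      ultimately show ?thesis unfolding arctriv_def by (rule triv_eqv)
    qed
  qed
qed

text \<open>Negating both \<open>h\<close> and \<open>s\<close> exchanges the half-cells, so the arc
  may be taken to start above the plane.\<close>

lemma arctriv_cut:
  assumes W: "cellarc W xs" and nov: "\<And>x. x \<in> set xs \<Longrightarrow> h \<bullet> x \<noteq> s" and g: "good xs h s"
    and IH: "\<And>V ys. V = W \<inter> {y. s < h \<bullet> y} \<or> V = W \<inter> {y. h \<bullet> y < s} \<Longrightarrow> cellarc V ys \<Longrightarrow>
       dominates xs ys \<Longrightarrow> arctriv V ys"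
  shows "arctriv W xs"
proof -
  have "xs \<noteq> []" using W by (auto simp: cellarc_def)
  then have "hd xs \<in> set xs" by simp
  then consider "s < h \<bullet> hd xs" | "- s < (- h) \<bullet> hd xs" using nov by force
  then show ?thesis
  proof cases
    case 1
    then show ?thesis using arctriv_cut_pos[OF W nov g] IH by blast
  next
    case 2
    show ?thesis
    proof (rule arctriv_cut_pos[OF W _ _ 2])
      show "\<And>x. x \<in> set xs \<Longrightarrow> - h \<bullet> x \<noteq> - s" using nov by simp
      show "good xs (- h) (- s)" using g by simp
      fix V ys assume V: "V = W \<inter> {y. - s < - h \<bullet> y} \<or> V = W \<inter> {y. - h \<bullet> y < - s}"
        and ys: "cellarc V ys" "dominates xs ys"
      have "V = W \<inter> {y. s < h \<bullet> y} \<or> V = W \<inter> {y. h \<bullet> y < s}" using V by auto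
      then show "arctriv V ys" using IH ys by blast
    qed
  qed
qed

section \<open>Arcs that all parallel planes cut at most twice\<close>

lemma cellarc_rev: "cellarc W (rev xs) \<longleftrightarrow> cellarc W xs"
  by (cases "xs = []") (auto simp: cellarc_def hd_rev last_rev insert_commute)

lemma arctriv_rev: "xs \<noteq> [] \<Longrightarrow> arctriv W (rev xs) \<longleftrightarrow> arctriv W xs"
  by (simp add: arctriv_def hd_rev last_rev triv_commute)

lemma dominates_trans: "dominates xs ys \<Longrightarrow> dominates ys zs \<Longrightarrow> dominates xs zs"
  by (simp add: dominates_def)

lemma cellarc_inner:
  assumes "cellarc W (l @ a # b # c # r)"
  shows "b \<in> W" "a \<in> closure W" "c \<in> closure W" "l \<noteq> [] \<Longrightarrow> a \<in> W" "r \<noteq> [] \<Longrightarrow> c \<in> W"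
proof -
  let ?xs = "l @ a # b # c # r"
  have d: "distinct ?xs" using assms emb_distinct unfolding cellarc_def by blast
  have inW: "x \<in> W" if "x \<in> set ?xs" "x \<noteq> hd ?xs" "x \<noteq> last ?xs" for x
    by (rule cellarc_pline_cell[OF assms]) (use that set_subset_pline[of ?xs] in blast)+
  have hd_l: "hd ?xs = (if l = [] then a else hd l)" by (cases l) auto
  have last_r: "last ?xs = (if r = [] then c else last r)" by (cases r) auto
  have hl: "l \<noteq> [] \<Longrightarrow> hd l \<in> set l" and lr: "r \<noteq> [] \<Longrightarrow> last r \<in> set r" by auto
  show b: "b \<in> W" by (rule inW) (use d hd_l last_r hl lr in \<open>auto split: if_splits\<close>)
  show 1: "l \<noteq> [] \<Longrightarrow> a \<in> W" by (rule inW) (use d hd_l last_r hl lr in \<open>auto split: if_splits\<close>)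
  show 2: "r \<noteq> [] \<Longrightarrow> c \<in> W" by (rule inW) (use d hd_l last_r hl lr in \<open>auto split: if_splits\<close>)
  have "hd ?xs \<in> closure W" "last ?xs \<in> closure W" using assms unfolding cellarc_def by auto
  then show "a \<in> closure W" "c \<in> closure W"
    using 1 2 hd_l last_r closure_subset[of W] by (auto split: if_splits)
qed

lemma cellarc_insert:
  assumes "cellarc W (l @ a # b # r)" "p \<in> open_segment a b"
  shows "cellarc W (l @ a # p # b # r)" "arctriv W (l @ a # p # b # r) \<longleftrightarrow> arctriv W (l @ a # b # r)"
    "dominates (l @ a # b # r) (l @ a # p # b # r)"
proof -
  have pc: "p \<in> closed_segment a b" using assms(2) by (simp add: open_segment_def)
  have hl: "hd (l @ a # p # b # r) = hd (l @ a # b # r)" "last (l @ a # p # b # r) = last (l @ a # b # r)"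
    by (cases l) auto
  show "cellarc W (l @ a # p # b # r)"
    using assms(1) emb_insert[OF _ assms(2), of l r] unfolding cellarc_def hl pline_insert[OF pc] by simp
  show "arctriv W (l @ a # p # b # r) \<longleftrightarrow> arctriv W (l @ a # b # r)"
    unfolding arctriv_def hl pline_insert[OF pc] ..
  show "dominates (l @ a # b # r) (l @ a # p # b # r)"
    unfolding dominates_def using good_insert[OF _ pc] by blast
qed

text \<open>Another vertex besides \<open>a\<close>, \<open>b\<close>, \<open>c\<close> puts
  \<open>a\<close> or \<open>c\<close> inside the cell; otherwise the new edge \<open>a c\<close>
  might run along the frontier.\<close>

lemma cellarc_delete:
  assumes W: "cellarc W (l @ a # b # c # r)" and lr: "l \<noteq> [] \<or> r \<noteq> []"
    and Ta: "convex hull {a, b, c} \<inter> pline (l @ [a]) \<subseteq> {a}"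
    and Tc: "convex hull {a, b, c} \<inter> pline (c # r) \<subseteq> {c}"
  shows "cellarc W (l @ a # c # r)" "arctriv W (l @ a # c # r) \<Longrightarrow> arctriv W (l @ a # b # c # r)"
    "dominates (l @ a # b # c # r) (l @ a # c # r)"
proof -
  let ?xs = "l @ a # b # c # r" and ?ys = "l @ a # c # r" and ?T = "convex hull {a, b, c}"
  have oc: "open W" "convex W" and e: "emb ?xs" and sub: "pline ?xs \<subseteq> W \<union> {hd ?xs, last ?xs}"
    using W unfolding cellarc_def by auto
  note inner = cellarc_inner[OF W]
  have hl: "hd ?ys = hd ?xs" "last ?ys = last ?xs" by (cases l; auto)+
  have e': "emb (l @ [a])" "emb (a # b # c # r)" "pline (l @ [a]) \<inter> pline (a # b # c # r) \<subseteq> {a}"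
    using e unfolding emb_append[of l a "b # c # r"] by auto
  have segT: "closed_segment a c \<subseteq> ?T" by (intro closed_segment_subset) (auto simp: hull_inc)
  have TW: "?T \<subseteq> W \<union> {a, c}"
    by (rule triangle_subset_cell'[OF oc inner(1-3)]) (use inner lr in blast)
  have d: "a \<noteq> b" "b \<noteq> c" "a \<noteq> c" using emb_distinct[OF e] by auto
  have P: "pline ?xs = closed_segment a b \<union> closed_segment b c \<union> (pline (l @ [a]) \<union> pline (c # r))"
    "pline ?ys = closed_segment a c \<union> (pline (l @ [a]) \<union> pline (c # r))"
    using pline_append[of l a "b # c # r"] pline_append[of l a "c # r"] by auto
  have eqv: "eqv W (pline ?xs) (pline ?ys)"
  proof (cases "nondeg a b c")
    case True
    show ?thesis unfolding P
      by (rule eqv_triangle[OF True]) (use Ta Tc TW in auto)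
  next
    \<comment> \<open>At a straight corner, deleting \<open>b\<close> does not change the point
      set.\<close>
    case False
    have "closed_segment a b \<inter> closed_segment b c \<subseteq> {b}" using e'(2) by auto
    from collinear_middle[OF d(1,2) False this] have "b \<in> closed_segment a c" .
    then show ?thesis using pline_insert[of b a c l r] by simp
  qed
  then show "arctriv W ?ys \<Longrightarrow> arctriv W ?xs" unfolding arctriv_def hl by (rule triv_eqv)
  have "closed_segment a c \<inter> pline (c # r) \<subseteq> {c}" using segT Tc by blast
  then have e2: "emb (a # c # r)" using e'(2) d by simp
  have "pline (l @ [a]) \<inter> pline (c # r) \<subseteq> {a}" using e'(3) by auto
  then have e3: "pline (l @ [a]) \<inter> pline (a # c # r) \<subseteq> {a}" using segT Ta by auto
  have "emb ?ys" unfolding emb_append[of l a "c # r"] using e'(1) e2 e3 by simp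
  moreover have "pline ?ys \<subseteq> W \<union> {hd ?xs, last ?xs}"
  proof -
    have "{a, c} \<subseteq> pline ?xs" using set_subset_pline[of ?xs] by auto
    then have "closed_segment a c \<subseteq> W \<union> {hd ?xs, last ?xs}" using segT TW sub by blast
    then show ?thesis using sub unfolding P by blast
  qed
  ultimately show "cellarc W ?ys" using W unfolding cellarc_def hl by simp
  show "dominates ?xs ?ys"
    using good_delete[of "l @ [a]" "[b]" "c # r"] unfolding dominates_def by simp
qed

text \<open>The end of all shortenings: with four vertices \<open>triv_three_segments\<close>
  applies.\<close>

lemma arctriv_short:
  assumes W: "cellarc W xs" and len: "length xs \<le> 4"
  shows "arctriv W xs"
proof -
  have oc: "open W" "convex W" and l2: "2 \<le> length xs" and e: "emb xs"
    and ends: "hd xs \<in> closure W" "hd xs \<notin> W" "last xs \<in> closure W" "last xs \<notin> W"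
    and sub: "pline xs \<subseteq> W \<union> {hd xs, last xs}"
    using W unfolding cellarc_def by auto
  consider u v where "xs = [u, v]" | u x v where "xs = [u, x, v]" | u x y v where "xs = [u, x, y, v]"
  proof -
    have "length xs = 2 \<or> length xs = 3 \<or> length xs = 4" using l2 len by linarith
    then show thesis using that by (auto simp: numeral_eq_Suc length_Suc_conv)
  qed
  then show ?thesis
  proof cases
    case (1 u v)
    have uv: "u \<noteq> v" using e 1 by simp
    have o: "open_segment u v \<subseteq> W" using sub 1 by (auto simp: open_segment_def)
    then have "W \<noteq> {}" using uv by (metis open_segment_eq_empty subset_empty)
    then obtain y where y: "y \<in> W" "y \<notin> affine hull {u, v, v}"
      using ex_generic_point[OF oc(1), of "[(u, v, v)]"] by auto
    have "eqv W (closed_segment u v) (closed_segment u y \<union> closed_segment y v)"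
      by (rule eqv_segment_apex[OF oc _ _ uv o y(1)]) (use ends 1 y in auto)
    moreover have "pline [u, v] = closed_segment u v" by auto
    ultimately show ?thesis unfolding arctriv_def triv_def 1 using y(1) by auto
  next
    case (2 u x v)
    have "x \<in> W" using cellarc_inner(1)[of W "[]" u x v "[]"] W 2 by simp
    moreover have "pline [u, x, v] = closed_segment u x \<union> closed_segment x v" by auto
    ultimately show ?thesis unfolding arctriv_def triv_def 2 by (intro bexI[of _ x]) (simp_all del: pline.simps)
  next
    case (3 u x y v)
    have xy: "x \<in> W" "y \<in> W"
      using cellarc_inner(1)[of W "[]" u x y "[v]"] cellarc_inner(1)[of W "[u]" x y v "[]"] W 3 by auto
    have pl: "pline [u, x, y, v] = closed_segment u x \<union> closed_segment x y \<union> closed_segment y v" by auto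
    have em: "u \<noteq> x" "x \<noteq> y" "y \<noteq> v" "x \<noteq> v"
      "closed_segment u x \<inter> (closed_segment x y \<union> closed_segment y v) \<subseteq> {x}"
      "closed_segment x y \<inter> closed_segment y v \<subseteq> {y}"
      using e emb_distinct[OF e] unfolding 3 by auto
    have "x \<notin> closed_segment y v"
    proof
      assume "x \<in> closed_segment y v"
      moreover have "x \<in> closed_segment x y" by simp
      ultimately show False using em by blast
    qed
    then have "triv W u v (closed_segment u x \<union> closed_segment x y \<union> closed_segment y v)"
      by (intro triv_three_segments[OF oc _ _ xy em(1-3) _ em(6)]) (use em(5) ends 3 in auto)
    then show ?thesis unfolding arctriv_def using pl 3 by simp
  qed
qed

section \<open>Shortening an arc at its highest vertices\<close>

lemma ex_level_card:
  fixes S :: "real set"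
  assumes "finite S" "k \<le> card S"
  shows "\<exists>c. card {x\<in>S. c < x} = k"
  using assms(2)
proof (induction k)
  case 0
  show ?case
  proof (cases "S = {}")
    case False
    then have "{x\<in>S. Max S < x} = {}" using assms(1) by (auto simp: not_less)
    then show ?thesis by (metis card.empty)
  qed simp
next
  case (Suc k)
  then obtain c where c: "card {x\<in>S. c < x} = k" by auto
  define R where "R = {x\<in>S. x \<le> c}"
  have SR: "S = R \<union> {x\<in>S. c < x}" by (auto simp: R_def)
  have fR: "finite R" using assms(1) by (simp add: R_def)
  have "R \<noteq> {}" using SR Suc.prems c by (metis Suc_n_not_le_n sup_bot_left)
  then have m: "Max R \<in> R" "\<And>x. x \<in> R \<Longrightarrow> x \<le> Max R" using fR by auto
  \<comment> \<open>The second largest of the values not above \<open>c\<close>: lowering the level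
    to it admits exactly one more value, \<open>Max R\<close>. The default is any level below a
    single remaining value.\<close>
  define c' where "c' = (if R - {Max R} = {} then Max R - 1 else Max (R - {Max R}))"
  have c': "c' < Max R \<and> (\<forall>x\<in>R - {Max R}. x \<le> c')"
  proof (cases "R - {Max R} = {}")
    case False
    then have "Max (R - {Max R}) \<in> R - {Max R}" using fR by (intro Max_in) auto
    then have "Max (R - {Max R}) < Max R" using m by (metis DiffD1 DiffD2 insertCI order_le_less)
    then show ?thesis using False fR by (auto simp: c'_def)
  next
    case True
    then have "c' = Max R - 1" unfolding c'_def by (rule if_P)
    moreover have "\<forall>x\<in>R - {Max R}. x \<le> c'" unfolding True by simp
    ultimately show ?thesis by simp
  qed
  have "{x\<in>S. c' < x} = insert (Max R) {x\<in>S. c < x}"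
  proof (intro equalityI subsetI)
    fix x assume x: "x \<in> {x\<in>S. c' < x}"
    show "x \<in> insert (Max R) {x\<in>S. c < x}"
    proof (cases "c < x")
      case False
      then have "x \<in> R" using x by (simp add: R_def)
      have "x = Max R"
      proof (rule ccontr)
        assume "x \<noteq> Max R"
        then have "x \<le> c'" using c' \<open>x \<in> R\<close> by blast
        then show False using x by simp
      qed
      then show ?thesis by simp
    qed (use x in simp)
  next
    fix x assume "x \<in> insert (Max R) {x\<in>S. c < x}"
    then consider "x = Max R" | "x \<in> S" "c < x" by auto
    then show "x \<in> {x\<in>S. c' < x}"
      using c' m(1) by cases (auto simp: R_def)
  qed
  moreover have "Max R \<notin> {x\<in>S. c < x}" using m(1) by (simp add: R_def)
  ultimately have "card {x\<in>S. c' < x} = Suc k" using c assms(1) by simp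
  then show ?case ..
qed

text \<open>The lowest point of the triangle is its vertex \<open>c\<close>, and all other vertices of the arc are lower
  still; so the only edge of the arc that could pierce the triangle is the one entering \<open>a\<close>.\<close>

lemma cellarc_delete_high:
  assumes W: "cellarc W (l @ a # b # c # r)" and lr: "l \<noteq> [] \<or> r \<noteq> []"
    and low: "\<forall>x\<in>set l \<union> set r. h \<bullet> x < h \<bullet> c" and c: "h \<bullet> c < h \<bullet> a" "h \<bullet> c < h \<bullet> b"
  shows "cellarc W (l @ a # c # r)" "arctriv W (l @ a # c # r) \<Longrightarrow> arctriv W (l @ a # b # c # r)"
    "dominates (l @ a # b # c # r) (l @ a # c # r)"
proof -
  let ?T = "convex hull {a, b, c}"
  have e: "emb (l @ a # b # c # r)" using W unfolding cellarc_def by auto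
  have e': "emb (a # b # c # r)" "pline (l @ [a]) \<inter> pline (a # b # c # r) \<subseteq> {a}"
    using e unfolding emb_append[of l a "b # c # r"] by auto
  have T: "h \<bullet> c < h \<bullet> x \<or> x = c" if "x \<in> ?T" for x
  proof -
    have "x \<in> convex hull (insert c {a, b})" using that by (simp add: insert_commute)
    then obtain y where y: "y \<in> closed_segment a b" "x \<in> closed_segment c y"
      unfolding convex_hull_insert_segments by (auto simp: segment_convex_hull)
    have "h \<bullet> c < h \<bullet> y" using segment_gt[OF c y(1)] .
    then show ?thesis using segment_above[of "h \<bullet> c" h c y x] y(2) by auto
  qed
  have Tc: "?T \<inter> pline (c # r) \<subseteq> {c}"
  proof
    fix x assume x: "x \<in> ?T \<inter> pline (c # r)"
    then have "h \<bullet> x < h \<bullet> c \<or> x = c"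
      using pline_below[of "rev r" h "h \<bullet> c" c x] low pline_rev[of "c # r"] by auto
    then show "x \<in> {c}" using T[of x] x by auto
  qed
  have Ta: "?T \<inter> pline (l @ [a]) \<subseteq> {a}"
  proof (cases l rule: rev_cases)
    case Nil
    then show ?thesis by simp
  next
    case (snoc l' d)
    have pl: "pline (l @ [a]) = pline l \<union> closed_segment d a"
      using pline_append[of l' d "[a]"] snoc by auto
    have "pline l \<subseteq> {x. h \<bullet> x < h \<bullet> c}"
      using low by (intro pline_subset_convex) (auto simp: convex_halfspace_lt)
    then have 1: "?T \<inter> pline l = {}" using T by force
    have "closed_segment a d \<inter> ?T \<subseteq> {a}"
    proof (rule ray_lemma)
      have "h \<bullet> d < h \<bullet> c" using low snoc by simp
      then show "d \<notin> ?T" using T[of d] by auto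
      have "closed_segment d a \<inter> closed_segment b c \<subseteq> {a}" using e'(2) pl by auto
      moreover have "a \<notin> closed_segment b c"
      proof
        assume "a \<in> closed_segment b c"
        moreover have "a \<in> closed_segment a b" by simp
        ultimately show False using e'(1) by auto
      qed
      ultimately show "closed_segment a d \<inter> closed_segment b c = {}"
        by (auto simp: closed_segment_commute)
    qed
    then show ?thesis unfolding pl using 1 by (auto simp: closed_segment_commute)
  qed
  show "cellarc W (l @ a # c # r)" by (rule cellarc_delete(1)[OF W lr Ta Tc])
  show "arctriv W (l @ a # c # r) \<Longrightarrow> arctriv W (l @ a # b # c # r)" by (rule cellarc_delete(2)[OF W lr Ta Tc])
  show "dominates (l @ a # b # c # r) (l @ a # c # r)" by (rule cellarc_delete(3)[OF W lr Ta Tc])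
qed

definition all_good :: "'a::real_inner list \<Rightarrow> 'a \<Rightarrow> bool" where
  "all_good xs h \<longleftrightarrow> (\<forall>c. good xs h c)"

lemma all_good_uminus [simp]: "all_good xs (- h) \<longleftrightarrow> all_good xs h"
  unfolding all_good_def by (metis good_uminus minus_minus)

lemma all_good_dominates: "all_good xs h \<Longrightarrow> dominates xs ys \<Longrightarrow> all_good ys h"
  by (simp add: all_good_def dominates_def)

text \<open>Take a level with exactly three vertices above it. As there are at most two sign
  changes, these vertices are consecutive unless both ends of the arc are among them. Of three
  consecutive ones the middle is not the lowest, so it can be deleted across a triangle whose lowest
  point is one of its neighbours.\<close>

lemma reduce_or_ends_high:
  assumes W: "cellarc W xs" and g: "all_good xs h" and inj: "inj_on (\<lambda>x. h \<bullet> x) (set xs)" and len: "5 \<le> length xs"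
  shows "(\<exists>ys. cellarc W ys \<and> length ys < length xs \<and> set ys \<subseteq> set xs \<and> dominates xs ys \<and>
      (arctriv W ys \<longrightarrow> arctriv W xs)) \<or>
    (\<exists>c. card {x\<in>set xs. c < h \<bullet> x} = 3 \<and> c < h \<bullet> hd xs \<and> c < h \<bullet> last xs)"
proof -
  have e: "emb xs" and ne: "xs \<noteq> []" using W len unfolding cellarc_def by auto
  have dist: "distinct xs" by (rule emb_distinct[OF e])
  have "card ((\<lambda>x. h \<bullet> x) ` set xs) = length xs" using inj dist by (simp add: card_image distinct_card)
  then obtain c where c: "card {y \<in> (\<lambda>x. h \<bullet> x) ` set xs. c < y} = 3"
    using ex_level_card[of "(\<lambda>x. h \<bullet> x) ` set xs" 3] len by auto
  let ?D = "{x\<in>set xs. c < h \<bullet> x}"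
  have "{y \<in> (\<lambda>x. h \<bullet> x) ` set xs. c < y} = (\<lambda>x. h \<bullet> x) ` ?D" by auto
  moreover have "inj_on (\<lambda>x. h \<bullet> x) ?D" using inj by (rule inj_on_subset) auto
  ultimately have D: "card ?D = 3" using c by (simp add: card_image)
  have reduce: ?thesis if xs: "xs = l @ B @ r" and B: "length B = 3" "\<forall>x\<in>set B. c < h \<bullet> x"
    and lr: "\<forall>x\<in>set l \<union> set r. \<not> c < h \<bullet> x" for l B r
  proof -
    obtain x1 x2 x3 where B3: "B = [x1, x2, x3]" using B(1) by (auto simp: numeral_eq_Suc length_Suc_conv)
    have xs3: "xs = l @ x1 # x2 # x3 # r" using xs B3 by simp
    have lrne: "l \<noteq> [] \<or> r \<noteq> []" using len xs3 by auto
    have ne3: "h \<bullet> x1 \<noteq> h \<bullet> x2" "h \<bullet> x2 \<noteq> h \<bullet> x3" "h \<bullet> x1 \<noteq> h \<bullet> x3"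
      using inj dist unfolding xs3 inj_on_def by auto
    have low: "h \<bullet> y < h \<bullet> x" if "y \<in> set l \<union> set r" "x \<in> set B" for x y
    proof -
      have "c < h \<bullet> x" "\<not> c < h \<bullet> y" using B(2) lr that by blast+
      then show ?thesis by simp
    qed
    \<comment> \<open>Otherwise the level of \<open>x2\<close> itself gives, together with a lower
      vertex \<open>y\<close> before or after the block, three changes.\<close>
    have mid: "\<not> (h \<bullet> x2 < h \<bullet> x1 \<and> h \<bullet> x2 < h \<bullet> x3)"
    proof
      assume m: "h \<bullet> x2 < h \<bullet> x1 \<and> h \<bullet> x2 < h \<bullet> x3"
      have g2: "good (l @ [x1, x2, x3] @ r) h (h \<bullet> x2)" using g xs3 by (simp add: all_good_def)
      show False
      proof (cases r)
        case Nil
        then obtain l' y where l: "l = l' @ [y]" using lrne by (cases l rule: rev_cases) auto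
        have "good ([] @ l' @ [y, x1, x2, x3]) h (h \<bullet> x2)" using g2 Nil l by simp
        then have "good [y, x1, x2, x3] h (h \<bullet> x2)" using good_delete[of "[]" l'] by fastforce
        moreover have "h \<bullet> y < h \<bullet> x2" using low[of y x2] l B3 by simp
        ultimately show False using m by (simp add: good_def)
      next
        case (Cons y r')
        have "good ([] @ l @ ([x1, x2, x3, y] @ r')) h (h \<bullet> x2)" using g2 Cons by simp
        then have "good ([x1, x2, x3, y] @ r' @ []) h (h \<bullet> x2)" using good_delete[of "[]" l] by fastforce
        then have "good [x1, x2, x3, y] h (h \<bullet> x2)" using good_delete[of "[x1, x2, x3, y]" r' "[]"] by simp
        moreover have "h \<bullet> y < h \<bullet> x2" using low[of y x2] Cons B3 by simp
        ultimately show False using m by (simp add: good_def)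
      qed
    qed
    then consider "h \<bullet> x3 < h \<bullet> x1" "h \<bullet> x3 < h \<bullet> x2" | "h \<bullet> x1 < h \<bullet> x3" "h \<bullet> x1 < h \<bullet> x2"
      using ne3 by linarith
    then have "cellarc W (l @ x1 # x3 # r) \<and> (arctriv W (l @ x1 # x3 # r) \<longrightarrow> arctriv W xs) \<and> dominates xs (l @ x1 # x3 # r)"
    proof cases
      case 1
      have lw: "\<forall>x\<in>set l \<union> set r. h \<bullet> x < h \<bullet> x3" using low B3 by simp
      show ?thesis using cellarc_delete_high[OF _ lrne lw 1] W unfolding xs3 by blast
    next
      case 2
      have rv: "rev xs = rev r @ x3 # x2 # x1 # rev l" "rev r @ x3 # x1 # rev l = rev (l @ x1 # x3 # r)"
        using xs3 by simp_all
      have lw: "\<forall>x\<in>set (rev r) \<union> set (rev l). h \<bullet> x < h \<bullet> x1" using low B3 by auto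
      have "rev r \<noteq> [] \<or> rev l \<noteq> []" using lrne by auto
      note del = cellarc_delete_high[OF _ this lw 2, of W, folded rv(1), unfolded rv(2)]
      have "cellarc W (rev xs)" using W by (simp add: cellarc_rev)
      note del = del[OF this]
      have "dominates xs (l @ x1 # x3 # r)" using del(3) unfolding dominates_def good_rev .
      moreover have "arctriv W (l @ x1 # x3 # r) \<longrightarrow> arctriv W xs"
        using del(2) arctriv_rev[of "l @ x1 # x3 # r" W] arctriv_rev[OF ne, of W] by simp
      ultimately show ?thesis using del(1) cellarc_rev[of W "l @ x1 # x3 # r"] by blast
    qed
    then show ?thesis using xs3 by (intro disjI1 exI[of _ "l @ x1 # x3 # r"]) auto
  qed
  have ch: "changes (map (\<lambda>x. c < h \<bullet> x) xs) \<le> 2" using g by (simp add: good_def all_good_def)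
  obtain A B C where ABC: "xs = A @ B @ C" "A \<noteq> []" "\<forall>y\<in>set A. (c < h \<bullet> y) = (c < h \<bullet> hd xs)"
    "\<forall>y\<in>set B. (c < h \<bullet> y) \<noteq> (c < h \<bullet> hd xs)" "\<forall>y\<in>set C. (c < h \<bullet> y) = (c < h \<bullet> hd xs)" "B = [] \<longrightarrow> C = []"
    by (rule changes_le_2_split[OF ch ne])
  show ?thesis
  proof (cases "c < h \<bullet> hd xs")
    case False
    have "set xs = set A \<union> set B \<union> set C" by (subst ABC(1)) auto
    then have "?D = set B" using ABC(3-5) False by blast
    then have "length B = 3" using D dist ABC(1) by (metis distinct_append distinct_card)
    moreover have "\<forall>x\<in>set B. c < h \<bullet> x" "\<forall>x\<in>set A \<union> set C. \<not> c < h \<bullet> x"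
      using ABC(3-5) False by blast+
    ultimately show ?thesis by (intro reduce[OF ABC(1)])
  next
    case True
    show ?thesis
    proof (cases "C = []")
      case CN: True
      have "set xs = set A \<union> set B" by (subst ABC(1)) (simp add: CN)
      then have "?D = set A" using ABC(3,4) True by blast
      then have "length A = 3" using D dist ABC(1) by (metis distinct_append distinct_card)
      moreover have "\<forall>x\<in>set A. c < h \<bullet> x" "\<forall>x\<in>set [] \<union> set B. \<not> c < h \<bullet> x"
        using ABC(3,4) True by auto
      moreover have "xs = [] @ A @ B" by (subst ABC(1)) (simp add: CN)
      ultimately show ?thesis by (intro reduce[of "[]" A B])
    next
      case False
      then have "last xs \<in> set C" by (subst ABC(1)) simp
      then have "c < h \<bullet> last xs" using ABC(5) True by blast
      then show ?thesis using D True by blast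
    qed
  qed
qed

text \<open>If neither the top nor the bottom allows a deletion, both ends belong to the top three
  and to the bottom three vertices. These six places are then taken by at most four vertices,
  leaving a vertex in neither group.\<close>

lemma arctriv_distinct_heights:
  assumes "cellarc W xs" "all_good xs h" "inj_on (\<lambda>x. h \<bullet> x) (set xs)"
  shows "arctriv W xs"
  using assms
proof (induction xs rule: measure_induct_rule[of length])
  case (less xs)
  show ?case
  proof (cases "length xs \<le> 4")
    case True
    then show ?thesis using arctriv_short less.prems by blast
  next
    case False
    then have len: "5 \<le> length xs" by simp
    have inj': "inj_on (\<lambda>x. (- h) \<bullet> x) (set xs)" using less.prems(3) by (simp add: inj_on_def)
    have dist: "distinct xs" using less.prems(1) emb_distinct unfolding cellarc_def by blast
    have fin: "arctriv W xs" if "\<exists>ys. cellarc W ys \<and> length ys < length xs \<and> set ys \<subseteq> set xs \<and> dominates xs ys \<and>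
      (arctriv W ys \<longrightarrow> arctriv W xs)"
      using that less.IH less.prems(2,3) all_good_dominates inj_on_subset by blast
    show ?thesis
    proof (rule ccontr)
      assume n: "\<not> ?thesis"
      obtain c where c: "card {x\<in>set xs. c < h \<bullet> x} = 3" "c < h \<bullet> hd xs" "c < h \<bullet> last xs"
        using reduce_or_ends_high[OF less.prems len] fin n by blast
      obtain c' where c': "card {x\<in>set xs. c' < (- h) \<bullet> x} = 3" "c' < (- h) \<bullet> hd xs" "c' < (- h) \<bullet> last xs"
        using reduce_or_ends_high[OF less.prems(1) _ inj' len] less.prems(2) fin n by auto
      let ?D = "{x\<in>set xs. c < h \<bullet> x}" and ?D' = "{x\<in>set xs. c' < (- h) \<bullet> x}"
      have "xs \<noteq> []" using len by auto
      then have hl: "hd xs \<in> ?D \<inter> ?D'" "last xs \<in> ?D \<inter> ?D'" using c c' by auto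
      have "hd xs \<noteq> last xs" using dist len
        by (cases xs) (auto simp: last_in_set split: if_splits)
      then have "2 \<le> card (?D \<inter> ?D')"
        using card_mono[of "?D \<inter> ?D'" "{hd xs, last xs}"] hl by auto
      then have "card (?D \<union> ?D') \<le> 4" using card_Un_Int[of ?D ?D'] c(1) c'(1) by auto
      then have "card (?D \<union> ?D') < card (set xs)" using len dist by (simp add: distinct_card)
      then have "\<not> set xs \<subseteq> ?D \<union> ?D'" using card_mono[of "?D \<union> ?D'" "set xs"] by auto
      \<comment> \<open>The height of \<open>x\<close> lies between \<open>- c'\<close> and
        \<open>c\<close>, whereas the first vertex shows that \<open>c < - c'\<close>.\<close>
      then obtain x where "x \<in> set xs" "\<not> c < h \<bullet> x" "\<not> c' < (- h) \<bullet> x" by blast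
      then show False using c(2) c'(2) by simp
    qed
  qed
qed

section \<open>Breaking ties between heights\<close>

lemma emb_segments_disjoint:
  assumes "emb (l @ [c] @ d # e # e' # r)"
  shows "closed_segment d c \<inter> closed_segment e e' = {}" "closed_segment d e \<inter> pline (e' # r) = {}"
    "closed_segment d e \<inter> pline (l @ [c]) = {}"
proof -
  have a: "emb ((l @ [c]) @ d # e # e' # r)" using assms by simp
  have b: "emb ((l @ [c]) @ [d])" "emb (d # e # e' # r)" "pline ((l @ [c]) @ [d]) \<inter> pline (d # e # e' # r) \<subseteq> {d}"
    using a unfolding emb_append[of "l @ [c]" d "e # e' # r"] by auto
  have pc: "pline ((l @ [c]) @ [d]) = pline (l @ [c]) \<union> closed_segment c d"
    using pline_append[of l c "[d]"] set_subset_pline[of "l @ [c]"] by auto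
  have s: "d \<noteq> e" "e \<noteq> e'" "closed_segment d e \<inter> pline (e # e' # r) \<subseteq> {e}"
    "closed_segment e e' \<inter> pline (e' # r) \<subseteq> {e'}" using b(2) by auto
  have "e \<notin> pline (e' # r)"
  proof
    assume "e \<in> pline (e' # r)"
    moreover have "e \<in> closed_segment e e'" by simp
    ultimately show False using s by blast
  qed
  then show "closed_segment d e \<inter> pline (e' # r) = {}" using s(3) by auto
  have "d \<notin> closed_segment e e'"
  proof
    assume "d \<in> closed_segment e e'"
    moreover have "d \<in> closed_segment d e" by simp
    ultimately show False using s by auto
  qed
  then show "closed_segment d c \<inter> closed_segment e e' = {}"
    using b(3) pc by (auto simp: closed_segment_commute)
  have "d \<notin> pline (l @ [c])"
  proof
    assume d: "d \<in> pline (l @ [c])"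
    have "emb (l @ c # [d])" using b(1) by simp
    then have "pline (l @ [c]) \<inter> pline [c, d] \<subseteq> {c}" "c \<noteq> d"
      using emb_append[of l c "[d]"] by auto
    then show False using d by auto
  qed
  then show "closed_segment d e \<inter> pline (l @ [c]) = {}" using b(3) pc by auto
qed

text \<open>Insert \<open>e'\<close> on the edge \<open>e f\<close>, then delete \<open>e\<close>.
  The triangle \<open>d e e'\<close> is so thin that it misses every edge having no end in common
  with it; the two edges attached at \<open>d\<close> and \<open>e'\<close> are handled by
  \<open>ray_lemma\<close>.\<close>

lemma cellarc_slide:
  assumes W: "cellarc W (l @ d # e # f # r)"
  shows "\<exists>\<delta>>0. \<delta> \<le> 1 \<and> (\<forall>t. 0 < t \<longrightarrow> t < \<delta> \<longrightarrow> (let e' = (1 - t) *\<^sub>R e + t *\<^sub>R f in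
     cellarc W (l @ d # e' # f # r) \<and> (arctriv W (l @ d # e' # f # r) \<longrightarrow> arctriv W (l @ d # e # f # r)) \<and>
     dominates (l @ d # e # f # r) (l @ d # e' # f # r)))"
proof -
  have em: "emb (l @ d # e # f # r)" using W unfolding cellarc_def by auto
  have ef: "e \<noteq> f" using emb_distinct[OF em] by auto
  have emd: "emb (d # e # f # r)" using em emb_append[of l d "e # f # r"] by simp
  \<comment> \<open>All edges that end neither at \<open>d\<close> nor at \<open>e\<close>; they
    have positive distance from the segment \<open>d e\<close>.\<close>
  define F where "F = pline l \<union> pline (f # r)"
  have "closed_segment d e \<inter> pline (f # r) = {}"
  proof (cases l rule: rev_cases)
    case (snoc l' c)
    then show ?thesis using emb_segments_disjoint(2)[of l' c d e f r] em by simp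
  next
    case Nil
    have s: "e \<noteq> f" "closed_segment d e \<inter> pline (e # f # r) \<subseteq> {e}"
      "closed_segment e f \<inter> pline (f # r) \<subseteq> {f}" using emd by auto
    have "e \<notin> pline (f # r)"
    proof
      assume "e \<in> pline (f # r)"
      moreover have "e \<in> closed_segment e f" by simp
      ultimately show False using s by blast
    qed
    then show ?thesis using s(2) by auto
  qed
  moreover have "closed_segment d e \<inter> pline l = {}"
  proof (cases l rule: rev_cases)
    case (snoc l' c)
    then show ?thesis using emb_segments_disjoint(3)[of l' c d e f r] em by simp
  qed simp
  ultimately have "closed_segment d e \<inter> F = {}" unfolding F_def by blast
  moreover have "closed F" unfolding F_def by (intro closed_Un compact_imp_closed) simp_all
  ultimately obtain \<delta>0 where d0: "\<delta>0 > 0" "\<And>x y. x \<in> closed_segment d e \<Longrightarrow> y \<in> F \<Longrightarrow> \<delta>0 \<le> dist x y"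
    using separate_compact_closed[of "closed_segment d e" F] by auto
  have nef: "norm (f - e) > 0" using ef by simp
  define \<delta> where "\<delta> = min 1 (\<delta>0 / norm (f - e))"
  have "\<delta> > 0" "\<delta> \<le> 1" using d0 nef by (auto simp: \<delta>_def)
  moreover have "cellarc W (l @ d # e' # f # r) \<and> (arctriv W (l @ d # e' # f # r) \<longrightarrow> arctriv W (l @ d # e # f # r)) \<and>
     dominates (l @ d # e # f # r) (l @ d # e' # f # r)"
    if t: "0 < t" "t < \<delta>" and e': "e' = (1 - t) *\<^sub>R e + t *\<^sub>R f" for t e'
  proof -
    have t1: "t < 1" "t * norm (f - e) < \<delta>0"
      using t nef by (auto simp: \<delta>_def pos_less_divide_eq)
    have e'o: "e' \<in> open_segment e f" using t t1 ef unfolding in_segment e' by auto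
    have W': "cellarc W ((l @ [d]) @ e # e' # f # r)" "arctriv W ((l @ [d]) @ e # e' # f # r) \<longleftrightarrow> arctriv W ((l @ [d]) @ e # f # r)"
      "dominates ((l @ [d]) @ e # f # r) ((l @ [d]) @ e # e' # f # r)"
      using cellarc_insert[OF _ e'o, of W "l @ [d]" r] W by auto
    have W1: "cellarc W (l @ d # e # e' # (f # r))" using W'(1) by simp
    have em': "emb (l @ d # e # e' # f # r)" using W1 unfolding cellarc_def by auto
    have emd': "emb (d # e # e' # f # r)" using em' emb_append[of l d "e # e' # f # r"] by simp
    let ?T = "convex hull {d, e, e'}"
    have TF: "?T \<inter> F = {}"
    proof -
      have "x \<notin> F" if x: "x \<in> ?T" for x
      proof
        assume xF: "x \<in> F"
        obtain p q where pq: "0 \<le> p" "0 \<le> q" "p + q \<le> 1" and xe: "x = d + p *\<^sub>R (e - d) + q *\<^sub>R (e' - d)"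
          using x unfolding triangle_coords by blast
        \<comment> \<open>Putting the weight of \<open>e'\<close> on \<open>e\<close> moves
          \<open>x\<close> onto the segment \<open>d e\<close>, by at most
          \<open>t * norm (f - e)\<close>.\<close>
        define y where "y = (1 - (p + q)) *\<^sub>R d + (p + q) *\<^sub>R e"
        have "y \<in> closed_segment d e"
          unfolding in_segment y_def by (intro exI[of _ "p + q"] conjI refl) (use pq(1-3) in simp_all)
        then have "\<delta>0 \<le> dist y x" using d0(2) xF by blast
        moreover have "dist y x = q * t * norm (f - e)"
        proof -
          have "x - y = (q * t) *\<^sub>R (f - e)" unfolding xe y_def e' by (simp add: algebra_simps)
          then have "norm (x - y) = \<bar>q * t\<bar> * norm (f - e)" by (simp only: norm_scaleR)
          moreover have "\<bar>q * t\<bar> = q * t" using pq(2) t(1) by simp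
          ultimately show ?thesis unfolding dist_commute[of y x] by (simp add: dist_norm)
        qed
        moreover have "q * t * norm (f - e) \<le> t * norm (f - e)"
          using pq t nef by (intro mult_right_mono) (auto simp: mult_left_le_one_le)
        ultimately show False using t1(2) by linarith
      qed
      then show ?thesis by blast
    qed
    have seg_e'f: "closed_segment d e \<inter> pline (e' # f # r) = {}"
    proof -
      have s: "e \<noteq> e'" "closed_segment d e \<inter> pline (e # e' # f # r) \<subseteq> {e}"
        "closed_segment e e' \<inter> pline (e' # f # r) \<subseteq> {e'}" using emd' by auto
      have "e \<notin> pline (e' # f # r)"
      proof
        assume "e \<in> pline (e' # f # r)"
        moreover have "e \<in> closed_segment e e'" by simp
        ultimately show False using s by blast
      qed
      then show ?thesis using s(2) by auto
    qed
    have Ta: "?T \<inter> pline (l @ [d]) \<subseteq> {d}"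
    proof (cases l rule: rev_cases)
      case Nil
      then show ?thesis by simp
    next
      case (snoc l' c)
      have pl: "pline (l @ [d]) = pline l \<union> closed_segment d c"
        using pline_append[of l' c "[d]"] set_subset_pline[of l] snoc by (auto simp: closed_segment_commute)
      have "closed_segment d c \<inter> ?T \<subseteq> {d}"
      proof (rule ray_lemma)
        have "c \<in> F" using snoc set_subset_pline[of l] by (auto simp: F_def)
        then show "c \<notin> ?T" using TF by blast
        show "closed_segment d c \<inter> closed_segment e e' = {}"
          using emb_segments_disjoint(1)[of l' c d e e' "f # r"] em' snoc by simp
      qed
      then show ?thesis unfolding pl using TF by (auto simp: F_def)
    qed
    have Tc: "?T \<inter> pline (e' # f # r) \<subseteq> {e'}"
    proof -
      have "closed_segment e' f \<inter> convex hull {e', d, e} \<subseteq> {e'}"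
      proof (rule ray_lemma)
        have "f \<in> F" using set_subset_pline[of "f # r"] by (auto simp: F_def)
        then show "f \<notin> convex hull {e', d, e}" using TF by (auto simp: insert_commute)
        show "closed_segment e' f \<inter> closed_segment d e = {}" using seg_e'f by auto
      qed
      moreover have "convex hull {e', d, e} = ?T" by (simp add: insert_commute)
      ultimately show ?thesis using TF by (auto simp: F_def)
    qed
    note del = cellarc_delete[OF W1 _ Ta Tc]
    show ?thesis using del W'(2,3) dominates_trans by auto
  qed
  ultimately show ?thesis unfolding Let_def by blast
qed

text \<open>Sliding a vertex along an adjacent edge that leaves its level breaks a tie of heights.\<close>

lemma cellarc_break_tie:
  assumes W: "cellarc W xs" and xs: "xs = l @ d # e # f # r" and ef: "h \<bullet> e \<noteq> h \<bullet> f"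
    and tie: "y \<in> set xs" "y \<noteq> e" "h \<bullet> y = h \<bullet> e"
  shows "\<exists>ys. cellarc W ys \<and> (arctriv W ys \<longrightarrow> arctriv W xs) \<and> dominates xs ys \<and> length ys = length xs \<and>
     card ((\<lambda>x. h \<bullet> x) ` set ys) = Suc (card ((\<lambda>x. h \<bullet> x) ` set xs)) \<and> (\<exists>x\<in>set ys. h \<bullet> x \<noteq> h \<bullet> hd ys)"
proof -
  obtain \<delta> where d: "\<delta> > 0" "\<delta> \<le> 1" and slide: "\<And>t e'. 0 < t \<Longrightarrow> t < \<delta> \<Longrightarrow> e' = (1 - t) *\<^sub>R e + t *\<^sub>R f \<Longrightarrow>
     cellarc W (l @ d # e' # f # r) \<and> (arctriv W (l @ d # e' # f # r) \<longrightarrow> arctriv W (l @ d # e # f # r)) \<and>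
     dominates (l @ d # e # f # r) (l @ d # e' # f # r)"
    using cellarc_slide[of W l d e f r] W unfolding xs Let_def by blast
  let ?H = "(\<lambda>x. h \<bullet> x) ` set xs"
  let ?\<phi> = "\<lambda>t. h \<bullet> ((1 - t) *\<^sub>R e + t *\<^sub>R f)"
  have phi: "?\<phi> t = h \<bullet> e + t * (h \<bullet> f - h \<bullet> e)" for t by (simp add: inner_add_right algebra_simps)
  \<comment> \<open>The slide passes through infinitely many heights, so one of them belongs to no
    vertex.\<close>
  have "inj_on ?\<phi> {0<..<\<delta>}" using ef by (auto simp: inj_on_def phi)
  moreover have "infinite {0<..<\<delta>}" using d by (simp add: infinite_Ioo)
  ultimately have "infinite (?\<phi> ` {0<..<\<delta>})" by (simp add: finite_image_iff)
  then have "\<not> ?\<phi> ` {0<..<\<delta>} \<subseteq> ?H" by (meson List.finite_set finite_imageI finite_subset)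
  then obtain t where t0: "t \<in> {0<..<\<delta>}" and t3: "?\<phi> t \<notin> ?H" by blast
  have t: "0 < t" "t < \<delta>" using t0 by auto
  define e' where "e' = (1 - t) *\<^sub>R e + t *\<^sub>R f"
  have he': "h \<bullet> e' \<notin> ?H" unfolding e'_def by (rule t3)
  define ys where "ys = l @ d # e' # f # r"
  \<comment> \<open>The old height of \<open>e\<close> is still attained at \<open>y\<close>, so the
    number of heights grows by exactly one.\<close>
  have "h \<bullet> y \<in> (\<lambda>x. h \<bullet> x) ` (set (l @ [d]) \<union> set (f # r))" using tie xs by (intro imageI) auto
  then have "?H = (\<lambda>x. h \<bullet> x) ` (set (l @ [d]) \<union> set (f # r))" unfolding xs using tie(3) by auto
  then have "(\<lambda>x. h \<bullet> x) ` set ys = insert (h \<bullet> e') ?H" by (auto simp: ys_def)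
  then have card: "card ((\<lambda>x. h \<bullet> x) ` set ys) = Suc (card ?H)" using he' by simp
  have "f \<in> set xs" using xs by simp
  then have "h \<bullet> e' \<noteq> h \<bullet> f" using he' by (metis imageI)
  moreover have "e' \<in> set ys" "f \<in> set ys" by (auto simp: ys_def)
  ultimately have "\<exists>x\<in>set ys. h \<bullet> x \<noteq> h \<bullet> hd ys" by metis
  then show ?thesis using slide[OF t(1,2) e'_def] card unfolding ys_def[symmetric] xs[symmetric]
    by (intro exI[of _ ys]) (auto simp: ys_def xs)
qed

text \<open>Both neighbours of \<open>x\<close> may be on its level, so sliding \<open>x\<close>
  itself need not help. Following the arc towards \<open>w\<close>, the last vertex of the run on
  that level has a successor off it and is slid instead; the arc is reversed if \<open>w\<close>
  comes before \<open>x\<close>.\<close>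

lemma cellarc_tied_inner:
  assumes W: "cellarc W xs" and x: "x \<in> set xs" "x \<noteq> hd xs" "x \<noteq> last xs"
    and y: "y \<in> set xs" "y \<noteq> x" "h \<bullet> y = h \<bullet> x" and w: "w \<in> set xs" "h \<bullet> w \<noteq> h \<bullet> x"
  shows "\<exists>ys. cellarc W ys \<and> (arctriv W ys \<longrightarrow> arctriv W xs) \<and> dominates xs ys \<and> length ys = length xs \<and>
     card ((\<lambda>x. h \<bullet> x) ` set ys) = Suc (card ((\<lambda>x. h \<bullet> x) ` set xs)) \<and> (\<exists>x\<in>set ys. h \<bullet> x \<noteq> h \<bullet> hd ys)"
    (is "?G xs")
proof -
  have dist: "distinct xs" using W emb_distinct unfolding cellarc_def by blast
  have half: "?G zs" if Wz: "cellarc W zs" and zs: "zs = X @ x # Y" and X: "X \<noteq> []" and wY: "w \<in> set Y"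
    and yz: "y \<in> set zs" and dz: "distinct zs" for zs X Y
  proof -
    define Y1 where "Y1 = takeWhile (\<lambda>z. h \<bullet> z = h \<bullet> x) Y"
    have "dropWhile (\<lambda>z. h \<bullet> z = h \<bullet> x) Y \<noteq> []" using wY w(2) by (auto simp: dropWhile_eq_Nil_conv)
    then obtain f r where fr: "dropWhile (\<lambda>z. h \<bullet> z = h \<bullet> x) Y = f # r" by (cases "dropWhile (\<lambda>z. h \<bullet> z = h \<bullet> x) Y") auto
    have hf: "h \<bullet> f \<noteq> h \<bullet> x" using hd_dropWhile[of "\<lambda>z. h \<bullet> z = h \<bullet> x" Y] fr by auto
    have Y: "Y = Y1 @ f # r" using takeWhile_dropWhile_id[of "\<lambda>z. h \<bullet> z = h \<bullet> x" Y] fr by (simp add: Y1_def)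
    have hY1: "h \<bullet> z = h \<bullet> x" if "z \<in> set Y1" for z using that by (auto simp: Y1_def dest: set_takeWhileD)
    obtain k e where ke: "x # Y1 = k @ [e]" by (cases "x # Y1" rule: rev_cases) auto
    have "X @ k \<noteq> []" using X by simp
    then obtain l d where ld: "X @ k = l @ [d]" by (cases "X @ k" rule: rev_cases) auto
    have zs': "zs = l @ d # e # f # r"
    proof -
      have "zs = X @ (x # Y1) @ f # r" using zs Y by simp
      also have "\<dots> = (X @ k) @ e # f # r" unfolding ke by simp
      finally show ?thesis unfolding ld by simp
    qed
    have "e \<in> set (x # Y1)" unfolding ke by simp
    then have he: "h \<bullet> e = h \<bullet> x" using hY1 by auto
    have ez: "x \<in> set zs" using zs by simp
    show ?thesis
    proof (cases "e = x")
      case True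
      show ?thesis by (rule cellarc_break_tie[OF Wz zs' _ yz]) (use hf he y True in auto)
    next
      case False
      show ?thesis by (rule cellarc_break_tie[OF Wz zs' _ ez]) (use hf he False in auto)
    qed
  qed
  obtain X Y where XY: "xs = X @ x # Y" using x(1) by (meson split_list)
  have X: "X \<noteq> []" using x(2) XY by (cases X) auto
  have Y: "Y \<noteq> []" using x(3) XY by (cases Y rule: rev_cases) auto
  have "w \<in> set X \<or> w \<in> set Y" using w XY by auto
  then show ?thesis
  proof
    assume "w \<in> set Y"
    then show ?thesis using half[OF W XY X _ y(1) dist] by blast
  next
    assume wX: "w \<in> set X"
    have "?G (rev xs)"
    proof (rule half)
      show "cellarc W (rev xs)" using W by (simp add: cellarc_rev)
      show "rev xs = rev Y @ x # rev X" using XY by simp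
    qed (use Y wX y(1) dist in auto)
    then obtain ys where ys: "cellarc W ys" "arctriv W ys \<longrightarrow> arctriv W (rev xs)" "dominates (rev xs) ys"
      "length ys = length (rev xs)" "card ((\<lambda>x. h \<bullet> x) ` set ys) = Suc (card ((\<lambda>x. h \<bullet> x) ` set (rev xs)))"
      "\<exists>x\<in>set ys. h \<bullet> x \<noteq> h \<bullet> hd ys" by blast
    have "xs \<noteq> []" using x(1) by auto
    then have "arctriv W (rev xs) = arctriv W xs" by (rule arctriv_rev)
    moreover have "dominates xs ys" using ys(3) by (simp add: dominates_def)
    ultimately show ?thesis using ys(1,2,4-6) by (intro exI[of _ ys]) simp
  qed
qed

section \<open>Tilting the height function when the two ends are tied\<close>

lemma changes_Cons_snoc:
  "b \<noteq> [] \<Longrightarrow> changes (x # b @ [y]) = (if x = hd b then 0 else 1) + changes b + (if last b = y then 0 else 1)"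
proof -
  assume "b \<noteq> []"
  then obtain b' z where b: "b = b' @ [z]" by (cases b rule: rev_cases) auto
  have "changes (x # b @ [y]) = changes (x # b) + changes [z, y]"
    using changes_append[of "x # b'" z "[y]"] b by simp
  moreover have "changes (x # b) = (if x = hd b then 0 else 1) + changes b"
    using \<open>b \<noteq> []\<close> by (cases b) auto
  ultimately show ?thesis using b by simp
qed

text \<open>The two hypotheses are the counts at the common level of the ends; the two alternatives
  are the counts after a tilt that lifts one end above the other. One of the two tilts is always
  harmless.\<close>

lemma changes_tilt:
  assumes "changes (False # b @ [False]) \<le> 2" "changes (True # b @ [True]) \<le> 2"
  shows "changes (True # b @ [False]) \<le> 2 \<or> changes (False # b @ [True]) \<le> 2"
proof (cases "b = []")
  case False
  then show ?thesis using assms unfolding changes_Cons_snoc[OF False] by (auto split: if_splits)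
qed simp

text \<open>On finitely many vertices, lying strictly below \<open>c\<close> is the negation of
  lying strictly above the largest height below \<open>c\<close>, so one of the two counts
  determines the other.\<close>

lemma all_goodI:
  assumes "\<And>c. changes (map (\<lambda>x. c < h \<bullet> x) xs) \<le> 2"
  shows "all_good xs h"
  unfolding all_good_def good_def
proof (intro allI conjI)
  fix c
  show "changes (map (\<lambda>x. c < h \<bullet> x) xs) \<le> 2" by (rule assms)
  let ?L = "{y \<in> (\<lambda>x. h \<bullet> x) ` set xs. y < c}"
  define c' where "c' = (if ?L = {} then c - 1 else Max ?L)"
  have c': "c' < c" "\<And>y. y \<in> ?L \<Longrightarrow> y \<le> c'"
  proof -
    show "c' < c"
    proof (cases "?L = {}")
      case False
      then have "Max ?L \<in> ?L" by (intro Max_in) auto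
      then show ?thesis using False by (simp add: c'_def)
    qed (simp add: c'_def)
    show "y \<le> c'" if "y \<in> ?L" for y
    proof -
      have "?L \<noteq> {}" using that by blast
      then have "c' = Max ?L" unfolding c'_def by (rule if_not_P)
      then show ?thesis using that by simp
    qed
  qed
  have "(h \<bullet> x < c) = (\<not> c' < h \<bullet> x)" if "x \<in> set xs" for x
    using c'(1) c'(2)[of "h \<bullet> x"] that by force
  then have "map (\<lambda>x. h \<bullet> x < c) xs = map Not (map (\<lambda>x. c' < h \<bullet> x) xs)" by simp
  then show "changes (map (\<lambda>x. h \<bullet> x < c) xs) \<le> 2" using assms[of c'] by (simp only: changes_Not)
qed

text \<open>Finitely many strict inequalities between heights survive a small change of
  direction.\<close>

lemma ex_small_tilt:
  fixes h w :: "'a::real_inner"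
  assumes "finite S"
  shows "\<exists>\<epsilon>>0. \<forall>x\<in>S. \<forall>y\<in>S. h \<bullet> x < h \<bullet> y \<longrightarrow> \<epsilon> * \<bar>w \<bullet> (x - y)\<bar> < h \<bullet> y - h \<bullet> x"
proof -
  have "\<forall>\<^sub>F \<epsilon> in at_right 0. \<forall>p\<in>S \<times> S. h \<bullet> fst p < h \<bullet> snd p \<longrightarrow>
     \<epsilon> * \<bar>w \<bullet> (fst p - snd p)\<bar> < h \<bullet> snd p - h \<bullet> fst p"
  proof (rule eventually_ball_finite)
    show "finite (S \<times> S)" using assms by simp
    show "\<forall>p\<in>S \<times> S. \<forall>\<^sub>F \<epsilon> in at_right 0. h \<bullet> fst p < h \<bullet> snd p \<longrightarrow>
       \<epsilon> * \<bar>w \<bullet> (fst p - snd p)\<bar> < h \<bullet> snd p - h \<bullet> fst p"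
    proof
      fix p
      show "\<forall>\<^sub>F \<epsilon> in at_right 0. h \<bullet> fst p < h \<bullet> snd p \<longrightarrow>
         \<epsilon> * \<bar>w \<bullet> (fst p - snd p)\<bar> < h \<bullet> snd p - h \<bullet> fst p"
      proof (cases "h \<bullet> fst p < h \<bullet> snd p")
        case True
        have "((\<lambda>\<epsilon>. \<epsilon> * \<bar>w \<bullet> (fst p - snd p)\<bar>) \<longlongrightarrow> 0 * \<bar>w \<bullet> (fst p - snd p)\<bar>) (at_right 0)"
          by (intro tendsto_intros)
        then show ?thesis using True order_tendstoD(2)[of _ 0 "at_right 0" "h \<bullet> snd p - h \<bullet> fst p"]
          by simp
      qed simp
    qed
  qed
  moreover have "\<forall>\<^sub>F \<epsilon> in at_right (0::real). 0 < \<epsilon>" by (rule eventually_at_right_less)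
  ultimately have "\<forall>\<^sub>F \<epsilon> in at_right 0. 0 < \<epsilon> \<and> (\<forall>p\<in>S \<times> S. h \<bullet> fst p < h \<bullet> snd p \<longrightarrow>
     \<epsilon> * \<bar>w \<bullet> (fst p - snd p)\<bar> < h \<bullet> snd p - h \<bullet> fst p)" by (rule eventually_conj[rotated])
  then obtain \<epsilon> where "0 < \<epsilon>" "\<forall>p\<in>S \<times> S. h \<bullet> fst p < h \<bullet> snd p \<longrightarrow>
     \<epsilon> * \<bar>w \<bullet> (fst p - snd p)\<bar> < h \<bullet> snd p - h \<bullet> fst p"
    using eventually_happens' trivial_limit_at_right_real by blast
  then show ?thesis by (intro exI[of _ \<epsilon>]) auto
qed

text \<open>A level of \<open>h'\<close> that leaves \<open>u\<close> and \<open>v\<close> on the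
  same side separates the vertices just as some level of \<open>h\<close> does. A level between them
  splits the inner vertices by the old level \<tau>, the pattern bounded in the last
  hypothesis.\<close>

lemma all_good_tilted:
  assumes xs: "xs = u # ys @ [v]" and g: "all_good xs h" and hu: "h \<bullet> u = \<tau>" and hv: "h \<bullet> v = \<tau>"
    and hy: "\<And>y. y \<in> set ys \<Longrightarrow> h \<bullet> y \<noteq> \<tau>" and inj: "inj_on (\<lambda>x. h \<bullet> x) (set ys)" and uv: "h' \<bullet> v < h' \<bullet> u"
    and ord: "\<And>x y. x \<in> set xs \<Longrightarrow> y \<in> set xs \<Longrightarrow> h \<bullet> x < h \<bullet> y \<Longrightarrow> h' \<bullet> x < h' \<bullet> y"
    and ch: "changes (True # map (\<lambda>y. \<tau> < h \<bullet> y) ys @ [False]) \<le> 2"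
  shows "all_good xs h'" "inj_on (\<lambda>x. h' \<bullet> x) (set xs)"
proof -
  have tie: "x = y \<or> {x, y} = {u, v}" if "x \<in> set xs" "y \<in> set xs" "h \<bullet> x = h \<bullet> y" for x y
  proof -
    have "x = u \<or> x = v \<or> x \<in> set ys" "y = u \<or> y = v \<or> y \<in> set ys" using that xs by auto
    moreover have "h \<bullet> z = \<tau>" if "z = u \<or> z = v" for z using that hu hv by blast
    moreover have "x = y" if "x \<in> set ys" "y \<in> set ys"
      using inj that \<open>h \<bullet> x = h \<bullet> y\<close> by (auto dest: inj_onD)
    ultimately have "x = y \<or> (x = u \<or> x = v) \<and> (y = u \<or> y = v)"
      using hy \<open>h \<bullet> x = h \<bullet> y\<close> by metis
    then show ?thesis by auto
  qed
  show "inj_on (\<lambda>x. h' \<bullet> x) (set xs)"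
  proof (rule inj_onI)
    fix x y assume xy: "x \<in> set xs" "y \<in> set xs" "h' \<bullet> x = h' \<bullet> y"
    have "h \<bullet> x = h \<bullet> y" using ord[of x y] ord[of y x] xy by force
    with tie[OF xy(1,2)] uv xy(3) show "x = y" by (auto simp: doubleton_eq_iff)
  qed
  show "all_good xs h'"
  proof (rule all_goodI)
    fix c
    show "changes (map (\<lambda>x. c < h' \<bullet> x) xs) \<le> 2"
    proof (cases "(c < h' \<bullet> u) = (c < h' \<bullet> v)")
      case True
      define N where "N = {x \<in> set xs. \<not> c < h' \<bullet> x}"
      have sep: "h \<bullet> y < h \<bullet> x" if "x \<in> set xs" "c < h' \<bullet> x" "y \<in> N" for x y
      proof -
        have y: "y \<in> set xs" "\<not> c < h' \<bullet> y" using that(3) by (simp_all add: N_def)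
        have "\<not> h \<bullet> x < h \<bullet> y" using ord[OF that(1) y(1)] that(2) y(2) by force
        moreover have "h \<bullet> x \<noteq> h \<bullet> y"
        proof
          assume "h \<bullet> x = h \<bullet> y"
          from tie[OF that(1) y(1) this] show False
            using that(2) y(2) True by (auto simp: doubleton_eq_iff)
        qed
        ultimately show ?thesis by simp
      qed
      have "\<exists>c'. \<forall>x\<in>set xs. (c < h' \<bullet> x) = (c' < h \<bullet> x)"
      proof (cases "N = {}")
        case True
        then have all: "\<forall>x\<in>set xs. c < h' \<bullet> x" by (auto simp: N_def)
        define m where "m = Min ((\<lambda>x. h \<bullet> x) ` set xs) - 1"
        have "m < h \<bullet> x" if "x \<in> set xs" for x
        proof -
          have "Min ((\<lambda>x. h \<bullet> x) ` set xs) \<le> h \<bullet> x" using that by (intro Min_le) auto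
          then show ?thesis by (simp add: m_def)
        qed
        then show ?thesis using all by blast
      next
        case False
        define m where "m = Max ((\<lambda>x. h \<bullet> x) ` N)"
        have fN: "finite N" by (simp add: N_def)
        have "m \<in> (\<lambda>x. h \<bullet> x) ` N" unfolding m_def using fN False by (intro Max_in) auto
        then obtain y where y: "y \<in> N" "m = h \<bullet> y" by blast
        have "(c < h' \<bullet> x) = (m < h \<bullet> x)" if x: "x \<in> set xs" for x
        proof
          show "c < h' \<bullet> x \<Longrightarrow> m < h \<bullet> x" using sep[OF x _ y(1)] y(2) by simp
          show "c < h' \<bullet> x" if m: "m < h \<bullet> x"
          proof (rule ccontr)
            assume "\<not> c < h' \<bullet> x"
            then have "x \<in> N" using x by (simp add: N_def)
            then have "h \<bullet> x \<le> m" unfolding m_def using fN by (intro Max_ge) auto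
            then show False using m by simp
          qed
        qed
        then show ?thesis by blast
      qed
      then obtain c' where "\<And>x. x \<in> set xs \<Longrightarrow> (c < h' \<bullet> x) = (c' < h \<bullet> x)" by blast
      then have "map (\<lambda>x. c < h' \<bullet> x) xs = map (\<lambda>x. c' < h \<bullet> x) xs" by simp
      then show ?thesis using g unfolding all_good_def good_def by metis
    next
      case False
      then have c: "c < h' \<bullet> u" "\<not> c < h' \<bullet> v" using uv by auto
      have "(c < h' \<bullet> y) = (\<tau> < h \<bullet> y)" if y: "y \<in> set ys" for y
      proof (cases "\<tau> < h \<bullet> y")
        case True
        have "h' \<bullet> u < h' \<bullet> y" by (rule ord) (use xs y True hu in auto)
        then show ?thesis using True c by simp
      next
        case F: False
        have "h' \<bullet> y < h' \<bullet> v" by (rule ord) (use xs y F hy[OF y] hv in auto)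
        then show ?thesis using F c by simp
      qed
      then have "map (\<lambda>x. c < h' \<bullet> x) xs = True # map (\<lambda>y. \<tau> < h \<bullet> y) ys @ [False]"
        unfolding xs using c by simp
      then show ?thesis using ch by simp
    qed
  qed
qed

text \<open>The ends of a proper arc have to stay fixed, so a tie between them is broken by tilting
  \<open>h\<close> along \<open>u - v\<close> instead of sliding.\<close>

lemma arctriv_ends_tied:
  assumes W: "cellarc W xs" and xs: "xs = u # ys @ [v]" and g: "all_good xs h" and hu: "h \<bullet> u = \<tau>" and hv: "h \<bullet> v = \<tau>"
    and hy: "\<And>y. y \<in> set ys \<Longrightarrow> h \<bullet> y \<noteq> \<tau>" and inj: "inj_on (\<lambda>x. h \<bullet> x) (set ys)"
  shows "arctriv W xs"
proof -
  have "emb xs" using W unfolding cellarc_def by simp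
  from emb_distinct[OF this] have uv: "u \<noteq> v" using xs by simp
  define w where "w = u - v"
  have w: "w \<bullet> u - w \<bullet> v > 0" using uv by (simp add: w_def flip: inner_diff_right)
  obtain \<epsilon> where eps: "\<epsilon> > 0" "\<And>x y. x \<in> set xs \<Longrightarrow> y \<in> set xs \<Longrightarrow> h \<bullet> x < h \<bullet> y \<Longrightarrow>
     \<epsilon> * \<bar>w \<bullet> (x - y)\<bar> < h \<bullet> y - h \<bullet> x"
    using ex_small_tilt[of "set xs" h w] by auto
  let ?b = "map (\<lambda>y. \<tau> < h \<bullet> y) ys"
  have "good xs h \<tau>" using g by (simp add: all_good_def)
  moreover have "map (\<lambda>x. \<tau> < h \<bullet> x) xs = False # ?b @ [False]" unfolding xs using hu hv by simp
  moreover have "map (\<lambda>x. h \<bullet> x < \<tau>) xs = map Not (True # ?b @ [True])"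
    unfolding xs using hu hv hy by (auto simp: not_less order_le_less)
  ultimately have "changes (False # ?b @ [False]) \<le> 2" "changes (True # ?b @ [True]) \<le> 2"
    unfolding good_def by (simp_all only: changes_Not)
  from changes_tilt[OF this] show ?thesis
  proof
    assume ch: "changes (True # ?b @ [False]) \<le> 2"
    define h' where "h' = h + \<epsilon> *\<^sub>R w"
    have e: "h' \<bullet> x = h \<bullet> x + \<epsilon> * (w \<bullet> x)" for x by (simp add: h'_def inner_add_left)
    have "h' \<bullet> v < h' \<bullet> u" using w eps(1) hu hv by (simp add: e)
    moreover have "h' \<bullet> x < h' \<bullet> y" if "x \<in> set xs" "y \<in> set xs" "h \<bullet> x < h \<bullet> y" for x y
    proof -
      have "\<epsilon> * (w \<bullet> (x - y)) \<le> \<epsilon> * \<bar>w \<bullet> (x - y)\<bar>" using eps(1) by (intro mult_left_mono) auto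
      then show ?thesis using eps(2)[OF that] by (simp add: e inner_diff_right right_diff_distrib)
    qed
    ultimately show ?thesis
      using arctriv_distinct_heights[OF W] all_good_tilted[OF xs g hu hv hy inj _ _ ch, of h'] by blast
  next
    \<comment> \<open>The opposite tilt puts \<open>v\<close> above \<open>u\<close>; reversing the
      arc places the higher end first again.\<close>
    assume ch: "changes (False # ?b @ [True]) \<le> 2"
    define h' where "h' = h - \<epsilon> *\<^sub>R w"
    have e: "h' \<bullet> x = h \<bullet> x - \<epsilon> * (w \<bullet> x)" for x by (simp add: h'_def inner_diff_left)
    have xs': "rev xs = v # rev ys @ [u]" using xs by simp
    have "rev (False # ?b @ [True]) = True # map (\<lambda>y. \<tau> < h \<bullet> y) (rev ys) @ [False]" by (simp add: rev_map)
    then have ch': "changes (True # map (\<lambda>y. \<tau> < h \<bullet> y) (rev ys) @ [False]) \<le> 2"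
      using ch changes_rev[of "False # ?b @ [True]"] by simp
    have g': "all_good (rev xs) h" using g by (simp add: all_good_def)
    have "h' \<bullet> u < h' \<bullet> v" using w eps(1) hu hv by (simp add: e)
    moreover have "h' \<bullet> x < h' \<bullet> y" if "x \<in> set (rev xs)" "y \<in> set (rev xs)" "h \<bullet> x < h \<bullet> y" for x y
    proof -
      have "- (\<epsilon> * (w \<bullet> (x - y))) \<le> \<epsilon> * \<bar>w \<bullet> (x - y)\<bar>"
        using eps(1) by (metis abs_ge_minus_self abs_mult abs_of_pos)
      then show ?thesis using eps(2)[of x y] that by (simp add: e inner_diff_right right_diff_distrib)
    qed
    moreover have "\<And>y. y \<in> set (rev ys) \<Longrightarrow> h \<bullet> y \<noteq> \<tau>" "inj_on (\<lambda>x. h \<bullet> x) (set (rev ys))" using hy inj by auto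
    ultimately have "all_good (rev xs) h'" "inj_on (\<lambda>x. h' \<bullet> x) (set (rev xs))"
      using all_good_tilted[OF xs' g' hv hu _ _ _ _ ch', of h'] by blast+
    then have "arctriv W (rev xs)" using arctriv_distinct_heights[of W "rev xs" h'] W by (simp add: cellarc_rev)
    then show ?thesis using arctriv_rev[of xs W] xs by simp
  qed
qed

text \<open>The measure counts the heights lost to ties. Ties involving an inner vertex are removed
  by slides, leaving at most the tie between the two ends.\<close>

lemma arctriv_all_good_nonplanar:
  assumes "cellarc W xs" "all_good xs h" "\<exists>x\<in>set xs. h \<bullet> x \<noteq> h \<bullet> hd xs"
  shows "arctriv W xs"
  using assms
proof (induction xs rule: measure_induct_rule[of "\<lambda>xs. length xs - card ((\<lambda>x. h \<bullet> x) ` set xs)"])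
  case (less xs)
  have dist: "distinct xs" and len: "2 \<le> length xs"
    using less.prems(1) emb_distinct unfolding cellarc_def by blast+
  show ?case
  proof (cases "\<exists>x y. x \<in> set xs \<and> x \<noteq> hd xs \<and> x \<noteq> last xs \<and> y \<in> set xs \<and> y \<noteq> x \<and> h \<bullet> y = h \<bullet> x")
    case True
    then obtain x y where xy: "x \<in> set xs" "x \<noteq> hd xs" "x \<noteq> last xs" "y \<in> set xs" "y \<noteq> x" "h \<bullet> y = h \<bullet> x" by blast
    obtain w where w: "w \<in> set xs" "h \<bullet> w \<noteq> h \<bullet> x"
      using less.prems(3) xy(1) len by (metis hd_in_set list.size(3) not_numeral_le_zero)
    obtain ys where ys: "cellarc W ys" "arctriv W ys \<longrightarrow> arctriv W xs" "dominates xs ys" "length ys = length xs"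
      "card ((\<lambda>x. h \<bullet> x) ` set ys) = Suc (card ((\<lambda>x. h \<bullet> x) ` set xs))" "\<exists>x\<in>set ys. h \<bullet> x \<noteq> h \<bullet> hd ys"
      using cellarc_tied_inner[OF less.prems(1) xy w] by blast
    have "card ((\<lambda>x. h \<bullet> x) ` set ys) \<le> length ys"
      by (metis card_image_le card_length finite_set le_trans)
    then have "length ys - card ((\<lambda>x. h \<bullet> x) ` set ys) < length xs - card ((\<lambda>x. h \<bullet> x) ` set xs)"
      using ys(4,5) by linarith
    then show ?thesis
      using less.IH ys all_good_dominates[OF less.prems(2) ys(3)] by blast
  next
    case False
    obtain u xs' where u: "xs = u # xs'" using len by (cases xs) auto
    then obtain ys v where xs: "xs = u # ys @ [v]" using len by (cases xs' rule: rev_cases) auto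
    have inner: "y \<noteq> hd xs" "y \<noteq> last xs" if "y \<in> set ys" for y using that dist xs by auto
    have tie: "h \<bullet> z \<noteq> h \<bullet> y" if "y \<in> set ys" "z \<in> set xs" "z \<noteq> y" for y z
      using False that inner[OF that(1)] xs by auto
    have inj: "inj_on (\<lambda>x. h \<bullet> x) (set ys)"
      using tie xs by (intro inj_onI) (metis UnCI list.set_intros(2) set_append)
    show ?thesis
    proof (cases "h \<bullet> u = h \<bullet> v")
      case True
      show ?thesis
      proof (rule arctriv_ends_tied[OF less.prems(1) xs less.prems(2) refl True[symmetric] _ inj])
        fix y assume y: "y \<in> set ys"
        have "u \<in> set xs" "u \<noteq> y" using inner(1)[OF y] xs by auto
        from tie[OF y this] show "h \<bullet> y \<noteq> h \<bullet> u" by simp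
      qed
    next
      case F: False
      have "inj_on (\<lambda>x. h \<bullet> x) (set xs)"
      proof (rule inj_onI)
        fix x y assume xy: "x \<in> set xs" "y \<in> set xs" "h \<bullet> x = h \<bullet> y"
        show "x = y"
        proof (cases "x \<in> set ys \<or> y \<in> set ys")
          case True
          then show ?thesis using tie[of x y] tie[of y x] xy by metis
        next
          case False
          then show ?thesis using xy xs F by auto
        qed
      qed
      then show ?thesis using arctriv_distinct_heights less.prems by blast
    qed
  qed
qed

lemma changes_const: "(\<And>x. x \<in> set xs \<Longrightarrow> x = b) \<Longrightarrow> changes xs = 0"
  by (induction xs rule: changes.induct) auto

text \<open>An arc within one level has no edge along which to slide. Inserting a vertex
  \<open>z\<close> off that level into the first edge is a triangle move, and the result still
  changes sides at most twice at each level.\<close>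

theorem arctriv_all_good:
  assumes W: "cellarc W xs" and g: "all_good xs h" and h0: "h \<noteq> 0"
  shows "arctriv W xs"
proof (cases "\<exists>x\<in>set xs. h \<bullet> x \<noteq> h \<bullet> hd xs")
  case True
  then show ?thesis using arctriv_all_good_nonplanar[OF W g] by blast
next
  case False
  define \<tau> where "\<tau> = h \<bullet> hd xs"
  have flat: "h \<bullet> x = \<tau>" if "x \<in> set xs" for x using False that by (auto simp: \<tau>_def)
  have oc: "open W" "convex W" and len: "2 \<le> length xs" and e: "emb xs"
    and ends: "hd xs \<in> closure W" "hd xs \<notin> W" "last xs \<in> closure W" "last xs \<notin> W"
    and sub: "pline xs \<subseteq> W \<union> {hd xs, last xs}"
    using W unfolding cellarc_def by auto
  obtain u xs' where u: "xs = u # xs'" using len by (cases xs) auto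
  then obtain p r where xs: "xs = u # p # r" using len by (cases xs') auto
  have up: "u \<noteq> p" and int: "closed_segment u p \<inter> pline (p # r) \<subseteq> {p}" and ep: "emb (p # r)"
    using e xs by auto
  let ?S = "{x. h \<bullet> x = \<tau>}"
  have S: "affine ?S" by (rule affine_hyperplane)
  have plS: "pline (p # r) \<subseteq> ?S"
    using flat xs by (intro pline_subset_convex) (auto simp: convex_hyperplane)
  have uS: "u \<in> ?S" "p \<in> ?S" using flat xs by auto
  have last: "last xs = last (p # r)" using xs by simp
  have vin: "last xs \<in> pline (p # r)" unfolding last using set_subset_pline[of "p # r"] last_in_set[of "p # r"] by blast
  have uout: "u \<notin> pline (p # r)"
  proof
    assume "u \<in> pline (p # r)"
    moreover have "u \<in> closed_segment u p" by simp
    ultimately show False using int up by blast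
  qed
  have segW: "closed_segment u p \<subseteq> W \<union> {u, p}"
  proof
    fix x assume x: "x \<in> closed_segment u p"
    then have "x \<in> W \<union> {u, last xs}" using sub xs by auto
    then show "x \<in> W \<union> {u, p}" using x int vin by blast
  qed
  have "W \<noteq> {}"
  proof
    assume "W = {}"
    then show False using ends(1) by simp
  qed
  moreover have "interior ?S = {}" using h0 by (rule interior_hyperplane)
  ultimately obtain z where z: "z \<in> W" "z \<notin> ?S"
    using interior_maximal[of W ?S] oc(1) by blast
  have pcl: "p \<in> closure W"
  proof -
    have "p \<in> pline xs" using xs by simp
    then show ?thesis using sub ends closure_subset[of W] by blast
  qed
  define zs where "zs = u # z # p # r"
  have nd: "nondeg u z p" using nondeg_off_plane[OF up z(2) S uS] by (rule nondeg_perms)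
  have T: "convex hull {u, z, p} \<inter> ?S \<subseteq> closed_segment u p" by (rule triangle_Int_affine[OF S uS z(2)])
  have TW: "convex hull {u, z, p} \<subseteq> W \<union> {u, p}"
    using triangle_subset_cell[OF oc z(1) _ pcl, of u] ends(1) xs segW by auto
  have "eqv W (closed_segment u z \<union> closed_segment z p \<union> pline (p # r)) (closed_segment u p \<union> pline (p # r))"
    by (rule eqv_triangle[OF nd]) (use T plS int TW in auto)
  then have eq: "eqv W (pline zs) (pline xs)" by (simp add: zs_def xs Un_assoc)
  have segT: "closed_segment u z \<subseteq> convex hull {u, z, p}" "closed_segment z p \<subseteq> convex hull {u, z, p}"
    by (intro closed_segment_subset; simp add: hull_inc)+
  have i1: "closed_segment z p \<inter> pline (p # r) \<subseteq> {p}" using segT(2) T plS int by blast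
  have i2: "closed_segment u z \<inter> closed_segment z p \<subseteq> {z}" by (rule nondeg_segments_Int[OF nd])
  have "closed_segment u z \<inter> ?S \<subseteq> {u}" by (rule segment_Int_affine[OF S uS(1) z(2)])
  then have i3: "closed_segment u z \<inter> pline (p # r) = {}" using plS uout by blast
  have "emb zs" unfolding zs_def using nondeg_distinct[OF nd] i1 i2 i3 ep by auto
  moreover have hl: "hd zs = hd xs" "last zs = last xs" by (simp_all add: zs_def xs)
  moreover have "pline zs \<subseteq> W \<union> {hd xs, last xs}"
  proof -
    have "p \<in> W \<union> {hd xs, last xs}" using sub xs by auto
    then have "closed_segment u z \<union> closed_segment z p \<subseteq> W \<union> {hd xs, last xs}" using segT TW xs by auto
    then show ?thesis using sub by (auto simp: zs_def xs)
  qed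
  ultimately have Wz: "cellarc W zs" using W len unfolding cellarc_def by (simp add: zs_def)
  have "all_good zs h"
  proof (rule all_goodI)
    fix c
    have "changes (map (\<lambda>x. c < h \<bullet> x) (p # r)) = 0"
      by (rule changes_const[of _ "c < \<tau>"]) (use flat xs in auto)
    then show "changes (map (\<lambda>x. c < h \<bullet> x) zs) \<le> 2" by (simp add: zs_def)
  qed
  moreover have "\<exists>x\<in>set zs. h \<bullet> x \<noteq> h \<bullet> hd zs" using z(2) flat xs by (auto simp: zs_def)
  ultimately have "arctriv W zs" using arctriv_all_good_nonplanar[OF Wz] by blast
  then show ?thesis unfolding arctriv_def hl using triv_eqv[OF eqv_sym[OF eq]] by blast
qed

section \<open>A minimal essential convex set\<close>

text \<open>When the plane moves slightly, the vertices on it all pass to the same side, so both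
  counts at the new level equal one of the two counts at \<open>s\<close>.\<close>

lemma good_near:
  fixes vs :: "'a::real_inner list"
  assumes "good vs h s"
  shows "\<exists>\<delta>>0. \<forall>c. \<bar>c - s\<bar> < \<delta> \<longrightarrow> good vs h c"
proof -
  \<comment> \<open>The extra 1 keeps the minimum meaningful if every vertex lies on the
    plane.\<close>
  let ?D = "insert 1 ((\<lambda>x. \<bar>h \<bullet> x - s\<bar>) ` {x \<in> set vs. h \<bullet> x \<noteq> s})"
  define \<delta> where "\<delta> = Min ?D"
  have fin: "finite ?D" by simp
  have pos: "\<delta> > 0" unfolding \<delta>_def by (subst Min_gr_iff) auto
  have del: "\<delta> \<le> \<bar>h \<bullet> x - s\<bar>" if "x \<in> set vs" "h \<bullet> x \<noteq> s" for x
    unfolding \<delta>_def by (rule Min_le[OF fin]) (use that in auto)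
  have "good vs h c" if c: "\<bar>c - s\<bar> < \<delta>" for c
  proof -
    consider "c = s" | "s < c" | "c < s" by linarith
    then show ?thesis
    proof cases
      case 2
      have "(c < h \<bullet> x) = (s < h \<bullet> x)" "(h \<bullet> x < c) = (\<not> s < h \<bullet> x)" if "x \<in> set vs" for x
        using del[OF that] c 2 by (cases "h \<bullet> x = s"; force simp: abs_if split: if_splits)+
      then have "map (\<lambda>x. c < h \<bullet> x) vs = map (\<lambda>x. s < h \<bullet> x) vs"
        "map (\<lambda>x. h \<bullet> x < c) vs = map Not (map (\<lambda>x. s < h \<bullet> x) vs)" by auto
      then show ?thesis using assms unfolding good_def by (simp only: changes_Not)
    next
      case 3
      have "(h \<bullet> x < c) = (h \<bullet> x < s)" "(c < h \<bullet> x) = (\<not> h \<bullet> x < s)" if "x \<in> set vs" for x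
        using del[OF that] c 3 by (cases "h \<bullet> x = s"; force simp: abs_if split: if_splits)+
      then have "map (\<lambda>x. h \<bullet> x < c) vs = map (\<lambda>x. h \<bullet> x < s) vs"
        "map (\<lambda>x. c < h \<bullet> x) vs = map Not (map (\<lambda>x. h \<bullet> x < s) vs)" by auto
      then show ?thesis using assms unfolding good_def by (simp only: changes_Not)
    qed (use assms in simp)
  qed
  with pos show ?thesis by blast
qed

lemma cellarc_set_subset: "cellarc W xs \<Longrightarrow> set xs \<subseteq> closure W"
  using set_subset_pline[of xs] closure_subset[of W] unfolding cellarc_def by blast

text \<open>Levels inside the slab are good by hypothesis, and levels outside it have the whole arc
  on one side.\<close>

lemma arctriv_near_plane:
  assumes W: "cellarc W xs" and dom: "dominates vs xs" and h0: "h \<noteq> 0"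
    and near: "\<And>c. \<bar>c - s\<bar> < \<delta> \<Longrightarrow> good vs h c" and cl: "closure W \<subseteq> {x. \<bar>h \<bullet> x - s\<bar> < \<delta>}"
  shows "arctriv W xs"
proof (rule arctriv_all_good[OF W _ h0])
  show "all_good xs h"
    unfolding all_good_def
  proof
    fix c
    have x: "\<bar>h \<bullet> x - s\<bar> < \<delta>" if "x \<in> set xs" for x using cellarc_set_subset[OF W] cl that by blast
    show "good xs h c"
    proof (cases "\<bar>c - s\<bar> < \<delta>")
      case True
      then show ?thesis using near dom unfolding dominates_def by blast
    next
      case False
      then consider "c \<ge> s + \<delta>" | "c \<le> s - \<delta>" by linarith
      then show ?thesis
      proof cases
        case 1
        have "c > h \<bullet> x" if "x \<in> set xs" for x using x[OF that] 1 by linarith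
        then have "changes (map (\<lambda>x. c < h \<bullet> x) xs) = 0" "changes (map (\<lambda>x. h \<bullet> x < c) xs) = 0"
          by (force intro: changes_const[of _ False], force intro: changes_const[of _ True])
        then show ?thesis unfolding good_def by simp
      next
        case 2
        have "c < h \<bullet> x" if "x \<in> set xs" for x using x[OF that] 2 by linarith
        then have "changes (map (\<lambda>x. c < h \<bullet> x) xs) = 0" "changes (map (\<lambda>x. h \<bullet> x < c) xs) = 0"
          by (force intro: changes_const[of _ True], force intro: changes_const[of _ False])
        then show ?thesis unfolding good_def by simp
      qed
    qed
  qed
qed

definition badcell :: "(real^3) list \<Rightarrow> (real^3) set \<Rightarrow> bool" where
  "badcell vs V \<longleftrightarrow> (\<exists>xs. cellarc V xs \<and> dominates vs xs \<and> \<not> arctriv V xs)"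

text \<open>Bad cells need only come close to \<open>C\<close>; testing this by open neighbourhoods
  lets the property pass to intersections of chains of compact sets.\<close>

definition essential :: "(real^3) list \<Rightarrow> (real^3) set \<Rightarrow> bool" where
  "essential vs C \<longleftrightarrow> compact C \<and> convex C \<and>
     (\<forall>U. open U \<longrightarrow> C \<subseteq> U \<longrightarrow> (\<exists>V. badcell vs V \<and> closure V \<subseteq> U))"

lemma essential_nonempty: "essential vs C \<Longrightarrow> C \<noteq> {}"
proof
  assume "essential vs C" "C = {}"
  then obtain V where "badcell vs V" "closure V \<subseteq> {}" unfolding essential_def by blast
  then show False unfolding badcell_def cellarc_def by blast
qed

text \<open>Passing to complements turns minimal sets into maximal ones, as Zorn's lemma for
  inclusion expects.\<close>

lemma ex_minimal_essential:
  assumes "essential vs C0"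
  shows "\<exists>C. essential vs C \<and> (\<forall>C'. essential vs C' \<longrightarrow> C' \<subseteq> C \<longrightarrow> C' = C)"
proof -
  let ?A = "{- C | C. essential vs C}"
  have "\<exists>M\<in>?A. \<forall>X\<in>?A. M \<subseteq> X \<longrightarrow> X = M"
  proof (rule subset_Zorn_nonempty)
    show "?A \<noteq> {}" using assms by blast
    fix \<D> assume ne: "\<D> \<noteq> {}" and ch: "subset.chain ?A \<D>"
    define \<F> where "\<F> = uminus ` \<D>"
    have ess: "essential vs C" if "C \<in> \<F>" for C
      using that ch by (auto simp: \<F>_def subset.chain_def)
    have lin: "C \<subseteq> C' \<or> C' \<subseteq> C" if H: "C \<in> \<F>" "C' \<in> \<F>" for C C'
    proof -
      obtain D D' where D: "D \<in> \<D>" "D' \<in> \<D>" "C = - D" "C' = - D'" using H unfolding \<F>_def by blast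
      have "D \<subseteq> D' \<or> D' \<subseteq> D" using ch D(1,2) unfolding subset.chain_def by blast
      then show ?thesis using D(3,4) by blast
    qed
    have neF: "\<F> \<noteq> {}" using ne by (simp add: \<F>_def)
    have cpt: "compact C" and cvx: "convex C" if "C \<in> \<F>" for C using ess[OF that] by (auto simp: essential_def)
    have "essential vs (\<Inter>\<F>)"
      unfolding essential_def
    proof (intro conjI allI impI)
      show "compact (\<Inter>\<F>)" using cpt neF by (intro compact_Inter) auto
      show "convex (\<Inter>\<F>)" using cvx by (intro convex_Inter) auto
      fix U assume U: "open U" "\<Inter>\<F> \<subseteq> U"
      have "\<exists>C\<in>\<F>. C \<subseteq> U"
      proof (rule ccontr)
        assume n: "\<not> (\<exists>C\<in>\<F>. C \<subseteq> U)"
        \<comment> \<open>If no member of the chain were inside \<open>U\<close>, the differences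
          would be a chain of nonempty compact sets, and a common point would lie in the
          intersection but outside \<open>U\<close>.\<close>
        have "\<Inter>((\<lambda>C. C - U) ` \<F>) \<noteq> {}"
        proof (rule compact_chain)
          show "compact S" if "S \<in> (\<lambda>C. C - U) ` \<F>" for S using that cpt U(1) by (auto intro: compact_diff)
          show "{} \<notin> (\<lambda>C. C - U) ` \<F>" using n by auto
          show "S \<subseteq> T \<or> T \<subseteq> S" if "S \<in> (\<lambda>C. C - U) ` \<F> \<and> T \<in> (\<lambda>C. C - U) ` \<F>" for S T
            using that lin by blast
        qed
        then show False using U(2) neF by blast
      qed
      then show "\<exists>V. badcell vs V \<and> closure V \<subseteq> U" using ess U(1) unfolding essential_def by blast
    qed
    moreover have "\<Union>\<D> = - \<Inter>\<F>" by (auto simp: \<F>_def)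
    ultimately show "\<Union>\<D> \<in> ?A" by blast
  qed
  then obtain M where M: "M \<in> ?A" "\<forall>X\<in>?A. M \<subseteq> X \<longrightarrow> X = M" by (rule bexE)
  obtain C where C: "M = - C" "essential vs C" using M(1) by auto
  have "C' = C" if C': "essential vs C'" "C' \<subseteq> C" for C'
  proof -
    have "- C' \<in> ?A" using C'(1) by auto
    moreover have "M \<subseteq> - C'" using C'(2) C(1) by auto
    ultimately have "- C' = M" by (rule M(2)[THEN bspec, THEN mp])
    then show ?thesis unfolding C(1) by simp
  qed
  then show ?thesis using C(2) by (intro exI[of _ C]) simp
qed

text \<open>The two parts overlap in a slab, which leaves room for a good cutting level between
  \<open>s\<close> and \<open>s + \<sigma>\<close> that avoids the vertices of the bad arc. By
  \<open>arctriv_cut\<close>, one half of the bad cell is bad again.\<close>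

lemma essential_halve:
  assumes C: "essential vs C" and near: "\<And>c. \<bar>c - s\<bar> < \<delta> \<Longrightarrow> good vs h c" and sig: "0 < \<sigma>" "\<sigma> \<le> \<delta>"
  shows "essential vs (C \<inter> {x. s - \<sigma> \<le> h \<bullet> x}) \<or> essential vs (C \<inter> {x. h \<bullet> x \<le> s + \<sigma>})"
proof (rule ccontr)
  let ?C1 = "C \<inter> {x. s - \<sigma> \<le> h \<bullet> x}" and ?C2 = "C \<inter> {x. h \<bullet> x \<le> s + \<sigma>}"
  assume n: "\<not> ?thesis"
  have cl: "closed {x. s - \<sigma> \<le> h \<bullet> x}" "closed {x. h \<bullet> x \<le> s + \<sigma>}"
    by (simp_all add: closed_halfspace_ge closed_halfspace_le)
  have cv: "convex {x. s - \<sigma> \<le> h \<bullet> x}" "convex {x. h \<bullet> x \<le> s + \<sigma>}"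
    by (simp_all add: convex_halfspace_ge convex_halfspace_le)
  have 1: "compact ?C1" "convex ?C1" "compact ?C2" "convex ?C2"
    using C cl cv unfolding essential_def by (auto intro: compact_Int_closed convex_Int)
  obtain U1 where U1: "open U1" "?C1 \<subseteq> U1" "\<And>V. badcell vs V \<Longrightarrow> \<not> closure V \<subseteq> U1"
    using n 1 unfolding essential_def by blast
  obtain U2 where U2: "open U2" "?C2 \<subseteq> U2" "\<And>V. badcell vs V \<Longrightarrow> \<not> closure V \<subseteq> U2"
    using n 1 unfolding essential_def by blast
  \<comment> \<open>Points of \<open>U\<close> not below \<open>s - \<sigma>\<close> lie in
    \<open>U1\<close>, and those not above \<open>s + \<sigma>\<close> lie in \<open>U2\<close>; so
    the closure of each half of the cell falls into one of the two.\<close>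
  define U where "U = (U1 \<union> {x. h \<bullet> x < s - \<sigma>}) \<inter> (U2 \<union> {x. s + \<sigma> < h \<bullet> x})"
  have "open U" unfolding U_def using U1(1) U2(1)
    by (intro open_Int open_Un open_halfspace_lt open_halfspace_gt)
  moreover have "C \<subseteq> U" using U1(2) U2(2) by (force simp: U_def)
  ultimately obtain V where V: "badcell vs V" "closure V \<subseteq> U" using C unfolding essential_def by blast
  obtain xs where xs: "cellarc V xs" "dominates vs xs" "\<not> arctriv V xs" using V(1) unfolding badcell_def by blast
  have "infinite {s<..<s + \<sigma>}" using sig by (simp add: infinite_Ioo)
  then have "\<not> {s<..<s + \<sigma>} \<subseteq> (\<lambda>x. h \<bullet> x) ` set xs" by (meson List.finite_set finite_imageI finite_subset)
  then obtain t where t0: "t \<in> {s<..<s + \<sigma>}" and t3: "t \<notin> (\<lambda>x. h \<bullet> x) ` set xs" by blast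
  have t: "s < t" "t < s + \<sigma>" using t0 by auto
  have "good vs h t" using t sig by (intro near) auto
  then have g: "good xs h t" using xs(2) by (simp add: dominates_def)
  have nov: "h \<bullet> x \<noteq> t" if "x \<in> set xs" for x using t3 that by blast
  have "\<exists>V' ys. (V' = V \<inter> {y. t < h \<bullet> y} \<or> V' = V \<inter> {y. h \<bullet> y < t}) \<and> cellarc V' ys \<and> dominates xs ys \<and> \<not> arctriv V' ys"
    using arctriv_cut[OF xs(1) nov g] xs(3) by blast
  then obtain V' ys where V': "V' = V \<inter> {y. t < h \<bullet> y} \<or> V' = V \<inter> {y. h \<bullet> y < t}"
    "cellarc V' ys" "dominates xs ys" "\<not> arctriv V' ys" by blast
  have bad: "badcell vs V'" unfolding badcell_def using V'(2-4) dominates_trans[OF xs(2)] by blast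
  have clV: "closure V' \<subseteq> U" using V(2) V'(1) closure_mono[of V' V] by auto
  from V'(1) show False
  proof
    assume e: "V' = V \<inter> {y. t < h \<bullet> y}"
    have "V' \<subseteq> {y. t \<le> h \<bullet> y}" using e by auto
    then have "closure V' \<subseteq> {y. t \<le> h \<bullet> y}" by (simp add: closure_minimal closed_halfspace_ge)
    then have "closure V' \<subseteq> U1" using clV t(1) sig by (force simp: U_def)
    then show False using U1(3)[OF bad] by blast
  next
    assume e: "V' = V \<inter> {y. h \<bullet> y < t}"
    have "V' \<subseteq> {y. h \<bullet> y \<le> t}" using e by auto
    then have "closure V' \<subseteq> {y. h \<bullet> y \<le> t}" by (simp add: closure_minimal closed_halfspace_le)
    then have "closure V' \<subseteq> U2" using clV t(2) by (force simp: U_def)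
    then show False using U2(3)[OF bad] by blast
  qed
qed

theorem arctriv_of_good_planes:
  assumes planes: "\<And>p. \<exists>h. h \<noteq> 0 \<and> good vs h (h \<bullet> p)"
    and W: "cellarc W xs" "bounded W" and dom: "dominates vs xs"
  shows "arctriv W xs"
proof (rule ccontr)
  assume n: "\<not> arctriv W xs"
  have "essential vs (closure W)"
    unfolding essential_def
  proof (intro conjI allI impI)
    show "compact (closure W)" using W(2) by simp
    show "convex (closure W)" using W(1) by (simp add: cellarc_def convex_closure)
    fix U assume "closure W \<subseteq> U"
    then show "\<exists>V. badcell vs V \<and> closure V \<subseteq> U" using n W(1) dom unfolding badcell_def by blast
  qed
  then obtain C where C: "essential vs C" "\<And>C'. essential vs C' \<Longrightarrow> C' \<subseteq> C \<Longrightarrow> C' = C"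
    using ex_minimal_essential by blast
  have cvx: "convex C" using C(1) by (simp add: essential_def)
  have neC: "C \<noteq> {}" using C(1) by (rule essential_nonempty)
  then obtain p where p: "p \<in> rel_interior C" using cvx rel_interior_eq_empty by blast
  obtain h where h: "h \<noteq> 0" "good vs h (h \<bullet> p)" using planes by blast
  define s where "s = h \<bullet> p"
  obtain \<delta> where d: "\<delta> > 0" "\<And>c. \<bar>c - s\<bar> < \<delta> \<Longrightarrow> good vs h c"
    using good_near[of vs h s] h(2) unfolding s_def by blast
  show False
  proof (cases "\<forall>x\<in>C. h \<bullet> x = s")
    case True
    have "open {x. \<bar>h \<bullet> x - s\<bar> < \<delta>}" by (intro open_Collect_less continuous_intros)
    moreover have "C \<subseteq> {x. \<bar>h \<bullet> x - s\<bar> < \<delta>}" using True d(1) by auto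
    ultimately obtain V where "badcell vs V" "closure V \<subseteq> {x. \<bar>h \<bullet> x - s\<bar> < \<delta>}"
      using C(1) unfolding essential_def by blast
    then show False unfolding badcell_def using arctriv_near_plane[OF _ _ h(1) d(2)] by blast
  next
    case False
    then obtain y where y: "y \<in> C" "h \<bullet> y \<noteq> s" by blast
    \<comment> \<open>At a relative interior point the segment from \<open>y\<close> to
      \<open>p\<close> can be prolonged within \<open>C\<close>; the new end is on the other side of
      the plane.\<close>
    obtain e where e: "e > 1" "(1 - e) *\<^sub>R y + e *\<^sub>R p \<in> C"
      using p y(1) convex_rel_interior_iff[OF cvx neC, of p] by blast
    define w where "w = (1 - e) *\<^sub>R y + e *\<^sub>R p"
    have w: "w \<in> C" using e(2) by (simp add: w_def)
    have hw: "h \<bullet> w - s = (1 - e) * (h \<bullet> y - s)" by (simp add: w_def s_def inner_add_right algebra_simps)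
    have "\<exists>a\<in>C. \<exists>b\<in>C. h \<bullet> a < s \<and> s < h \<bullet> b"
    proof (cases "h \<bullet> y < s")
      case True
      then have "h \<bullet> w - s > 0" unfolding hw using e(1) by (simp add: mult_neg_neg)
      then show ?thesis using True y(1) w by force
    next
      case False
      then have "h \<bullet> w - s < 0" unfolding hw using e(1) y(2) by (simp add: mult_neg_pos)
      then show ?thesis using False y w by force
    qed
    then obtain a b where ab: "a \<in> C" "b \<in> C" "h \<bullet> a < s" "s < h \<bullet> b" by blast
    \<comment> \<open>With half of the smallest margin, one part of \<open>C\<close> misses
      \<open>a\<close> and the other misses \<open>b\<close>, so both are proper.\<close>
    define \<sigma> where "\<sigma> = min \<delta> (min (s - h \<bullet> a) (h \<bullet> b - s)) / 2"
    have sig: "0 < \<sigma>" "\<sigma> \<le> \<delta>" "h \<bullet> a < s - \<sigma>" "s + \<sigma> < h \<bullet> b"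
      using d(1) ab by (auto simp: \<sigma>_def min_def field_simps)
    have "essential vs (C \<inter> {x. s - \<sigma> \<le> h \<bullet> x}) \<or> essential vs (C \<inter> {x. h \<bullet> x \<le> s + \<sigma>})"
      by (rule essential_halve[OF C(1) _ sig(1,2)]) (rule d(2))
    then have "C \<inter> {x. s - \<sigma> \<le> h \<bullet> x} = C \<or> C \<inter> {x. h \<bullet> x \<le> s + \<sigma>} = C"
      using C(2) by blast
    then show False using ab(1,2) sig(3,4) by force
  qed
qed

section \<open>Closed polygons\<close>

text \<open>One edge is singled out and the other edges form an embedded arc from \<open>y\<close>
  back to \<open>x\<close>; \<open>closed_emb_rotate\<close> shows that the starting vertex is
  immaterial.\<close>

fun closed_emb :: "'a::real_vector list \<Rightarrow> bool" where
  "closed_emb (x # y # ys) \<longleftrightarrow> x \<noteq> y \<and> emb (y # ys @ [x]) \<and> closed_segment x y \<inter> pline (y # ys @ [x]) \<subseteq> {x, y}"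
| "closed_emb _ \<longleftrightarrow> False"

lemma closed_emb_rotate1:
  assumes c: "closed_emb (x # y # z # ys)"
  shows "closed_emb (y # z # ys @ [x])"
    and "pline (y # z # ys @ [x, y]) = pline (x # y # z # ys @ [x])"
proof -
  have c': "x \<noteq> y" "emb (y # z # ys @ [x])" "closed_segment x y \<inter> pline (y # z # ys @ [x]) \<subseteq> {x, y}" using c by auto
  have e: "y \<noteq> z" "closed_segment y z \<inter> pline (z # ys @ [x]) \<subseteq> {z}" "emb (z # ys @ [x])" using c'(2) by auto
  have d: "distinct (y # z # ys @ [x])" using emb_distinct[OF c'(2)] .
  have p: "pline (z # ys @ [x, y]) = pline (z # ys @ [x]) \<union> closed_segment x y"
    using pline_append[of "z # ys" x "[y]"] by auto
  have yz: "y \<in> closed_segment y z" by simp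
  have yn: "y \<notin> pline (z # ys @ [x])" using e(1,2) yz by blast
  have "pline (z # ys @ [x]) \<inter> closed_segment x y \<subseteq> {x}" using c'(3) yn by auto
  then have "emb ((z # ys) @ x # [y])" unfolding emb_append[of "z # ys" x "[y]"] using e(3) c'(1) by auto
  then have emb: "emb (z # ys @ [x, y])" by simp
  have xin: "x \<in> pline (z # ys @ [x])" using set_subset_pline[of "z # ys @ [x]"] by auto
  have "x \<notin> closed_segment y z" using e(2) xin d by auto
  then have "closed_segment y z \<inter> closed_segment x y \<subseteq> {y}" using c'(3) by auto
  then have "closed_segment y z \<inter> pline (z # ys @ [x, y]) \<subseteq> {y, z}" unfolding p using e(2) by blast
  then show "closed_emb (y # z # ys @ [x])" using e(1) emb by simp
  show "pline (y # z # ys @ [x, y]) = pline (x # y # z # ys @ [x])" using p by auto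
qed

lemma closed_emb_rotate:
  assumes "closed_emb (l @ v # r)" "3 \<le> length (l @ v # r)"
  shows "closed_emb (v # r @ l) \<and> pline (v # r @ l @ [v]) = pline ((l @ v # r) @ [hd (l @ v # r)])"
  using assms
proof (induction l arbitrary: r)
  case (Cons x l)
  have "3 \<le> length (x # (l @ v # r))" using Cons.prems by simp
  then obtain y z ys where yz: "l @ v # r = y # z # ys"
    by (cases "l @ v # r"; cases "tl (l @ v # r)") auto
  have "closed_emb (x # y # z # ys)" using Cons.prems(1) yz by simp
  note rot = closed_emb_rotate1[OF this]
  have e: "y # z # ys @ [x] = l @ v # (r @ [x])" using yz by (metis append_Cons append_assoc)
  have hdy: "hd (l @ v # r @ [x]) = y" using e by (metis list.sel(1))
  have "closed_emb (l @ v # (r @ [x]))" using rot(1) unfolding e .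
  from Cons.IH[OF this] Cons.prems(2)
  have IH: "closed_emb (v # (r @ [x]) @ l)"
    "pline (v # (r @ [x]) @ l @ [v]) = pline ((l @ v # r @ [x]) @ [y])" unfolding hdy by auto
  have "(l @ v # r @ [x]) @ [y] = y # z # ys @ [x, y]" unfolding e[symmetric] by simp
  then have "pline (v # (r @ [x]) @ l @ [v]) = pline (x # y # z # ys @ [x])"
    using IH(2) rot(2) by (simp only:)
  then show ?case using IH(1) yz by simp
qed simp

lemma farthest_vertex:
  fixes v :: "'a::real_inner"
  assumes "norm x \<le> norm v" "x \<noteq> v"
  shows "v \<bullet> x < v \<bullet> v"
proof -
  have "0 < (v - x) \<bullet> (v - x)" using assms(2) by simp
  also have "\<dots> = v \<bullet> v - 2 * (v \<bullet> x) + x \<bullet> x" by (simp add: inner_diff_left inner_diff_right inner_commute)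
  also have "x \<bullet> x \<le> v \<bullet> v" using assms(1) by (simp add: norm_le)
  finally show ?thesis by simp
qed

text \<open>A vertex farthest from the origin is strictly highest in its own direction, so a plane
  just below it cuts off that vertex alone. The rest is a proper arc in a half ball and hence
  trivial; the knot becomes the quadrilateral \<open>p z q v\<close>, and deleting \<open>v\<close>
  leaves a triangle.\<close>

theorem trivial_knot_of_good_planes_rotated:
  fixes v b :: "real^3"
  assumes c: "closed_emb (v # b # ys)" and ne: "ys \<noteq> []"
    and far: "\<And>x. x \<in> set (b # ys) \<Longrightarrow> norm x \<le> norm v"
    and planes: "\<And>p. \<exists>h. h \<noteq> 0 \<and> good (v # b # ys @ [v]) h (h \<bullet> p)"
  shows "trivial_knot (pline (v # b # ys @ [v]))"
proof -
  have c': "v \<noteq> b" "emb (b # ys @ [v])" "closed_segment v b \<inter> pline (b # ys @ [v]) \<subseteq> {v, b}" using c by auto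
  have dist: "distinct (b # ys @ [v])" by (rule emb_distinct[OF c'(2)])
  obtain ys' w where w: "ys = ys' @ [w]" using ne by (cases ys rule: rev_cases) auto
  define h where "h = v"
  have low: "h \<bullet> x < h \<bullet> v" if "x \<in> set (b # ys)" for x
    unfolding h_def by (rule farthest_vertex[OF far[OF that]]) (use that dist in auto)
  define m where "m = Max ((\<lambda>x. h \<bullet> x) ` set (b # ys))"
  have mle: "h \<bullet> x \<le> m" if "x \<in> set (b # ys)" for x unfolding m_def using that by (intro Max_ge) auto
  have mlt: "m < h \<bullet> v" unfolding m_def using low by (subst Max_less_iff) auto
  define s where "s = (m + h \<bullet> v) / 2"
  have s: "h \<bullet> x < s" if "x \<in> set (b # ys)" for x using mle[OF that] mlt by (simp add: s_def)
  have sv: "s < h \<bullet> v" using mlt by (simp add: s_def)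
  have hb: "h \<bullet> b < s" and hw: "h \<bullet> w < s" using s w by auto
  obtain p where p: "p \<in> open_segment v b" "h \<bullet> p = s" using ex_level_point[OF sv hb] by blast
  obtain q where q: "q \<in> open_segment w v" "h \<bullet> q = s"
    using ex_level_point[OF sv hw] by (auto simp: open_segment_commute)
  have pc: "p \<in> closed_segment v b" "p \<noteq> b" "p \<noteq> v" and qc: "q \<in> closed_segment w v"
    using p q by (auto simp: open_segment_def)
  define xs where "xs = p # b # ys @ [q]"
  have L1: "b # ys @ [v] = (b # ys') @ w # v # []" "b # ys @ [q, v] = (b # ys') @ w # q # v # []" using w by simp_all
  have e1: "emb (b # ys @ [q, v])" unfolding L1(2) by (rule emb_insert[OF _ q(1)]) (use c'(2) L1(1) in simp)
  have pl1: "pline (b # ys @ [q, v]) = pline (b # ys @ [v])" unfolding L1 by (rule pline_insert[OF qc])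
  have e2: "emb (b # ys @ [q])" and e2': "emb [q, v]" "pline (b # ys @ [q]) \<inter> pline [q, v] \<subseteq> {q}"
    using e1 emb_append[of "b # ys" q "[v]"] by auto
  have pl2: "pline (b # ys @ [v]) = pline (b # ys @ [q]) \<union> closed_segment q v"
    using pl1 pline_append[of "b # ys" q "[v]"] by auto
  have segpb: "closed_segment p b \<subseteq> closed_segment v b" "closed_segment v p \<subseteq> closed_segment v b"
    using pc(1) by (simp_all add: subset_closed_segment)
  have "v \<notin> closed_segment p b" using segment_le[of h p s b v] p(2) hb sv by auto
  then have "closed_segment p b \<inter> pline (b # ys @ [q]) \<subseteq> {b}"
    using segpb(1) c'(3) pl2 by blast
  then have exs: "emb xs" unfolding xs_def using e2 pc(2) by auto
  \<comment> \<open>The ball holds all vertices, so the half ball is a bounded cell with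
    \<open>p\<close> and \<open>q\<close> on its flat side.\<close>
  define R where "R = norm v + 1"
  define B where "B = ball (0::real^3) R"
  have vB: "x \<in> B" if "x \<in> set (v # b # ys)" for x 
  proof -
    have "norm x \<le> norm v" using that far by auto
    then show ?thesis by (simp add: B_def R_def)
  qed
  have Boc: "open B" "convex B" by (simp_all add: B_def)
  define W where "W = B \<inter> {y. h \<bullet> y < s}"
  have W': "W = B \<inter> {y. - s < (- h) \<bullet> y}" by (auto simp: W_def)
  have ocW: "open W" "convex W" unfolding W' by (rule cell_halfspace[OF Boc])+
  have pqB: "p \<in> B" "q \<in> B"
    using closed_segment_subset[of v B b] closed_segment_subset[of w B v] Boc(2) vB pc(1) qc w by auto
  have pcl: "p \<in> closure W" unfolding W'
    by (rule closure_Int_halfspace'[OF Boc pqB(1), of _ _ b]) (use p hb vB closure_subset[of B] in auto)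
  have qcl: "q \<in> closure W" unfolding W'
    by (rule closure_Int_halfspace'[OF Boc pqB(2), of _ _ b]) (use q hb vB closure_subset[of B] in auto)
  have hxs: "h \<bullet> x < s \<or> x = p \<or> x = q" if x: "x \<in> pline xs" for x
  proof -
    have "x \<in> closed_segment b p \<or> x \<in> pline ((b # ys) @ [q])" using x by (auto simp: xs_def closed_segment_commute)
    then show ?thesis using segment_below[of h b s p x] pline_below[of "b # ys" h s q x] hb p q s by auto
  qed
  have "pline xs \<subseteq> B" by (rule pline_subset_convex[OF Boc(2)]) (use vB pqB in \<open>auto simp: xs_def\<close>)
  then have plW: "pline xs \<subseteq> W \<union> {p, q}" using hxs by (auto simp: W_def)
  have cell: "cellarc W xs"
    unfolding cellarc_def using ocW exs pcl qcl plW p q by (auto simp: xs_def W_def)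
  have bdd: "bounded W" unfolding W_def B_def by (rule bounded_subset[OF bounded_ball]) auto
  have dom: "dominates (v # b # ys @ [v]) xs"
    unfolding dominates_def
  proof (intro allI impI)
    \<comment> \<open>Insert \<open>p\<close> and \<open>q\<close> on the two edges at
      \<open>v\<close>, then delete both copies of \<open>v\<close>.\<close>
    fix k c assume "good (v # b # ys @ [v]) k c"
    then have "good ([] @ v # b # (ys @ [v])) k c" by simp
    from good_insert[OF this pc(1)] have "good ((v # p # b # ys') @ w # v # []) k c" using w by simp
    from good_insert[OF this qc] have "good ([] @ [v] @ (p # b # ys @ [q, v])) k c" using w by simp
    then have "good ([] @ (p # b # ys @ [q, v])) k c" by (rule good_delete)
    then have "good ((p # b # ys @ [q]) @ [v] @ []) k c" by simp
    then have "good ((p # b # ys @ [q]) @ []) k c" by (rule good_delete)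
    then show "good xs k c" by (simp add: xs_def)
  qed
  have "arctriv W xs" by (rule arctriv_of_good_planes[OF planes cell bdd dom])
  then have "triv W p q (pline xs)" unfolding arctriv_def by (simp add: xs_def)
  then obtain z where z: "z \<in> W" and ez: "eqv W (pline xs) (closed_segment p z \<union> closed_segment z q)"
    unfolding triv_def by blast
  have hz: "h \<bullet> z < s" using z by (simp add: W_def)
  have pq: "p \<noteq> q" using emb_distinct[OF exs] by (auto simp: xs_def)
  have nd: "nondeg p q x" if "h \<bullet> x \<noteq> s" for x
    by (rule nondeg_off_plane[of p q x "{x. h \<bullet> x = s}"]) (use that pq p q in \<open>auto simp: affine_hyperplane\<close>)
  let ?Z = "closed_segment p v \<union> closed_segment v q"
  have up: "s \<le> h \<bullet> x" if "x \<in> ?Z" for x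
    using that segment_ge[of s h p v x] segment_ge[of s h v q x] p q sv by auto
  have "pline (v # b # ys @ [v]) = pline xs \<union> ?Z"
  proof -
    have "closed_segment v b = closed_segment v p \<union> closed_segment p b" using Un_closed_segment[OF pc(1)] by simp
    then show ?thesis using pl2 by (auto simp: xs_def closed_segment_commute)
  qed
  moreover have "trivial_knot (pline xs \<union> ?Z) \<longleftrightarrow> trivial_knot (closed_segment p z \<union> closed_segment z q \<union> ?Z)"
    using ez up unfolding eqv_def W_def by (metis (no_types, lifting) Int_iff disjoint_iff finseg_Un finseg_segment linorder_not_less mem_Collect_eq)
  moreover have "trivial_knot (?Z \<union> (closed_segment p z \<union> closed_segment z q))
     \<longleftrightarrow> trivial_knot (closed_segment p q \<union> (closed_segment p z \<union> closed_segment z q))"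
  proof (rule trivial_knot_triangle)
    show "nondeg p v q" using nd[of v] sv by (intro nondeg_perms(1)[of p q v]) auto
    have "convex hull {p, v, q} \<subseteq> {x. h \<bullet> x \<ge> s}"
      using p q sv by (intro hull_minimal) (auto simp: convex_halfspace_ge)
    then have up': "s \<le> h \<bullet> x" if "x \<in> convex hull {p, v, q}" for x using that by blast
    have down: "h \<bullet> x < s \<or> x = p \<or> x = q" if "x \<in> closed_segment p z \<union> closed_segment z q" for x
      using that segment_below[of h z s p x] segment_below[of h z s q x] hz p(2) q(2)
      by (auto simp: closed_segment_commute[of p z])
    show "(closed_segment p z \<union> closed_segment z q) \<inter> convex hull {p, v, q} \<subseteq> {p, q}"
    proof
      fix x assume "x \<in> (closed_segment p z \<union> closed_segment z q) \<inter> convex hull {p, v, q}"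
      then show "x \<in> {p, q}" using up'[of x] down[of x] by auto
    qed
  qed simp
  moreover have "trivial_knot (triangle_boundary p q z)"
    by (rule trivial_knot_triangle_boundary) (use nd hz in auto)
  ultimately show ?thesis
    unfolding triangle_boundary_def by (simp add: closed_segment_commute Un_ac)
qed

section \<open>Counting cuts of a closed curve\<close>

lemma cis_shift [simp]: "cis (t + 2 * pi) = cis t"
  by (simp add: cis.code)

lemma cis_eq_near:
  assumes "cis s = cis t" "\<bar>s - t\<bar> < 2 * pi"
  shows "s = t"
proof -
  have "cos (s - t) = 1"
  proof -
    have "cos s = cos t" "sin s = sin t" using assms(1) by (metis cis.sel)+
    then have "cos (s - t) = (cos t)\<^sup>2 + (sin t)\<^sup>2" by (simp add: cos_diff power2_eq_square)
    then show ?thesis by simp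
  qed
  then obtain n :: int where n: "s - t = of_int n * 2 * pi" using cos_one_2pi_int by auto
  then have "\<bar>of_int n :: real\<bar> * (2 * pi) < 1 * (2 * pi)" using assms(2) by (simp add: abs_mult)
  then have "\<bar>of_int n :: real\<bar> < 1" by (rule mult_right_less_imp_less) simp
  then have "n = 0" by linarith
  then show ?thesis using n by simp
qed

lemma continuous_cis: "continuous_on S cis"
  unfolding cis_conv_exp by (intro continuous_intros)

lemma circle_param:
  assumes "z \<in> sphere 0 (1::real)"
  shows "\<exists>t. s \<le> t \<and> t < s + 2 * pi \<and> z = cis t"
proof -
  define z' where "z' = z / cis s"
  have "norm z' = 1" using assms by (simp add: z'_def norm_divide)
  then obtain r where r: "0 \<le> r" "r < 2 * pi" "z' = cis r"
    using complex_unimodular_polar[of z'] by (metis cis.code)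
  have "z = z' * cis s" by (simp add: z'_def)
  also have "\<dots> = cis (s + r)" using r(3) by (simp add: cis_mult add.commute)
  finally show ?thesis using r by (intro exI[of _ "s + r"]) auto
qed

text \<open>The two points divide the circle into closed arcs that meet nowhere else, so they
  separate any connected set avoiding both.\<close>

lemma connected_circle_two_points:
  assumes C: "connected C" "C \<subseteq> sphere 0 1" and st: "s < t" "t < s + 2 * pi"
    and n: "cis s \<notin> C" "cis t \<notin> C"
  shows "C \<subseteq> cis ` {s<..<t} \<or> C \<subseteq> cis ` {t<..<s + 2 * pi}"
proof -
  let ?F1 = "cis ` {s..t}" and ?F2 = "cis ` {t..s + 2 * pi}"
  have cl: "closed ?F1" "closed ?F2"
    by (intro compact_imp_closed compact_continuous_image continuous_cis compact_Icc)+
  have cover: "C \<subseteq> ?F1 \<union> ?F2"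
  proof
    fix z assume "z \<in> C"
    then obtain r where r: "s \<le> r" "r < s + 2 * pi" "z = cis r" using circle_param[of z s] C(2) by blast
    show "z \<in> ?F1 \<union> ?F2" unfolding r(3) using r(1,2) by (cases "r \<le> t") auto
  qed
  have "?F1 \<inter> ?F2 \<inter> C = {}"
  proof (rule ccontr)
    assume "?F1 \<inter> ?F2 \<inter> C \<noteq> {}"
    then obtain z where z0: "z \<in> C" "z \<in> ?F1" "z \<in> ?F2" by blast
    obtain r where r: "z = cis r" "s \<le> r" "r \<le> t" using z0(2) by auto
    obtain r' where r': "z = cis r'" "t \<le> r'" "r' \<le> s + 2 * pi" using z0(3) by auto
    have rC: "cis r \<in> C" by (rule subst[OF r(1), of "\<lambda>x. x \<in> C"], rule z0(1))
    have rC': "cis r' \<in> C" by (rule subst[OF r'(1), of "\<lambda>x. x \<in> C"], rule z0(1))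
    have rs: "r \<noteq> s"
    proof
      assume "r = s" then show False using rC n(1) by simp
    qed
    have "r' \<noteq> t"
    proof
      assume "r' = t" then show False using rC' n(2) by simp
    qed
    with rs have "\<bar>r - r'\<bar> < 2 * pi" using r(2,3) r'(2,3) st by linarith
    moreover have "cis r = cis r'" by (rule trans[OF r(1)[symmetric] r'(1)])
    ultimately have "r = r'" by (intro cis_eq_near)
    then have "r = t" using r(3) r'(2) by simp
    then show False using rC n(2) by simp
  qed
  then have "?F1 \<inter> C = {} \<or> ?F2 \<inter> C = {}"
    using connected_closedD[OF C(1) _ cover cl] by blast
  then show ?thesis
  proof
    assume e: "?F1 \<inter> C = {}"
    have "C \<subseteq> cis ` {t<..<s + 2 * pi}"
    proof
      fix z assume z: "z \<in> C"
      then have "z \<in> ?F2" using cover e by blast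
      then obtain r where r: "z = cis r" "r \<in> {t..s + 2 * pi}" by (rule imageE)
      have rC: "cis r \<in> C" by (rule subst[OF r(1), of "\<lambda>x. x \<in> C"], rule z)
      have "r \<noteq> t" "r \<noteq> s + 2 * pi" using rC n(2) rC n(1) cis_shift[of s] by fastforce+
      then have "r \<in> {t<..<s + 2 * pi}" using r(2) by simp
      then show "z \<in> cis ` {t<..<s + 2 * pi}" unfolding r(1) by (rule imageI)
    qed
    then show ?thesis ..
  next
    assume e: "?F2 \<inter> C = {}"
    have "C \<subseteq> cis ` {s<..<t}"
    proof
      fix z assume z: "z \<in> C"
      then have "z \<in> ?F1" using cover e by blast
      then obtain r where r: "z = cis r" "r \<in> {s..t}" by (rule imageE)
      have rC: "cis r \<in> C" by (rule subst[OF r(1), of "\<lambda>x. x \<in> C"], rule z)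
      have "r \<noteq> s" "r \<noteq> t" using rC n by fastforce+
      then have "r \<in> {s<..<t}" using r(2) by simp
      then show "z \<in> cis ` {s<..<t}" unfolding r(1) by (rule imageI)
    qed
    then show ?thesis ..
  qed
qed

context
  fixes K :: "complex \<Rightarrow> 'a::euclidean_space"
  assumes K: "closed_curve K"
begin

lemma continuous_height: "continuous_on S (\<lambda>t. u \<bullet> K (cis t))"
proof -
  have "continuous_on S (\<lambda>t. K (cis t))"
    by (rule continuous_on_compose2[OF K[unfolded closed_curve_def] continuous_cis]) auto
  then show ?thesis by (intro continuous_intros)
qed

text \<open>The times \<open>s\<close> and \<open>e\<close> are off the level and confine the
  component to one arc, where it lifts to an interval of parameters.\<close>

lemma component_interval:
  assumes x: "s < x" "x < e" "u \<bullet> K (cis x) = c" and e: "e < s + 2 * pi"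
    and n: "u \<bullet> K (cis s) \<noteq> c" "u \<bullet> K (cis e) \<noteq> c"
  shows "\<exists>C a b. C \<in> intersection_components K u c \<and> C = cis ` {a..b} \<and> s < a \<and> a \<le> x \<and> x \<le> b \<and> b < e \<and>
    (\<forall>t\<in>{a..b}. u \<bullet> K (cis t) = c)"
proof -
  let ?Z = "{z \<in> sphere 0 1. u \<bullet> K z = c}"
  have cs: "closedin (top_of_set (sphere 0 1)) ?Z"
    using K unfolding closed_curve_def by (intro continuous_closedin_preimage_constant continuous_intros) auto
  have clZ: "closed ?Z" using cs by (rule closedin_closed_trans) simp
  have xZ: "cis x \<in> ?Z" using x(3) by simp
  define C where "C = connected_component_set ?Z (cis x)"
  have CZ: "C \<subseteq> ?Z" unfolding C_def by (rule connected_component_subset)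
  have Cc: "connected C" unfolding C_def by simp
  have xC: "cis x \<in> C" unfolding C_def using xZ by simp
  have Ccl: "closed C" unfolding C_def by (rule closed_connected_component[OF clZ])
  have comp: "C \<in> intersection_components K u c"
    unfolding intersection_components_def C_def components_def using xZ by blast
  have Csph: "C \<subseteq> sphere 0 1" using CZ by blast
  have sep: "C \<subseteq> cis ` {s<..<r}" if r: "x < r" "r \<le> e" "cis r \<notin> C" for r
  proof -
    have "cis s \<notin> C" using CZ n by auto
    then have "C \<subseteq> cis ` {s<..<r} \<or> C \<subseteq> cis ` {r<..<s + 2 * pi}"
      by (intro connected_circle_two_points Cc Csph) (use r x e in auto)
    moreover have "\<not> C \<subseteq> cis ` {r<..<s + 2 * pi}"
    proof
      assume "C \<subseteq> cis ` {r<..<s + 2 * pi}"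
      then have "cis x \<in> cis ` {r<..<s + 2 * pi}" using xC by blast
      then obtain y where y: "r < y" "y < s + 2 * pi" "cis x = cis y" by auto
      then show False using cis_eq_near[of x y] x r by auto
    qed
    ultimately show ?thesis by blast
  qed
  have sep': "C \<subseteq> cis ` {r<..<s + 2 * pi}" if r: "s < r" "r < x" "cis r \<notin> C" for r
  proof -
    have "cis s \<notin> C" using CZ n by auto
    then have "C \<subseteq> cis ` {s<..<r} \<or> C \<subseteq> cis ` {r<..<s + 2 * pi}"
      by (intro connected_circle_two_points Cc Csph) (use r x e in auto)
    moreover have "\<not> C \<subseteq> cis ` {s<..<r}"
    proof
      assume "C \<subseteq> cis ` {s<..<r}"
      then have "cis x \<in> cis ` {s<..<r}" using xC by blast
      then obtain y where y: "s < y" "y < r" "cis x = cis y" by auto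
      then show False using cis_eq_near[of x y] x r e by auto
    qed
    ultimately show ?thesis by blast
  qed
  have "cis e \<notin> C" using CZ n by auto
  then have Cse: "C \<subseteq> cis ` {s<..<e}" using sep[of e] x by simp
  \<comment> \<open>The lift of the component is closed; a parameter missing between its extremes
    would separate the component.\<close>
  define R where "R = {r \<in> {s..e}. cis r \<in> C}"
  have "R = {s..e} \<inter> cis -` C" by (auto simp: R_def)
  then have clR: "closed R"
    using continuous_closed_preimage[OF continuous_cis closed_atLeastAtMost[of s e] Ccl] by simp
  have xR: "x \<in> R" using x xC by (simp add: R_def)
  have Rb: "bdd_above R" "bdd_below R" by (auto simp: R_def intro: bdd_aboveI[of _ e] bdd_belowI[of _ s])
  define a b where "a = Inf R" and "b = Sup R"
  have abR: "a \<in> R" "b \<in> R"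
    unfolding a_def b_def using closed_contains_Inf closed_contains_Sup clR xR Rb by blast+
  have ab: "a \<le> r" "r \<le> b" if "r \<in> R" for r
    unfolding a_def b_def using that Rb by (auto intro: cInf_lower cSup_upper)
  have RC: "r \<in> R \<longleftrightarrow> s < r \<and> r < e \<and> cis r \<in> C" for r
  proof
    assume "r \<in> R"
    then have "s \<le> r" "r \<le> e" "cis r \<in> C" by (auto simp: R_def)
    moreover have "r \<noteq> s" "r \<noteq> e" using calculation(3) CZ n by auto
    ultimately show "s < r \<and> r < e \<and> cis r \<in> C" by simp
  qed (simp add: R_def)
  have full: "cis r \<in> C" if r: "a \<le> r" "r \<le> b" for r
  proof (rule ccontr)
    assume nC: "cis r \<notin> C"
    have rse: "s < r" "r < e" using r abR RC[of a] RC[of b] by auto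
    have "r \<noteq> x" using nC xC by auto
    then consider "x < r" | "r < x" by linarith
    then show False
    proof cases
      case 1
      have "cis b \<in> cis ` {s<..<r}" using sep[OF 1 _ nC] rse abR(2) by (auto simp: R_def)
      then obtain y where "s < y" "y < r" "cis b = cis y" by auto
      then show False using cis_eq_near[of b y] RC[of b] abR(2) r e by (auto simp: abs_if)
    next
      case 2
      have "cis a \<in> cis ` {r<..<s + 2 * pi}" using sep'[OF rse(1) 2 nC] abR(1) by (auto simp: R_def)
      then obtain y where "r < y" "y < s + 2 * pi" "cis a = cis y" by auto
      then show False using cis_eq_near[of a y] RC[of a] abR(1) r e by (auto simp: abs_if)
    qed
  qed
  have "C = cis ` {a..b}"
  proof (intro equalityI subsetI)
    fix z assume z: "z \<in> C"
    then have "z \<in> cis ` {s<..<e}" using Cse by blast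
    then obtain r where r: "z = cis r" "r \<in> {s<..<e}" by (rule imageE)
    have "cis r \<in> C" by (rule subst[OF r(1), of "\<lambda>x. x \<in> C"], rule z)
    then have "r \<in> R" using r(2) RC by auto
    then have "r \<in> {a..b}" using ab by auto
    then show "z \<in> cis ` {a..b}" unfolding r(1) by (rule imageI)
  qed (use full in auto)
  moreover have "\<forall>t\<in>{a..b}. u \<bullet> K (cis t) = c"
  proof
    fix t assume "t \<in> {a..b}"
    then have "cis t \<in> ?Z" using full[of t] CZ by (intro subsetD[OF CZ]) simp
    then show "u \<bullet> K (cis t) = c" by simp
  qed
  ultimately show ?thesis
    using comp RC[of a] RC[of b] abR ab[OF xR] by (intro exI[of _ C] exI[of _ a] exI[of _ b]) blast
qed

text \<open>The first time at or below the level starts a component preceded by points above, the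
  last such time ends one followed by points above. The two components may coincide.\<close>

lemma excursion_components:
  assumes st: "s < m" "m < e" "e < s + 2 * pi" and hs: "c < u \<bullet> K (cis s)" "c < u \<bullet> K (cis e)"
    and hm: "u \<bullet> K (cis m) \<le> c"
  shows "\<exists>C\<in>downward_intersections K u c. C \<noteq> {} \<and> C \<subseteq> cis ` {s<..<e}"
    and "\<exists>C\<in>upward_intersections K u c. C \<noteq> {} \<and> C \<subseteq> cis ` {s<..<e}"
proof -
  let ?g = "\<lambda>t. u \<bullet> K (cis t)"
  let ?T = "{t \<in> {s..e}. ?g t \<le> c}"
  have "closed ({s..e} \<inter> ?g -` {..c})"
    by (intro continuous_closed_preimage continuous_height) auto
  moreover have "{s..e} \<inter> ?g -` {..c} = ?T" by auto
  ultimately have clT: "closed ?T" by simp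
  have mT: "m \<in> ?T" using st hm by simp
  have bT: "bdd_below ?T" "bdd_above ?T" by (auto intro: bdd_aboveI[of _ e] bdd_belowI[of _ s])
  \<comment> \<open>By continuity, a value below \<open>c\<close> would exclude values above
    \<open>c\<close> nearby.\<close>
  have lvl: "?g r = c" if r: "r \<in> ?T" and near: "\<And>d. d > 0 \<Longrightarrow> \<exists>t. \<bar>t - r\<bar> < d \<and> c < ?g t" for r
  proof (rule ccontr)
    assume "?g r \<noteq> c"
    then have "?g r < c" using r by simp
    moreover have "isCont ?g r"
      using continuous_height[of UNIV u] by (simp add: continuous_on_eq_continuous_at)
    ultimately have "\<forall>\<^sub>F t in at r. ?g t < c"
      unfolding isCont_def using order_tendstoD(2) by blast
    then obtain d where "d > 0" "\<And>t. t \<noteq> r \<Longrightarrow> dist t r < d \<Longrightarrow> ?g t < c"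
      unfolding eventually_at by blast
    then show False using near[of d] \<open>?g r < c\<close> by (metis dist_real_def not_less_iff_gr_or_eq)
  qed
  define x where "x = Inf ?T"
  have xT: "x \<in> ?T" unfolding x_def using closed_contains_Inf[OF _ bT(1) clT] mT by blast
  have xmin: "x \<le> t" if "t \<in> ?T" for t unfolding x_def using that bT(1) by (rule cInf_lower)
  have sx: "s < x" "x < e" using xT hs by (auto simp: order_le_less)
  have above: "c < ?g t" if "s \<le> t" "t < x" for t
    using xmin[of t] that sx by force
  have gx: "?g x = c"
  proof (rule lvl[OF xT])
    fix d :: real assume "d > 0"
    then show "\<exists>t. \<bar>t - x\<bar> < d \<and> c < ?g t"
      using above[of "max s (x - d/2)"] sx by (intro exI[of _ "max s (x - d/2)"]) (auto simp: abs_if max_def)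
  qed
  have ne: "?g s \<noteq> c" "?g e \<noteq> c" using hs by auto
  obtain C a b where C: "C \<in> intersection_components K u c" "C = cis ` {a..b}" "s < a" "a \<le> x" "x \<le> b" "b < e"
    "\<forall>t\<in>{a..b}. ?g t = c"
    using component_interval[OF sx gx st(3) ne] by blast
  have "a = x"
  proof (rule ccontr)
    assume "a \<noteq> x"
    then have "c < ?g a" using above[of a] C by simp
    then show False using C by auto
  qed
  then have "preceded_by K C {x. u \<bullet> x > c}"
    unfolding preceded_by_def using C(2-6) above sx
    by (intro exI[of _ a] exI[of _ b] exI[of _ "a - s"]) auto
  then have "C \<in> downward_intersections K u c" using C(1) by (simp add: downward_intersections_def)
  moreover have "C \<noteq> {}" "C \<subseteq> cis ` {s<..<e}" using C(2-6) by auto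
  ultimately show "\<exists>C\<in>downward_intersections K u c. C \<noteq> {} \<and> C \<subseteq> cis ` {s<..<e}" by blast
  define y where "y = Sup ?T"
  have yT: "y \<in> ?T" unfolding y_def using closed_contains_Sup[OF _ bT(2) clT] mT by blast
  have ymax: "t \<le> y" if "t \<in> ?T" for t unfolding y_def using that bT(2) by (rule cSup_upper)
  have sy: "s < y" "y < e" using yT hs by (auto simp: order_le_less)
  have above': "c < ?g t" if "y < t" "t \<le> e" for t
    using ymax[of t] that sy by force
  have gy: "?g y = c"
  proof (rule lvl[OF yT])
    fix d :: real assume "d > 0"
    then show "\<exists>t. \<bar>t - y\<bar> < d \<and> c < ?g t"
      using above'[of "min e (y + d/2)"] sy by (intro exI[of _ "min e (y + d/2)"]) (auto simp: abs_if min_def)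
  qed
  obtain C' a' b' where C': "C' \<in> intersection_components K u c" "C' = cis ` {a'..b'}" "s < a'" "a' \<le> y" "y \<le> b'" "b' < e"
    "\<forall>t\<in>{a'..b'}. ?g t = c"
    using component_interval[OF sy gy st(3) ne] by blast
  have "b' = y"
  proof (rule ccontr)
    assume "b' \<noteq> y"
    then have "c < ?g b'" using above'[of b'] C' by simp
    then show False using C' by auto
  qed
  then have "followed_by K C' {x. u \<bullet> x > c}"
    unfolding followed_by_def using C'(2-6) above' sy
    by (intro exI[of _ a'] exI[of _ b'] exI[of _ "e - b'"]) auto
  then have "C' \<in> upward_intersections K u c" using C'(1) by (simp add: upward_intersections_def)
  moreover have "C' \<noteq> {}" "C' \<subseteq> cis ` {s<..<e}" using C'(2-6) by auto
  ultimately show "\<exists>C\<in>upward_intersections K u c. C \<noteq> {} \<and> C \<subseteq> cis ` {s<..<e}" by blast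
qed

lemma card_two_excursions:
  assumes fin: "finite X" and t: "t1 < t3" "t3 < t1 + 2 * pi"
    and 1: "\<exists>C\<in>X. C \<noteq> {} \<and> C \<subseteq> cis ` {t1<..<t3}" and 2: "\<exists>C\<in>X. C \<noteq> {} \<and> C \<subseteq> cis ` {t3<..<t1 + 2 * pi}"
  shows "2 \<le> card X"
proof -
  obtain C D where CD: "C \<in> X" "C \<noteq> {}" "C \<subseteq> cis ` {t1<..<t3}" "D \<in> X" "D \<noteq> {}" "D \<subseteq> cis ` {t3<..<t1 + 2 * pi}"
    using 1 2 by blast
  have "C \<inter> D = {}"
  proof (rule ccontr)
    assume "C \<inter> D \<noteq> {}"
    then obtain z where "z \<in> C" "z \<in> D" by blast
    then have "z \<in> cis ` {t1<..<t3}" "z \<in> cis ` {t3<..<t1 + 2 * pi}" using CD by auto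
    then obtain r r' where "t1 < r" "r < t3" "t3 < r'" "r' < t1 + 2 * pi" "cis r = cis r'" by auto
    then show False using cis_eq_near[of r r'] by auto
  qed
  then have "C \<noteq> D" using CD by blast
  then show ?thesis using card_mono[OF fin, of "{C, D}"] CD by simp
qed

text \<open>Each of the two excursions, over \<open>t2\<close> and over \<open>t4\<close>, gives a
  downward and an upward intersection. If the curve merely touches the plane, these are one
  component, lying in both sets and counted twice.\<close>

lemma cuts_ge_4_above:
  assumes t: "t1 < t2" "t2 < t3" "t3 < t4" "t4 < t1 + 2 * pi"
    and g: "c < u \<bullet> K (cis t1)" "u \<bullet> K (cis t2) \<le> c" "c < u \<bullet> K (cis t3)" "u \<bullet> K (cis t4) \<le> c"
  shows "4 \<le> cuts K u c"
proof -
  have "K (cis t1) \<in> K ` sphere 0 1" by simp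
  then have np: "\<not> K ` sphere 0 1 \<subseteq> {x. u \<bullet> x = c}" using g(1) by force
  show ?thesis
  proof (cases "infinite (intersection_components K u c)")
    case True
    then show ?thesis using np by (simp add: cuts_def)
  next
    case False
    have fin: "finite (upward_intersections K u c)" "finite (downward_intersections K u c)"
      using False by (auto simp: upward_intersections_def downward_intersections_def)
    have a: "t1 < t3" "t3 < t1 + 2 * pi" using t by auto
    have e: "t1 + 2 * pi < t3 + 2 * pi" "c < u \<bullet> K (cis (t1 + 2 * pi))" using t g by auto
    have e13: "t3 < t1 + 2 * pi" using t by simp
    have "2 \<le> card (downward_intersections K u c)"
      by (rule card_two_excursions[OF fin(2) a])
         (use excursion_components(1)[OF t(1,2) e13 g(1,3,2)] excursion_components(1)[OF t(3,4) e(1) g(3) e(2) g(4)] in auto)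
    moreover have "2 \<le> card (upward_intersections K u c)"
      by (rule card_two_excursions[OF fin(1) a])
         (use excursion_components(2)[OF t(1,2) e13 g(1,3,2)] excursion_components(2)[OF t(3,4) e(1) g(3) e(2) g(4)] in auto)
    ultimately have "4 \<le> card (upward_intersections K u c) + card (downward_intersections K u c)" by linarith
    then have "enat 4 \<le> cuts K u c" using np False by (simp add: cuts_def)
    then show ?thesis by (simp add: numeral_eq_enat)
  qed
qed

end

lemma cuts_uminus: "cuts K (- u) (- c) = cuts K u c"
proof -
  have e: "\<And>x. - u \<bullet> x = - c \<longleftrightarrow> u \<bullet> x = c" "\<And>x. - u \<bullet> x < - c \<longleftrightarrow> u \<bullet> x > c" "\<And>x. - u \<bullet> x > - c \<longleftrightarrow> u \<bullet> x < c"
    by auto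
  have "upward_intersections K (- u) (- c) = downward_intersections K u c"
    "downward_intersections K (- u) (- c) = upward_intersections K u c"
    unfolding upward_intersections_def downward_intersections_def intersection_components_def e by auto
  then show ?thesis
    unfolding cuts_def intersection_components_def e by (simp add: add.commute)
qed

section \<open>Inscribed polygons\<close>

text \<open>Skipping the constant run at the front uses up exactly one change.\<close>

lemma changes_first:
  fixes x :: "'a::linorder"
  assumes "sorted_wrt (<) (x # xs)" "1 \<le> changes (map P (x # xs))"
  shows "\<exists>y ys. x < y \<and> y \<in> set xs \<and> P y \<noteq> P x \<and> sorted_wrt (<) (y # ys) \<and> set ys \<subseteq> set xs \<and>
    changes (map P (x # xs)) = Suc (changes (map P (y # ys)))"
  using assms
proof (induction xs arbitrary: x)
  case (Cons z zs)
  show ?case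
  proof (cases "P z = P x")
    case False
    then show ?thesis using Cons.prems by (intro exI[of _ z] exI[of _ zs]) auto
  next
    case True
    have "sorted_wrt (<) (z # zs)" "x < z" using Cons.prems(1) by auto
    moreover have e: "changes (map P (x # z # zs)) = changes (map P (z # zs))" using True by simp
    ultimately obtain y ys where y: "z < y" "y \<in> set zs" "P y \<noteq> P z" "sorted_wrt (<) (y # ys)" "set ys \<subseteq> set zs"
      "changes (map P (z # zs)) = Suc (changes (map P (y # ys)))"
      using Cons.IH[of z] Cons.prems(2) by (metis (no_types, lifting))
    moreover have "x < y" using y(1) \<open>x < z\<close> by simp
    ultimately show ?thesis using e True by (intro exI[of _ y] exI[of _ ys]) auto
  qed
qed simp

lemma changes_ge_3_alternating:
  fixes ts :: "'a::linorder list"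
  assumes s: "sorted_wrt (<) ts" and ch: "3 \<le> changes (map P ts)"
  shows "\<exists>a b c d. {a, b, c, d} \<subseteq> set ts \<and> a < b \<and> b < c \<and> c < d \<and> P a \<noteq> P b \<and> P b \<noteq> P c \<and> P c \<noteq> P d"
proof -
  obtain a xs where a: "ts = a # xs" using ch by (cases ts) auto
  obtain b ys where b: "a < b" "b \<in> set xs" "P b \<noteq> P a" "sorted_wrt (<) (b # ys)" "set ys \<subseteq> set xs"
    "changes (map P ts) = Suc (changes (map P (b # ys)))"
  proof -
    have "sorted_wrt (<) (a # xs)" "1 \<le> changes (map P (a # xs))" using s ch a by simp_all
    from changes_first[OF this] show thesis using that unfolding a by blast
  qed
  obtain c zs where c: "b < c" "c \<in> set ys" "P c \<noteq> P b" "sorted_wrt (<) (c # zs)" "set zs \<subseteq> set ys"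
    "changes (map P (b # ys)) = Suc (changes (map P (c # zs)))"
  proof -
    have "1 \<le> changes (map P (b # ys))" using b(6) ch by simp
    from changes_first[OF b(4) this] show thesis using that by blast
  qed
  obtain d ws where d: "c < d" "d \<in> set zs" "P d \<noteq> P c"
  proof -
    have "1 \<le> changes (map P (c # zs))" using c(6) b(6) ch by simp
    from changes_first[OF c(4) this] show thesis using that by blast
  qed
  show ?thesis
    by (intro exI[of _ a] exI[of _ b] exI[of _ c] exI[of _ d]) (use a b(1,2,3,5) c(1,2,3,5) d in auto)
qed

text \<open>If the first time is not above the level, the cyclic shift \<open>t2\<close>,
  \<open>t3\<close>, \<open>t4\<close>, \<open>t1 + 2 * pi\<close> starts above.\<close>

lemma cuts_ge_4_alternating:
  assumes K: "closed_curve K" and t: "t1 < t2" "t2 < t3" "t3 < t4" "t4 < t1 + 2 * pi"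
    and alt: "(c < u \<bullet> K (cis t1)) \<noteq> (c < u \<bullet> K (cis t2))" "(c < u \<bullet> K (cis t2)) \<noteq> (c < u \<bullet> K (cis t3))"
      "(c < u \<bullet> K (cis t3)) \<noteq> (c < u \<bullet> K (cis t4))"
  shows "4 \<le> cuts K u c"
proof (cases "c < u \<bullet> K (cis t1)")
  case True
  then show ?thesis using cuts_ge_4_above[OF K t, of c u] alt by auto
next
  case False
  have "t1 + 2 * pi < t2 + 2 * pi" "t4 < t1 + 2 * pi" using t by auto
  then show ?thesis using cuts_ge_4_above[OF K t(2,3), of "t1 + 2 * pi" c u] alt False by auto
qed

text \<open>Three changes give four alternating times. The first and the last are on different
  sides, so they are not a full turn apart and give four cyclically ordered points of the
  curve.\<close>

lemma changes_inscribed: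
  assumes K: "closed_curve K" and s: "sorted_wrt (<) ts" and ne: "ts \<noteq> []" and ts: "set ts \<subseteq> {hd ts..<hd ts + 2 * pi}"
    and n: "\<not> 4 \<le> cuts K u c"
  shows "changes (map (\<lambda>x. c < u \<bullet> x) (map (\<lambda>t. K (cis t)) (ts @ [hd ts + 2 * pi]))) \<le> 2"
proof (rule ccontr)
  assume "\<not> ?thesis"
  then have ch: "3 \<le> changes (map (\<lambda>t. c < u \<bullet> K (cis t)) (ts @ [hd ts + 2 * pi]))"
    by (simp add: comp_def)
  have "sorted_wrt (<) (ts @ [hd ts + 2 * pi])" using s ts by (auto simp: sorted_wrt_append)
  from changes_ge_3_alternating[OF this ch]
  obtain t1 t2 t3 t4 where t: "{t1, t2, t3, t4} \<subseteq> set (ts @ [hd ts + 2 * pi])" "t1 < t2" "t2 < t3" "t3 < t4"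
    and alt: "(c < u \<bullet> K (cis t1)) \<noteq> (c < u \<bullet> K (cis t2))" "(c < u \<bullet> K (cis t2)) \<noteq> (c < u \<bullet> K (cis t3))"
      "(c < u \<bullet> K (cis t3)) \<noteq> (c < u \<bullet> K (cis t4))" by blast
  have in_window: "hd ts \<le> t" "t \<le> hd ts + 2 * pi" if "t \<in> set (ts @ [hd ts + 2 * pi])" for t
    using that ts by (auto simp: less_imp_le)
  have "hd ts \<le> t1" "t4 \<le> hd ts + 2 * pi" using in_window t(1) by auto
  moreover have "t4 \<noteq> t1 + 2 * pi"
  proof
    assume "t4 = t1 + 2 * pi"
    then have "cis t4 = cis t1" by simp
    then show False using alt by auto
  qed
  ultimately have "t4 < t1 + 2 * pi" by linarith
  then show False using cuts_ge_4_alternating[OF K t(2-4) _ alt] n by blast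
qed

text \<open>Vertices strictly below the plane are strictly above it for the opposite orientation,
  which has the same number of cuts.\<close>

lemma good_inscribed:
  assumes K: "closed_curve K" and s: "sorted_wrt (<) ts" and ne: "ts \<noteq> []" and ts: "set ts \<subseteq> {hd ts..<hd ts + 2 * pi}"
    and n: "\<not> 4 \<le> cuts K u c"
  shows "good (map (\<lambda>t. K (cis t)) (ts @ [hd ts + 2 * pi])) u c"
proof -
  have "changes (map (\<lambda>x. - c < - u \<bullet> x) (map (\<lambda>t. K (cis t)) (ts @ [hd ts + 2 * pi]))) \<le> 2"
    by (rule changes_inscribed[OF K s ne ts]) (use n in \<open>simp add: cuts_uminus\<close>)
  then show ?thesis
    unfolding good_def using changes_inscribed[OF assms] by (simp only: inner_minus_left neg_less_iff_less)
qed

section \<open>From simple polygonal paths to embedded vertex lists\<close>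

lemma polygonal_path_pline:
  assumes "2 \<le> length xs"
  shows "pathstart (polygonal_path xs) = hd xs \<and> pathfinish (polygonal_path xs) = last xs \<and>
    path_image (polygonal_path xs) = pline xs"
  using assms
proof (induction xs rule: polygonal_path.induct)
  case (4 a b c vs)
  then show ?case by (simp add: path_image_join)
qed auto

lemma emb_of_arc:
  assumes "2 \<le> length xs" "arc (polygonal_path xs)"
  shows "emb xs"
  using assms
proof (induction xs rule: polygonal_path.induct)
  case (3 a b)
  then show ?case using arc_distinct_ends[of "linepath a b"] by auto
next
  case (4 a b c vs)
  have p: "pathstart (polygonal_path (b # c # vs)) = b" "path_image (polygonal_path (b # c # vs)) = pline (b # c # vs)"
    using polygonal_path_pline[of "b # c # vs"] by auto
  have "arc (linepath a b) \<and> arc (polygonal_path (b # c # vs)) \<and> path_image (linepath a b) \<inter> path_image (polygonal_path (b # c # vs)) \<subseteq> {b}"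
    using 4(3) arc_join_eq[of "linepath a b" "polygonal_path (b # c # vs)"] p(1) by simp
  moreover from this have "a \<noteq> b" using arc_distinct_ends[of "linepath a b"] by auto
  ultimately show ?case using 4(1) p(2) by auto
qed auto

lemma not_simple_path_constant: "\<not> simple_path (linepath a a)"
proof
  assume "simple_path (linepath a a)"
  then have "loop_free (linepath a a)" by (simp add: simple_path_def)
  \<comment> \<open>Two inner parameters with the same value violate
    \<open>loop_free\<close>.\<close>
  then have "(1/4 :: real) = 1/2 \<or> (1/4 :: real) = 0 \<and> (1/2 :: real) = 1 \<or> (1/4 :: real) = 1 \<and> (1/2 :: real) = 0"
    unfolding loop_free_def by (elim ballE[of _ _ "1/4"] ballE[of _ _ "1/2"]) (auto simp: linepath_refl)
  then show False by simp
qed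

lemma closed_emb_of_simple_path:
  assumes "simple_path (closed_polygon vs)"
  shows "closed_emb vs" "3 \<le> length vs" "path_image (closed_polygon vs) = pline (vs @ [hd vs])"
proof -
  have "vs \<noteq> []"
  proof
    assume "vs = []"
    then have "closed_polygon vs = linepath (hd []) (hd [])" by (simp add: closed_polygon_def)
    then show False using assms by (simp add: not_simple_path_constant)
  qed
  moreover have "tl vs \<noteq> []"
  proof
    assume "tl vs = []"
    then obtain a where "vs = [a]" using \<open>vs \<noteq> []\<close> by (cases vs) auto
    then have "closed_polygon vs = linepath a a" by (simp add: closed_polygon_def)
    then show False using assms by (simp add: not_simple_path_constant)
  qed
  ultimately obtain a b ys where vs: "vs = a # b # ys" by (cases vs; cases "tl vs") auto
  have len: "2 \<le> length (b # ys @ [a])" by simp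
  obtain c r where cr: "ys @ [a] = c # r" by (cases "ys @ [a]") auto
  have cp: "closed_polygon vs = linepath a b +++ polygonal_path (b # ys @ [a])"
    unfolding closed_polygon_def vs by (simp add: cr)
  have pp: "pathstart (polygonal_path (b # ys @ [a])) = b" "pathfinish (polygonal_path (b # ys @ [a])) = a"
    "path_image (polygonal_path (b # ys @ [a])) = pline (b # ys @ [a])"
    using polygonal_path_pline[OF len] by auto
  have "arc (linepath a b) \<and> arc (polygonal_path (b # ys @ [a])) \<and>
     path_image (linepath a b) \<inter> path_image (polygonal_path (b # ys @ [a])) \<subseteq> {a, b}"
    using assms simple_path_join_loop_eq[of "polygonal_path (b # ys @ [a])" "linepath a b"] pp unfolding cp by simp
  moreover from this have "a \<noteq> b" using arc_distinct_ends[of "linepath a b"] by auto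
  ultimately have j: "a \<noteq> b" "emb (b # ys @ [a])" "closed_segment a b \<inter> pline (b # ys @ [a]) \<subseteq> {a, b}"
    using emb_of_arc[OF len] pp by auto
  then show "closed_emb vs" by (simp add: vs)
  show "path_image (closed_polygon vs) = pline (vs @ [hd vs])"
    unfolding cp using pp cr by (simp add: vs path_image_join)
  show "3 \<le> length vs"
  proof (rule ccontr)
    assume "\<not> 3 \<le> length vs"
    then have "ys = []" using vs by (cases ys) auto
    \<comment> \<open>With two vertices the second edge retraces the first.\<close>
    then have "closed_segment a b \<subseteq> {a, b}" using j(3) by (auto simp: closed_segment_commute)
    then have "midpoint a b \<in> {a, b}" by (meson midpoint_in_closed_segment subsetD)
    then show False using j(1) by auto
  qed
qed

theorem mainTheorem1:
  fixes K :: "complex \<Rightarrow> real ^ 3"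
  assumes "closed_curve K"
    and "\<exists>vs. inscribed_polygon K vs \<and> knotted_polygon vs"
  shows "hull_n 2 K \<noteq> {}"
proof
  assume empty: "hull_n 2 K = {}"
  obtain vs where vs: "inscribed_polygon K vs" "knotted_polygon vs" using assms(2) by blast
  have simple: "simple_path (closed_polygon vs)" and knot: "\<not> trivial_knot (path_image (closed_polygon vs))"
    using vs(2) by (simp_all add: knotted_polygon_def)
  note poly = closed_emb_of_simple_path[OF simple]
  obtain a ts where ts: "sorted_wrt (<) ts" "set ts \<subseteq> {a..<a + 2 * pi}" "vs = map (\<lambda>t. K (cis t)) ts"
    using vs(1) unfolding inscribed_polygon_def by blast
  have "ts \<noteq> []" using poly(2) ts(3) by auto
  define M where "M = Max ((\<lambda>t. norm (K (cis t))) ` set ts)"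
  have "M \<in> (\<lambda>t. norm (K (cis t))) ` set ts" unfolding M_def using \<open>ts \<noteq> []\<close> by (intro Max_in) auto
  then obtain t where t: "t \<in> set ts" "norm (K (cis t)) = M" by auto
  have far: "norm (K (cis r)) \<le> norm (K (cis t))" if "r \<in> set ts" for r
    unfolding t(2) M_def using that by (intro Max_ge) auto
  obtain l r where lr: "ts = l @ t # r" using t(1) by (meson split_list)
  \<comment> \<open>The times before \<open>t\<close> are moved to the next turn, so that the list
    starts at the farthest vertex and still increases within one period.\<close>
  define ts' where "ts' = t # r @ map (\<lambda>x. x + 2 * pi) l"
  have srt: "sorted_wrt (<) l" "sorted_wrt (<) (t # r)" "\<And>x y. x \<in> set l \<Longrightarrow> y \<in> set (t # r) \<Longrightarrow> x < y"
    using ts(1) unfolding lr sorted_wrt_append by auto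
  have win: "a \<le> x" "x < a + 2 * pi" if "x \<in> set l \<or> x \<in> set (t # r)" for x
    using ts(2) that unfolding lr by auto
  have sl: "sorted_wrt (<) (map (\<lambda>x. x + 2 * pi) l)" using srt(1) by (simp add: sorted_wrt_map)
  have cross: "y < x + 2 * pi" if "x \<in> set l" "y \<in> set (t # r)" for x y
    using win(1)[of x] win(2)[of y] that by auto
  have sorted': "sorted_wrt (<) ts'"
    unfolding ts'_def using srt(2) sl cross by (auto simp: sorted_wrt_append)
  have hd': "hd ts' = t" by (simp add: ts'_def)
  have win': "set ts' \<subseteq> {hd ts'..<hd ts' + 2 * pi}"
    unfolding hd' ts'_def using srt(2,3) cross win by (fastforce simp: less_imp_le)
  let ?f = "\<lambda>t. K (cis t)"
  have vs': "vs = map ?f l @ ?f t # map ?f r" using ts(3) lr by simp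
  have rot: "closed_emb (?f t # map ?f r @ map ?f l)"
    "pline (?f t # map ?f r @ map ?f l @ [?f t]) = path_image (closed_polygon vs)"
    using closed_emb_rotate[of "map ?f l" "?f t" "map ?f r"] poly vs' by auto
  have "3 \<le> length (?f t # map ?f r @ map ?f l)" using poly(2) vs' by simp
  then obtain b ys where bys: "map ?f r @ map ?f l = b # ys" "ys \<noteq> []"
  proof -
    obtain b ys where "map ?f r @ map ?f l = b # ys"
      using \<open>3 \<le> length (?f t # map ?f r @ map ?f l)\<close> by (cases "map ?f r @ map ?f l") simp_all
    moreover from this have "ys \<noteq> []"
      using \<open>3 \<le> length (?f t # map ?f r @ map ?f l)\<close> by (cases ys) simp_all
    ultimately show thesis by (rule that)
  qed
  \<comment> \<open>The final time is one full turn after the first, so it repeats the first vertex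
    and closes the list.\<close>
  have map': "map ?f (ts' @ [hd ts' + 2 * pi]) = ?f t # b # ys @ [?f t]"
    using bys(1) by (simp add: hd' ts'_def comp_def)
  have "trivial_knot (pline (?f t # b # ys @ [?f t]))"
  proof (rule trivial_knot_of_good_planes_rotated[OF _ bys(2)])
    show "closed_emb (?f t # b # ys)" using rot(1) bys(1) by simp
    show "norm x \<le> norm (?f t)" if "x \<in> set (b # ys)" for x
    proof -
      have "x \<in> set (map ?f r @ map ?f l)" using that bys(1) by simp
      then show ?thesis using far lr by auto
    qed
    show "\<exists>h. h \<noteq> 0 \<and> good (?f t # b # ys @ [?f t]) h (h \<bullet> p)" for p
    proof -
      have "p \<notin> hull_n 2 K" using empty by simp
      then obtain u where u: "u \<noteq> 0" "\<not> enat (2 * 2) \<le> cuts K u (u \<bullet> p)"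
        unfolding hull_n_def by blast
      have "\<not> 4 \<le> cuts K u (u \<bullet> p)" using u(2) by (simp add: numeral_eq_enat)
      from good_inscribed[OF assms(1) sorted' _ win' this] show ?thesis
        using u(1) unfolding map' by (intro exI[of _ u]) (simp add: ts'_def)
    qed
  qed
  moreover have "?f t # b # ys @ [?f t] = ?f t # map ?f r @ map ?f l @ [?f t]"
    using bys(1) by (metis append_Cons append_assoc)
  ultimately have "trivial_knot (path_image (closed_polygon vs))" using rot(2) by simp
  then show False using knot by blast
qed

end
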